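(* Let $\mathbb K$ be a field of characteristic $0$, $I$ a set, $\mathcal E=\{E_i\}_{i\in I}$ a family of finite sets, and for each $i\in I$ let $\Lambda_i:\mathbb K[\mathbf L_i]\to\mathbb K[L]$ be a 1-cocycle, where $\mathbf L_i=(L_e)_{e\in E_i}$, with associated coefficients $a_{i,\alpha}$ ($\alpha\in\mathbb Z_{\ge0}^{E_i}$). The unique algebra morphism $\phi:\widetilde{\mathcal H}_{I,\mathcal E}\to\mathbb K[L]$ satisfying $\phi\,\tilde B_+^{(i)}=\Lambda_i\,\phi^{\otimes E_i}$ for all $i\in I$ (identifying $\mathbb K[L]^{\otimes E_i}$ with $\mathbb K[\mathbf L_i]$) is given on $(I,\mathcal E)$-trees $t$ by $$\phi(t)=\sum_{\tau\in\mathrm{Tub}(t)}\mathrm{mel}(\tau)\sum_{k=1}^{b(\tau)}a_{d(t),\beta^k(\tau)}\frac{L^k}{k!}.$$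
   Context: **1-cocycles.** $\mathbb K[L]$ is the Hopf algebra with $\Delta L=L\otimes1+1\otimes L$. $\mathbb K[\mathbf L_i]\cong\mathbb K[L]^{\otimes E_i}$ is a left $\mathbb K[L]$-comodule via $\delta(\mathbf L^\alpha)=\sum_{\beta\le\alpha}\binom{\alpha}{\beta}L^{|\alpha|-|\beta|}\otimes\mathbf L^\beta$. A 1-cocycle is a linear map $\Lambda:\mathbb K[\mathbf L_i]\to\mathbb K[L]$ with $\Delta\Lambda=\Lambda\otimes1+(\mathrm{id}\otimes\Lambda)\delta$. Every 1-cocycle has the form $\Lambda_if=\int_0^LA_i(\partial/\partial u_e:e\in E_i)f(\mathbf u)\big|_{u_e=u\ \forall e}\,du$ for a unique $A_i\in\mathbb K[[\mathbf L_i]]$; write $A_i(\mathbf L_i)=\sum_{\alpha\in\mathbb Z_{\ge0}^{E_i}}a_{i,\alpha}\binom{|\alpha|}{\alpha}\mathbf L_i^\alpha$ with $\binom{|\alpha|}{\alpha}$ the multinomial coefficient. **Trees.** A rooted forest is a finite poset in which each element is covered by at most one element; a rooted tree is a connected nonempty rooted forest (its greatest element is the root $\mathrm{rt}\,t$). Elements are vertices, covering relations are edges. An $(I,\mathcal E)$-tree (forest) is a rooted tree (forest) with each vertex $v$ decorated by some $d(v)\in I$ and each edge from a parent $v$ to a child decorated by an element of $E_{d(v)}$; $d(t)$ denotes the decoration of the root of $t$. $\widetilde{\mathcal H}_{I,\mathcal E}$ is the vector space with basis the isomorphism classes of $(I,\mathcal E)$-forests, a bialgebra with disjoint union as product and coproduct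 $\Delta(F)=\sum_{D\text{ downset of }F}D\otimes(F\setminus D)$ (keeping decorations on vertices and remaining edges). $\tilde B_+^{(i)}:\widetilde{\mathcal H}_{I,\mathcal E}^{\otimes E_i}\to\widetilde{\mathcal H}_{I,\mathcal E}$ sends $\bigotimes_{e\in E_i}f_e$ to the tree obtained from the disjoint union of the $f_e$ by adding a new root decorated $i$, joined to the root of each component of $f_e$ by an edge decorated $e$. **Tubings.** A tube of $t$ is a nonempty set of vertices inducing a connected subgraph; a tubing is a set of tubes any two of which are disjoint or nested. $\mathrm{Tub}(t)$ is the set of binary tubings, i.e. inclusion-maximal tubings. In a binary tubing $\tau$, $t\in\tau$ and every non-singleton tube $X\in\tau$ has exactly two maximal proper subtubes in $\tau$; they partition $X$, one is a downset of $X$ (a lower tube), the other an upset of $X$ (an upper tube); $t$ itself counts as a lower tube. If $t'\in\tau$ is an upper tube and $t''$ is the corresponding lower tube ($t'\cup t''\in\tau$), the type of $t'$ is the decoration of the first edge on the path from the root of $t'$ to the root of $t''$. For a vertex $v$ and $e\in E_{d(v)}$, $\mathrm{rk}_e(\tau,v)$ is the number of upper tubes of type $e$ in $\tau$ with root $v$, and $\mathbf{rk}(\tau,v)=(\mathrm{rk}_e(\tau,v))_{e\in E_{d(v)}}$. $b(\tau)$ is the number of tubes of $\tau$ containing $\mathrm{rt}\,t$. For $1\le k\le b(\tau)$, $\beta^k(\tau)\in\mathbb Z_{\ge0}^{E_{d(t)}}$ has $e$-component the number of upper tubes of type $e$ containing $\mathrm{rt}\,t$, excluding the outermost $k-1$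 upper tubes containing $\mathrm{rt}\,t$. The Mellin monomial is $\mathrm{mel}(\tau)=\prod_{v\in t,\,v\ne\mathrm{rt}\,t}a_{d(v),\mathbf{rk}(\tau,v)}$. *)

theory Defs
  imports
    "HOL-Computational_Algebra.Polynomial"
    "HOL-Library.Poly_Mapping"
    "HOL-Library.Countable_Set"
    "HOL-Library.FuncSet"
begin

text \<open>
  A multi-index is an element of \<^typ>\<open>'e \<Rightarrow>\<^sub>0 nat\<close>, and \<open>K[L\<^sub>e : e \<in> E]\<close> is the set of those
  elements of the monoid algebra \<^typ>\<open>('e \<Rightarrow>\<^sub>0 nat) \<Rightarrow>\<^sub>0 'k\<close> in which only variables from \<open>E\<close> occur.
\<close>

type_synonym 'e mindex = "'e \<Rightarrow>\<^sub>0 nat"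
type_synonym ('e, 'k) mpol = "('e \<Rightarrow>\<^sub>0 nat) \<Rightarrow>\<^sub>0 'k"

abbreviation lookup where "lookup \<equiv> Poly_Mapping.lookup"
abbreviation keys where "keys \<equiv> Poly_Mapping.keys"
abbreviation single where "single \<equiv> Poly_Mapping.single"

definition mi_le :: "'e mindex \<Rightarrow> 'e mindex \<Rightarrow> bool" where
  "mi_le \<beta> \<alpha> \<longleftrightarrow> (\<forall>e. lookup \<beta> e \<le> lookup \<alpha> e)"

definition mi_deg :: "'e mindex \<Rightarrow> nat" where
  "mi_deg \<alpha> = (\<Sum>e\<in>keys \<alpha>. lookup \<alpha> e)"

definition mi_choose :: "'e mindex \<Rightarrow> 'e mindex \<Rightarrow> nat" where
  "mi_choose \<alpha> \<beta> = (\<Prod>e\<in>keys \<alpha>. lookup \<alpha> e choose lookup \<beta> e)"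

definition multinomial :: "'e mindex \<Rightarrow> 'k::field_char_0" where
  "multinomial \<alpha> = fact (mi_deg \<alpha>) / (\<Prod>e\<in>keys \<alpha>. fact (lookup \<alpha> e))"

definition mpol_on :: "'e set \<Rightarrow> ('e, 'k::zero) mpol set" where
  "mpol_on E = {f. \<forall>\<alpha>\<in>keys f. keys \<alpha> \<subseteq> E}"

definition scale :: "'k::comm_semiring_1 \<Rightarrow> ('a \<Rightarrow>\<^sub>0 'k) \<Rightarrow> ('a \<Rightarrow>\<^sub>0 'k)" where
  "scale c f = Poly_Mapping.map ((*) c) f"

text \<open>
  The tensor product \<open>K[L] \<otimes> K[L]\<close> is \<^typ>\<open>'k poly poly\<close>, the outer variable being that of the
  second factor, and \<open>K[L] \<otimes> K[L\<^sub>e : e \<in> E]\<close> consists of polynomials in the \<open>L\<^sub>e\<close> with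
  coefficients in \<open>K[L]\<close>: the coefficient \<open>p\<close> at \<open>\<beta>\<close> contributes the pure tensor of \<open>p\<close>
  and the monomial with exponent \<open>\<beta>\<close>.
\<close>

definition ptensor :: "'k::comm_ring_1 poly \<Rightarrow> 'k poly \<Rightarrow> 'k poly poly" where
  "ptensor p q = map_poly (\<lambda>c. smult c p) q"

text \<open>The algebra morphism with \<open>\<Delta> L = L \<otimes> 1 + 1 \<otimes> L\<close>.\<close>

definition Delta :: "'k::comm_ring_1 poly \<Rightarrow> 'k poly poly" where
  "Delta p = poly (map_poly (\<lambda>c. [:[:c:]:]) p) (ptensor [:0, 1:] 1 + ptensor 1 [:0, 1:])"

definition coaction_mono :: "'e mindex \<Rightarrow> ('e, 'k::comm_ring_1 poly) mpol" where
  "coaction_mono \<alpha> =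
     (\<Sum>\<beta> | mi_le \<beta> \<alpha>. single \<beta> (monom (of_nat (mi_choose \<alpha> \<beta>)) (mi_deg \<alpha> - mi_deg \<beta>)))"

definition coaction :: "('e, 'k::comm_ring_1) mpol \<Rightarrow> ('e, 'k poly) mpol" where
  "coaction f = (\<Sum>\<alpha>\<in>keys f. scale [:lookup f \<alpha>:] (coaction_mono \<alpha>))"

definition id_tensor ::
  "(('e, 'k::comm_ring_1) mpol \<Rightarrow> 'k poly) \<Rightarrow> ('e, 'k poly) mpol \<Rightarrow> 'k poly poly" where
  "id_tensor \<Lambda> g = (\<Sum>\<beta>\<in>keys g. ptensor (lookup g \<beta>) (\<Lambda> (single \<beta> 1)))"

definition one_cocycle :: "'e set \<Rightarrow> (('e, 'k::comm_ring_1) mpol \<Rightarrow> 'k poly) \<Rightarrow> bool" where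
  "one_cocycle E \<Lambda> \<longleftrightarrow>
     (\<forall>f\<in>mpol_on E. \<forall>g\<in>mpol_on E. \<Lambda> (f + g) = \<Lambda> f + \<Lambda> g) \<and>
     (\<forall>c. \<forall>f\<in>mpol_on E. \<Lambda> (scale c f) = smult c (\<Lambda> f)) \<and>
     (\<forall>f\<in>mpol_on E. Delta (\<Lambda> f) = ptensor (\<Lambda> f) 1 + id_tensor \<Lambda> (coaction f))"

text \<open>The iterated partial derivative of \<open>f\<close> that differentiates \<open>\<alpha> e\<close> times in \<open>L\<^sub>e\<close>.\<close>

definition mpderiv :: "'e mindex \<Rightarrow> ('e, 'k::comm_ring_1) mpol \<Rightarrow> ('e, 'k) mpol" where
  "mpderiv \<alpha> f = (\<Sum>\<gamma>\<in>keys f. if mi_le \<alpha> \<gamma>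
     then single (\<gamma> - \<alpha>)
       (lookup f \<gamma> * of_nat (\<Prod>e\<in>keys \<alpha>. \<Prod>j<lookup \<alpha> e. lookup \<gamma> e - j))
     else 0)"

definition diag :: "('e, 'k::comm_ring_1) mpol \<Rightarrow> 'k poly" where
  "diag f = (\<Sum>\<gamma>\<in>keys f. monom (lookup f \<gamma>) (mi_deg \<gamma>))"

definition poly_integral :: "'k::field_char_0 poly \<Rightarrow> 'k poly" where
  "poly_integral p = (\<Sum>n\<le>degree p. monom (coeff p n / of_nat (Suc n)) (Suc n))"

text \<open>
  \<open>A(\<partial>) f\<close> for a formal power series given by its coefficient function \<open>A\<close>;
  only finitely many terms of the sum are nonzero.
\<close>

definition diff_op :: "('e mindex \<Rightarrow> 'k) \<Rightarrow> ('e, 'k::comm_ring_1) mpol \<Rightarrow> ('e, 'k) mpol" where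
  "diff_op A f = Sum_any (\<lambda>\<alpha>. scale (A \<alpha>) (mpderiv \<alpha> f))"

definition cocycle_coeffs ::
  "'e set \<Rightarrow> (('e, 'k::field_char_0) mpol \<Rightarrow> 'k poly) \<Rightarrow> ('e mindex \<Rightarrow> 'k) \<Rightarrow> bool" where
  "cocycle_coeffs E \<Lambda> a \<longleftrightarrow>
     (\<forall>\<alpha>. \<not> keys \<alpha> \<subseteq> E \<longrightarrow> a \<alpha> = 0) \<and>
     (\<forall>f\<in>mpol_on E.
        \<Lambda> f = poly_integral (diag (diff_op (\<lambda>\<alpha>. a \<alpha> * multinomial \<alpha>) f)))"


text \<open>
  The root of a tree is the greatest element. An edge is a pair (parent, child); \<open>edec\<close> matters
  only on edges.
\<close>

record ('v, 'i, 'e) forest =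
  verts :: "'v set"
  leq :: "'v rel"
  vdec :: "'v \<Rightarrow> 'i"
  edec :: "'v \<times> 'v \<Rightarrow> 'e"

definition edges :: "('v, 'i, 'e) forest \<Rightarrow> 'v rel" where
  "edges F = {(v, w). (w, v) \<in> leq F \<and> w \<noteq> v \<and>
     \<not> (\<exists>z. z \<noteq> v \<and> z \<noteq> w \<and> (w, z) \<in> leq F \<and> (z, v) \<in> leq F)}"

definition rooted_forest :: "('v, 'i, 'e) forest \<Rightarrow> bool" where
  "rooted_forest F \<longleftrightarrow> finite (verts F) \<and> partial_order_on (verts F) (leq F) \<and>
     (\<forall>u v w. (u, w) \<in> edges F \<and> (v, w) \<in> edges F \<longrightarrow> u = v)"

definition induces_connected :: "('v, 'i, 'e) forest \<Rightarrow> 'v set \<Rightarrow> bool" where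
  "induces_connected F X \<longleftrightarrow>
     (\<forall>x\<in>X. \<forall>y\<in>X. (x, y) \<in> ((edges F \<union> (edges F)\<inverse>) \<inter> X \<times> X)\<^sup>*)"

definition rooted_tree :: "('v, 'i, 'e) forest \<Rightarrow> bool" where
  "rooted_tree F \<longleftrightarrow> rooted_forest F \<and> verts F \<noteq> {} \<and> induces_connected F (verts F)"

definition well_decorated :: "'i set \<Rightarrow> ('i \<Rightarrow> 'e set) \<Rightarrow> ('v, 'i, 'e) forest \<Rightarrow> bool" where
  "well_decorated I E F \<longleftrightarrow> (\<forall>v\<in>verts F. vdec F v \<in> I) \<and>
     (\<forall>(v, w)\<in>edges F. edec F (v, w) \<in> E (vdec F v))"

definition iso_map :: "('v \<Rightarrow> 'w) \<Rightarrow> ('v, 'i, 'e) forest \<Rightarrow> ('w, 'i, 'e) forest \<Rightarrow> bool" where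
  "iso_map h F G \<longleftrightarrow> bij_betw h (verts F) (verts G) \<and>
     (\<forall>x\<in>verts F. \<forall>y\<in>verts F. (x, y) \<in> leq F \<longleftrightarrow> (h x, h y) \<in> leq G) \<and>
     (\<forall>x\<in>verts F. vdec G (h x) = vdec F x) \<and>
     (\<forall>(x, y)\<in>edges F. edec G (h x, h y) = edec F (x, y))"

definition forest_iso :: "('v, 'i, 'e) forest \<Rightarrow> ('w, 'i, 'e) forest \<Rightarrow> bool" where
  "forest_iso F G \<longleftrightarrow> (\<exists>h. iso_map h F G)"


definition empty_forest :: "('v, 'i, 'e) forest" where
  "empty_forest = \<lparr>verts = {}, leq = {}, vdec = (\<lambda>_. undefined), edec = (\<lambda>_. undefined)\<rparr>"

lemma leq_verts:
  assumes "rooted_forest F" "(x, y) \<in> leq F"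
  shows "x \<in> verts F" "y \<in> verts F"
proof -
  have "leq F \<subseteq> verts F \<times> verts F"
    using assms(1) unfolding rooted_forest_def by (blast dest: partial_order_onD(4))
  then show "x \<in> verts F" "y \<in> verts F"
    using assms(2) by blast+
qed

lemma edges_verts:
  assumes "rooted_forest F" "(x, y) \<in> edges F"
  shows "x \<in> verts F" "y \<in> verts F"
proof -
  have "(y, x) \<in> leq F" using assms(2) by (simp add: edges_def)
  then show "x \<in> verts F" "y \<in> verts F"
    using leq_verts[OF assms(1)] by blast+
qed

lemma parent_unique:
  assumes "rooted_forest F" "(u, w) \<in> edges F" "(v, w) \<in> edges F"
  shows "u = v"
  using assms unfolding rooted_forest_def by blast

lemma iso_edges:
  assumes F: "rooted_forest F" and G: "rooted_forest G"
    and h: "bij_betw h (verts F) (verts G)"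
    and le: "\<And>x y. x \<in> verts F \<Longrightarrow> y \<in> verts F \<Longrightarrow> (x, y) \<in> leq F \<longleftrightarrow> (h x, h y) \<in> leq G"
    and xy: "x \<in> verts F" "y \<in> verts F"
  shows "(x, y) \<in> edges F \<longleftrightarrow> (h x, h y) \<in> edges G"
proof -
  have inj: "h u = h v \<longleftrightarrow> u = v" if "u \<in> verts F" "v \<in> verts F" for u v
    using h that by (auto simp: bij_betw_def inj_on_def)
  have "(\<exists>z. z \<noteq> x \<and> z \<noteq> y \<and> (y, z) \<in> leq F \<and> (z, x) \<in> leq F) \<longleftrightarrow>
        (\<exists>z\<in>verts F. z \<noteq> x \<and> z \<noteq> y \<and> (y, z) \<in> leq F \<and> (z, x) \<in> leq F)"
    using leq_verts[OF F] by blast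
  also have "\<dots> \<longleftrightarrow> (\<exists>z\<in>verts F. h z \<noteq> h x \<and> h z \<noteq> h y \<and> (h y, h z) \<in> leq G \<and> (h z, h x) \<in> leq G)"
    using inj le xy by blast
  also have "\<dots> \<longleftrightarrow> (\<exists>z\<in>verts G. z \<noteq> h x \<and> z \<noteq> h y \<and> (h y, z) \<in> leq G \<and> (z, h x) \<in> leq G)"
    unfolding bij_betw_imp_surj_on[OF h, symmetric] by simp
  also have "\<dots> \<longleftrightarrow> (\<exists>z. z \<noteq> h x \<and> z \<noteq> h y \<and> (h y, z) \<in> leq G \<and> (z, h x) \<in> leq G)"
    using leq_verts[OF G] by blast
  finally show ?thesis
    using inj le xy unfolding edges_def by auto
qed

lemma iso_mapD:
  assumes "iso_map h F G"
  shows "bij_betw h (verts F) (verts G)"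
    and "\<And>x y. x \<in> verts F \<Longrightarrow> y \<in> verts F \<Longrightarrow> (x, y) \<in> leq F \<longleftrightarrow> (h x, h y) \<in> leq G"
    and "\<And>x. x \<in> verts F \<Longrightarrow> vdec G (h x) = vdec F x"
    and "\<And>x y. (x, y) \<in> edges F \<Longrightarrow> edec G (h x, h y) = edec F (x, y)"
  using assms unfolding iso_map_def by blast+

lemma forest_isoI:
  assumes "bij_betw h (verts F) (verts G)"
    and "\<And>x y. x \<in> verts F \<Longrightarrow> y \<in> verts F \<Longrightarrow> (x, y) \<in> leq F \<longleftrightarrow> (h x, h y) \<in> leq G"
    and "\<And>x. x \<in> verts F \<Longrightarrow> vdec G (h x) = vdec F x"
    and "\<And>x y. (x, y) \<in> edges F \<Longrightarrow> edec G (h x, h y) = edec F (x, y)"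
  shows "forest_iso F G"
  unfolding forest_iso_def iso_map_def
proof (intro exI[of _ h] conjI)
  show "bij_betw h (verts F) (verts G)" by (rule assms(1))
  show "\<forall>x\<in>verts F. \<forall>y\<in>verts F. (x, y) \<in> leq F \<longleftrightarrow> (h x, h y) \<in> leq G"
    by (intro ballI assms(2))
  show "\<forall>x\<in>verts F. vdec G (h x) = vdec F x" by (intro ballI assms(3))
  show "\<forall>(x, y)\<in>edges F. edec G (h x, h y) = edec F (x, y)"
    by (rule ballI, clarify, rule assms(4))
qed

lemma forest_iso_refl: "forest_iso F F"
  by (rule forest_isoI[of id]) auto

lemma forest_iso_sym:
  assumes "rooted_forest F" "rooted_forest G" "forest_iso F G"
  shows "forest_iso G F"
proof -
  obtain h where "iso_map h F G"
    using assms(3) by (auto simp: forest_iso_def)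
  note h = iso_mapD(1)[OF this] and le = iso_mapD(2)[OF this]
    and vd = iso_mapD(3)[OF this] and ed = iso_mapD(4)[OF this]
  define g where "g = inv_into (verts F) h"
  have g: "bij_betw g (verts G) (verts F)"
    unfolding g_def by (rule bij_betw_inv_into[OF h])
  have gv: "g x \<in> verts F" "h (g x) = x" if "x \<in> verts G" for x
    using that g h unfolding g_def by (auto simp: bij_betw_def f_inv_into_f inv_into_into)
  have "(g x, g y) \<in> edges F" if "(x, y) \<in> edges G" for x y
    using iso_edges[OF assms(1,2) h le, of "g x" "g y"] that edges_verts[OF assms(2) that] gv by auto
  then have "edec F (g x, g y) = edec G (x, y)" if "(x, y) \<in> edges G" for x y
    using ed[of "g x" "g y"] gv edges_verts[OF assms(2) that] that by simp
  moreover have "(x, y) \<in> leq G \<longleftrightarrow> (g x, g y) \<in> leq F" if "x \<in> verts G" "y \<in> verts G" for x y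
    using le[of "g x" "g y"] gv that by simp
  moreover have "vdec F (g x) = vdec G x" if "x \<in> verts G" for x
    using vd[of "g x"] gv that by simp
  ultimately show ?thesis
    using g by (intro forest_isoI[of g])
qed

lemma forest_iso_trans:
  assumes "rooted_forest F" "rooted_forest G" "forest_iso F G" "forest_iso G H"
  shows "forest_iso F H"
proof -
  obtain h where "iso_map h F G"
    using assms(3) by (auto simp: forest_iso_def)
  note h = iso_mapD(1)[OF this] and le = iso_mapD(2)[OF this]
    and vd = iso_mapD(3)[OF this] and ed = iso_mapD(4)[OF this]
  obtain g where "iso_map g G H"
    using assms(4) by (auto simp: forest_iso_def)
  note g = iso_mapD(1)[OF this] and le' = iso_mapD(2)[OF this]
    and vd' = iso_mapD(3)[OF this] and ed' = iso_mapD(4)[OF this]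
  have hv: "h x \<in> verts G" if "x \<in> verts F" for x
    using h that by (auto simp: bij_betw_def)
  have "(h x, h y) \<in> edges G" if "(x, y) \<in> edges F" for x y
    using iso_edges[OF assms(1,2) h le, of x y] that edges_verts[OF assms(1) that] by auto
  then show ?thesis
    using bij_betw_trans[OF h g] le le' vd vd' ed ed' hv
    by (intro forest_isoI[of "g \<circ> h"]) simp_all
qed

lemma rooted_forest_empty: "rooted_forest empty_forest"
  by (auto simp: rooted_forest_def empty_forest_def edges_def)

text \<open>Isomorphism classes are represented by forests whose vertices are natural numbers.\<close>

quotient_type ('i, 'e) fclass =
  "(nat, 'i, 'e) forest" / partial: "\<lambda>F G. rooted_forest F \<and> rooted_forest G \<and> forest_iso F G"
proof (rule part_equivpI)
  show "\<exists>F::(nat, 'i, 'e) forest. rooted_forest F \<and> rooted_forest F \<and> forest_iso F F"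
    using rooted_forest_empty forest_iso_refl by blast
  show "symp (\<lambda>(F::(nat, 'i, 'e) forest) G. rooted_forest F \<and> rooted_forest G \<and> forest_iso F G)"
    by (auto simp: symp_def intro: forest_iso_sym)
  show "transp (\<lambda>(F::(nat, 'i, 'e) forest) G. rooted_forest F \<and> rooted_forest G \<and> forest_iso F G)"
    by (auto simp: transp_def intro: forest_iso_trans)
qed

definition relabel :: "('v \<Rightarrow> 'w) \<Rightarrow> ('v, 'i, 'e) forest \<Rightarrow> ('w, 'i, 'e) forest" where
  "relabel h F = \<lparr>verts = h ` verts F, leq = map_prod h h ` leq F,
     vdec = (\<lambda>x. vdec F (inv_into (verts F) h x)),
     edec = (\<lambda>(x, y). edec F (inv_into (verts F) h x, inv_into (verts F) h y))\<rparr>"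

definition cls :: "('v, 'i, 'e) forest \<Rightarrow> ('i, 'e) fclass" where
  "cls F = abs_fclass (relabel (to_nat_on (verts F)) F)"

lemma rooted_forest_transfer:
  assumes F: "rooted_forest F" and h: "bij_betw h (verts F) (verts G)"
    and le: "\<And>x y. x \<in> verts F \<Longrightarrow> y \<in> verts F \<Longrightarrow> (x, y) \<in> leq F \<longleftrightarrow> (h x, h y) \<in> leq G"
    and sub: "leq G \<subseteq> verts G \<times> verts G"
  shows "rooted_forest G"
proof -
  have im: "verts G = h ` verts F" and inj: "inj_on h (verts F)"
    using h by (auto simp: bij_betw_def)
  have po: "partial_order_on (verts F) (leq F)" and fin: "finite (verts F)"
    and cov: "\<And>u v w. (u, w) \<in> edges F \<Longrightarrow> (v, w) \<in> edges F \<Longrightarrow> u = v"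
    using F by (auto simp: rooted_forest_def)
  have refl: "refl_on (verts G) (leq G)"
    using partial_order_onD(1)[OF po] le unfolding refl_on_def im by auto
  have trans: "trans (leq G)"
  proof (rule transI)
    fix x y z assume xy: "(x, y) \<in> leq G" and yz: "(y, z) \<in> leq G"
    then obtain x' y' z' where "x = h x'" "y = h y'" "z = h z'"
        "x' \<in> verts F" "y' \<in> verts F" "z' \<in> verts F"
      using sub unfolding im by blast
    then show "(x, z) \<in> leq G"
      using le xy yz partial_order_onD(2)[OF po] by (meson transD)
  qed
  have antisym: "antisym (leq G)"
  proof (rule antisymI)
    fix x y assume xy: "(x, y) \<in> leq G" and yx: "(y, x) \<in> leq G"
    then obtain x' y' where "x = h x'" "y = h y'" "x' \<in> verts F" "y' \<in> verts F"
      using sub unfolding im by blast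
    then show "x = y"
      using le xy yx partial_order_onD(3)[OF po] by (metis antisymD)
  qed
  have edge: "(x, y) \<in> edges F" if "(h x, h y) \<in> edges G" "x \<in> verts F" "y \<in> verts F" for x y
  proof -
    have "z = x \<or> z = y" if "(y, z) \<in> leq F" "(z, x) \<in> leq F" for z
    proof -
      have z: "z \<in> verts F" using leq_verts[OF F that(1)] by simp
      then have "h z = h x \<or> h z = h y"
        using \<open>(h x, h y) \<in> edges G\<close> le that \<open>x \<in> verts F\<close> \<open>y \<in> verts F\<close> unfolding edges_def by auto
      then show ?thesis using inj z \<open>x \<in> verts F\<close> \<open>y \<in> verts F\<close> by (auto simp: inj_on_def)
    qed
    then show ?thesis using that le unfolding edges_def by auto
  qed
  have "u = v" if uw: "(u, w) \<in> edges G" and vw: "(v, w) \<in> edges G" for u v w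
  proof -
    have "u \<in> verts G" "v \<in> verts G" "w \<in> verts G"
      using uw vw sub unfolding edges_def by auto
    then obtain u' v' w' where "u = h u'" "v = h v'" "w = h w'"
        "u' \<in> verts F" "v' \<in> verts F" "w' \<in> verts F"
      unfolding im by blast
    then show ?thesis using uw vw edge cov by metis
  qed
  then show ?thesis
    using refl trans antisym sub fin
    unfolding rooted_forest_def partial_order_on_def preorder_on_def im by auto
qed

lemma
  assumes F: "rooted_forest F" and inj: "inj_on h (verts F)"
  shows rooted_forest_relabel: "rooted_forest (relabel h F)"
    and forest_iso_relabel: "forest_iso F (relabel h F)"
proof -
  have bij: "bij_betw h (verts F) (verts (relabel h F))"
    using inj by (simp add: relabel_def bij_betw_def)
  have le: "(x, y) \<in> leq F \<longleftrightarrow> (h x, h y) \<in> leq (relabel h F)"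
    if "x \<in> verts F" "y \<in> verts F" for x y
  proof
    assume "(x, y) \<in> leq F"
    then show "(h x, h y) \<in> leq (relabel h F)" by (force simp: relabel_def)
  next
    assume "(h x, h y) \<in> leq (relabel h F)"
    then obtain x' y' where *: "(x', y') \<in> leq F" "h x = h x'" "h y = h y'"
      by (auto simp: relabel_def)
    then have "x = x'" "y = y'"
      using leq_verts[OF F *(1)] that inj by (simp_all add: inj_on_def)
    then show "(x, y) \<in> leq F" using * by simp
  qed
  have "leq (relabel h F) \<subseteq> verts (relabel h F) \<times> verts (relabel h F)"
    by (simp add: relabel_def) (use leq_verts[OF F] in fastforce)
  then show "rooted_forest (relabel h F)"
    using rooted_forest_transfer[OF F bij le] by blast
  show "forest_iso F (relabel h F)"
    using bij le inj edges_verts[OF F]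
    by (intro forest_isoI[of h]) (auto simp: relabel_def)
qed

lemma
  assumes F: "rooted_forest F"
  shows rooted_forest_rep_cls: "rooted_forest (rep_fclass (cls F))"
    and forest_iso_rep_cls: "forest_iso F (rep_fclass (cls F))"
proof -
  have inj: "inj_on (to_nat_on (verts F)) (verts F)"
    using F by (auto simp: rooted_forest_def intro!: inj_on_to_nat_on countable_finite)
  let ?R = "relabel (to_nat_on (verts F)) F"
  have R: "rooted_forest ?R" "forest_iso F ?R"
    using rooted_forest_relabel[OF F inj] forest_iso_relabel[OF F inj] .
  have "rooted_forest ?R \<and> rooted_forest (rep_fclass (cls F)) \<and> forest_iso ?R (rep_fclass (cls F))"
    unfolding cls_def using R(1) forest_iso_refl by (intro rep_abs_rsp[OF Quotient3_fclass]) simp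
  then show "rooted_forest (rep_fclass (cls F))" "forest_iso F (rep_fclass (cls F))"
    using forest_iso_trans[OF F R(1) R(2)] by auto
qed

lemma rooted_forest_rep: "rooted_forest (rep_fclass C)"
  using Quotient3_rep_reflp[OF Quotient3_fclass] by blast

lemma cls_eqI:
  assumes F: "rooted_forest F" and G: "rooted_forest G" and FG: "forest_iso F G"
  shows "cls F = cls G"
proof -
  have inj: "inj_on (to_nat_on (verts F)) (verts F)" "inj_on (to_nat_on (verts G)) (verts G)"
    using F G by (auto simp: rooted_forest_def intro!: inj_on_to_nat_on countable_finite)
  note R = rooted_forest_relabel[OF F inj(1)] forest_iso_relabel[OF F inj(1)]
  note S = rooted_forest_relabel[OF G inj(2)] forest_iso_relabel[OF G inj(2)]
  have "forest_iso (relabel (to_nat_on (verts F)) F) (relabel (to_nat_on (verts G)) G)"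
    using forest_iso_trans[OF R(1) F forest_iso_sym[OF F R(1) R(2)] forest_iso_trans[OF F G FG S(2)]] .
  then show ?thesis
    unfolding cls_def using R(1) S(1) Quotient3_rel_abs[OF Quotient3_fclass] by blast
qed

lemma cls_rep: "cls (rep_fclass C) = C"
proof -
  let ?F = "rep_fclass C"
  have F: "rooted_forest ?F" by (rule rooted_forest_rep)
  have inj: "inj_on (to_nat_on (verts ?F)) (verts ?F)"
    using F by (auto simp: rooted_forest_def intro!: inj_on_to_nat_on countable_finite)
  have "abs_fclass ?F = cls ?F"
    unfolding cls_def
    using F rooted_forest_relabel[OF F inj] forest_iso_relabel[OF F inj]
      Quotient3_rel_abs[OF Quotient3_fclass] by blast
  then show ?thesis
    using Quotient3_abs_rep[OF Quotient3_fclass] by metis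
qed

definition dunion :: "('v, 'i, 'e) forest \<Rightarrow> ('w, 'i, 'e) forest \<Rightarrow> ('v + 'w, 'i, 'e) forest" where
  "dunion F G = \<lparr>verts = verts F <+> verts G,
     leq = map_prod Inl Inl ` leq F \<union> map_prod Inr Inr ` leq G,
     vdec = case_sum (vdec F) (vdec G),
     edec = (\<lambda>p. case p of (Inl x, Inl y) \<Rightarrow> edec F (x, y) | (Inr x, Inr y) \<Rightarrow> edec G (x, y)
       | _ \<Rightarrow> undefined)\<rparr>"

lemma verts_dunion: "verts (dunion F G) = Inl ` verts F \<union> Inr ` verts G"
  by (auto simp: dunion_def)

lemma leq_dunion [simp]:
  "(Inl x, Inl x') \<in> leq (dunion F G) \<longleftrightarrow> (x, x') \<in> leq F"
  "(Inr y, Inr y') \<in> leq (dunion F G) \<longleftrightarrow> (y, y') \<in> leq G"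
  "(Inl x, Inr y') \<notin> leq (dunion F G)"
  "(Inr y, Inl x') \<notin> leq (dunion F G)"
  by (auto simp: dunion_def)

lemma dec_dunion [simp]:
  "vdec (dunion F G) (Inl x) = vdec F x"
  "vdec (dunion F G) (Inr y) = vdec G y"
  "edec (dunion F G) (Inl x, Inl x') = edec F (x, x')"
  "edec (dunion F G) (Inr y, Inr y') = edec G (y, y')"
  by (auto simp: dunion_def)

lemma ex_sum: "(\<exists>z. P z) \<longleftrightarrow> (\<exists>x. P (Inl x)) \<or> (\<exists>y. P (Inr y))"
  by (metis sum.exhaust)

lemma edges_dunion [simp]:
  "(Inl x, Inl x') \<in> edges (dunion F G) \<longleftrightarrow> (x, x') \<in> edges F"
  "(Inr y, Inr y') \<in> edges (dunion F G) \<longleftrightarrow> (y, y') \<in> edges G"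
  "(Inl x, Inr y') \<notin> edges (dunion F G)"
  "(Inr y, Inl x') \<notin> edges (dunion F G)"
  by (auto simp: edges_def ex_sum)

lemma rooted_forest_dunion:
  assumes F: "rooted_forest F" and G: "rooted_forest G"
  shows "rooted_forest (dunion F G)"
proof -
  have po: "partial_order_on (verts F) (leq F)" "partial_order_on (verts G) (leq G)"
    using F G by (auto simp: rooted_forest_def)
  have "leq (dunion F G) \<subseteq> verts (dunion F G) \<times> verts (dunion F G)"
    using leq_verts[OF F] leq_verts[OF G] by (auto simp: dunion_def)
  moreover have "refl_on (verts (dunion F G)) (leq (dunion F G))"
    using partial_order_onD(1)[OF po(1)] partial_order_onD(1)[OF po(2)]
    by (auto simp: verts_dunion refl_on_def)
  moreover have "trans (leq (dunion F G))"
  proof (rule transI)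
    fix x y z assume "(x, y) \<in> leq (dunion F G)" "(y, z) \<in> leq (dunion F G)"
    then show "(x, z) \<in> leq (dunion F G)"
      using partial_order_onD(2)[OF po(1)] partial_order_onD(2)[OF po(2)]
      by (cases x; cases y; cases z) (auto dest: transD)
  qed
  moreover have "antisym (leq (dunion F G))"
  proof (rule antisymI)
    fix x y assume "(x, y) \<in> leq (dunion F G)" "(y, x) \<in> leq (dunion F G)"
    then show "x = y"
      using partial_order_onD(3)[OF po(1)] partial_order_onD(3)[OF po(2)]
      by (cases x; cases y) (auto dest: antisymD)
  qed
  moreover have "u = v" if "(u, w) \<in> edges (dunion F G)" "(v, w) \<in> edges (dunion F G)" for u v w
    using that
    by (cases u; cases v; cases w) (auto dest: parent_unique[OF F] parent_unique[OF G])
  moreover have "finite (verts (dunion F G))"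
    using F G by (auto simp: verts_dunion rooted_forest_def)
  ultimately show ?thesis
    unfolding rooted_forest_def partial_order_on_def preorder_on_def by blast
qed

lemma forest_iso_dunion:
  assumes "forest_iso F F'" "forest_iso G G'"
  shows "forest_iso (dunion F G) (dunion F' G')"
proof -
  obtain h where "iso_map h F F'"
    using assms(1) by (auto simp: forest_iso_def)
  note h = iso_mapD(1)[OF this] and le = iso_mapD(2)[OF this]
    and vd = iso_mapD(3)[OF this] and ed = iso_mapD(4)[OF this]
  obtain g where "iso_map g G G'"
    using assms(2) by (auto simp: forest_iso_def)
  note g = iso_mapD(1)[OF this] and le' = iso_mapD(2)[OF this]
    and vd' = iso_mapD(3)[OF this] and ed' = iso_mapD(4)[OF this]
  show ?thesis
  proof (rule forest_isoI[of "map_sum h g"])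
    have "inj_on (map_sum h g) (verts (dunion F G))"
      using bij_betw_imp_inj_on[OF h] bij_betw_imp_inj_on[OF g]
      by (intro inj_onI) (auto simp: verts_dunion dest: inj_onD)
    moreover have "map_sum h g ` verts (dunion F G) = verts (dunion F' G')"
      unfolding verts_dunion image_Un image_image
      by (simp add: bij_betw_imp_surj_on[OF h, symmetric] bij_betw_imp_surj_on[OF g, symmetric]
          image_image)
    ultimately show "bij_betw (map_sum h g) (verts (dunion F G)) (verts (dunion F' G'))"
      by (simp add: bij_betw_def)
    show "(x, y) \<in> leq (dunion F G) \<longleftrightarrow> (map_sum h g x, map_sum h g y) \<in> leq (dunion F' G')"
      if "x \<in> verts (dunion F G)" "y \<in> verts (dunion F G)" for x y
      using that by (cases x; cases y) (simp_all add: verts_dunion image_iff le le')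
    show "vdec (dunion F' G') (map_sum h g x) = vdec (dunion F G) x"
      if "x \<in> verts (dunion F G)" for x
      using that by (cases x) (simp_all add: verts_dunion image_iff vd vd')
    show "edec (dunion F' G') (map_sum h g x, map_sum h g y) = edec (dunion F G) (x, y)"
      if "(x, y) \<in> edges (dunion F G)" for x y
      using that by (cases x; cases y) (simp_all add: ed ed')
  qed
qed

lemma sum3_cases:
  obtains x where "z = Inl (Inl x)" | x where "z = Inl (Inr x)" | x where "z = Inr x"
  by (metis sum.exhaust)

instantiation fclass :: (type, type) comm_monoid_add
begin

definition zero_fclass :: "('a, 'b) fclass" where
  "zero_fclass = cls (empty_forest :: (nat, 'a, 'b) forest)"

definition plus_fclass :: "('a, 'b) fclass \<Rightarrow> ('a, 'b) fclass \<Rightarrow> ('a, 'b) fclass" where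
  "plus_fclass C D = cls (dunion (rep_fclass C) (rep_fclass D))"

lemma cls_dunion:
  fixes F :: "('v, 'a, 'b) forest" and G :: "('w, 'a, 'b) forest"
  assumes F: "rooted_forest F" and G: "rooted_forest G"
  shows "cls (dunion F G) = cls F + cls G"
  unfolding plus_fclass_def
  using rooted_forest_rep_cls[OF F] forest_iso_rep_cls[OF F]
    rooted_forest_rep_cls[OF G] forest_iso_rep_cls[OF G]
  by (intro cls_eqI rooted_forest_dunion forest_iso_dunion F G)

instance
proof
  fix a b c :: "('a, 'b) fclass"
  obtain A B C :: "(nat, 'a, 'b) forest"
    where r: "rooted_forest A" "rooted_forest B" "rooted_forest C"
      and c: "a = cls A" "b = cls B" "c = cls C"
    using cls_rep rooted_forest_rep by metis
  define h :: "(nat + nat) + nat \<Rightarrow> nat + (nat + nat)" where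
    "h = case_sum (case_sum Inl (\<lambda>x. Inr (Inl x))) (\<lambda>x. Inr (Inr x))"
  have h: "h (Inl (Inl x)) = Inl x" "h (Inl (Inr x)) = Inr (Inl x)" "h (Inr x) = Inr (Inr x)" for x
    by (simp_all add: h_def)
  have "forest_iso (dunion (dunion A B) C) (dunion A (dunion B C))"
  proof (rule forest_isoI[of h])
    have "inj h"
    proof (rule injI)
      show "x = y" if "h x = h y" for x y
        using that by (cases x rule: sum3_cases; cases y rule: sum3_cases) (simp_all add: h)
    qed
    then show "bij_betw h (verts (dunion (dunion A B) C)) (verts (dunion A (dunion B C)))"
      by (simp add: bij_betw_def inj_on_subset[OF _ subset_UNIV] verts_dunion image_Un image_image h Un_assoc)
    show "(x, y) \<in> leq (dunion (dunion A B) C) \<longleftrightarrow> (h x, h y) \<in> leq (dunion A (dunion B C))" for x y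
      by (cases x rule: sum3_cases; cases y rule: sum3_cases) (simp_all add: h)
    show "vdec (dunion A (dunion B C)) (h x) = vdec (dunion (dunion A B) C) x" for x
      by (cases x rule: sum3_cases) (simp_all add: h)
    show "edec (dunion A (dunion B C)) (h x, h y) = edec (dunion (dunion A B) C) (x, y)"
      if "(x, y) \<in> edges (dunion (dunion A B) C)" for x y
      using that by (cases x rule: sum3_cases; cases y rule: sum3_cases) (simp_all add: h)
  qed
  then have "cls (dunion (dunion A B) C) = cls (dunion A (dunion B C))"
    by (intro cls_eqI rooted_forest_dunion r)
  then show "a + b + c = a + (b + c)"
    unfolding c by (simp add: cls_dunion rooted_forest_dunion r)
  define s :: "nat + nat \<Rightarrow> nat + nat" where "s = case_sum Inr Inl"
  have s: "s (Inl x) = Inr x" "s (Inr x) = Inl x" for x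
    by (simp_all add: s_def)
  have "forest_iso (dunion A B) (dunion B A)"
  proof (rule forest_isoI[of s])
    have "inj s"
    proof (rule injI)
      show "x = y" if "s x = s y" for x y
        using that by (cases x; cases y) (simp_all add: s)
    qed
    then show "bij_betw s (verts (dunion A B)) (verts (dunion B A))"
      by (simp add: bij_betw_def inj_on_subset[OF _ subset_UNIV] verts_dunion image_Un image_image s Un_commute)
    show "(x, y) \<in> leq (dunion A B) \<longleftrightarrow> (s x, s y) \<in> leq (dunion B A)" for x y
      by (cases x; cases y) (simp_all add: s)
    show "vdec (dunion B A) (s x) = vdec (dunion A B) x" for x
      by (cases x) (simp_all add: s)
    show "edec (dunion B A) (s x, s y) = edec (dunion A B) (x, y)"
      if "(x, y) \<in> edges (dunion A B)" for x y
      using that by (cases x; cases y) (simp_all add: s)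
  qed
  then have "cls (dunion A B) = cls (dunion B A)"
    by (intro cls_eqI rooted_forest_dunion r)
  then show "a + b = b + a"
    unfolding c by (simp add: cls_dunion r)
  define e where "e = (empty_forest :: (nat, 'a, 'b) forest)"
  have "forest_iso A (dunion e A)"
    by (rule forest_isoI[of Inr]) (simp_all add: bij_betw_def verts_dunion e_def empty_forest_def)
  then have "cls A = cls (dunion e A)"
    unfolding e_def by (intro cls_eqI rooted_forest_dunion r rooted_forest_empty)
  then show "0 + a = a"
    unfolding c zero_fclass_def e_def by (simp add: cls_dunion r rooted_forest_empty)
qed

end

text \<open>
  The vector space with basis the isomorphism classes of forests is the monoid algebra
  \<^typ>\<open>('i, 'e) fclass \<Rightarrow>\<^sub>0 'k\<close>; disjoint union is written additively on \<^typ>\<open>('i, 'e) fclass\<close>.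
\<close>

definition fclasses :: "'i set \<Rightarrow> ('i \<Rightarrow> 'e set) \<Rightarrow> ('i, 'e) fclass set" where
  "fclasses I E = {cls F | F :: (nat, 'i, 'e) forest. rooted_forest F \<and> well_decorated I E F}"

definition forest_alg :: "'i set \<Rightarrow> ('i \<Rightarrow> 'e set) \<Rightarrow> (('i, 'e) fclass \<Rightarrow>\<^sub>0 'k::zero) set" where
  "forest_alg I E = {x. keys x \<subseteq> fclasses I E}"

text \<open>
  The tensor power of the forest algebra indexed by a finite set \<open>J\<close>: the basis element \<open>C\<close> is
  the pure tensor of the classes \<open>lookup C e\<close> for \<open>e \<in> J\<close>, and
  outside \<open>J\<close> the value is the empty forest, \<open>0\<close>.
\<close>

definition forest_tensor ::
  "'i set \<Rightarrow> ('i \<Rightarrow> 'e set) \<Rightarrow> 'e set \<Rightarrow> (('e \<Rightarrow>\<^sub>0 ('i, 'e) fclass) \<Rightarrow>\<^sub>0 'k::zero) set" where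
  "forest_tensor I E J = {x. \<forall>C\<in>keys x. keys C \<subseteq> J \<and> (\<forall>e\<in>J. lookup C e \<in> fclasses I E)}"

text \<open>
  The grafted tree has root \<open>None\<close>, and \<open>Some (e, v)\<close> is the vertex \<open>v\<close> of the forest \<open>f e\<close>.
\<close>

definition graft :: "'i \<Rightarrow> ('e \<Rightarrow> ('v, 'i, 'e) forest) \<Rightarrow> (('e \<times> 'v) option, 'i, 'e) forest" where
  "graft i f = (let V = insert None {Some (e, v) | e v. v \<in> verts (f e)} in
     \<lparr>verts = V,
      leq = V \<times> {None} \<union> {(Some (e, v), Some (e, w)) | e v w. (v, w) \<in> leq (f e)},
      vdec = (\<lambda>x. case x of None \<Rightarrow> i | Some (e, v) \<Rightarrow> vdec (f e) v),
      edec = (\<lambda>p. case p of (None, Some (e, w)) \<Rightarrow> e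
        | (Some (e, v), Some (_, w)) \<Rightarrow> edec (f e) (v, w) | _ \<Rightarrow> undefined)\<rparr>)"

definition Bplus ::
  "'i \<Rightarrow> (('e \<Rightarrow>\<^sub>0 ('i, 'e) fclass) \<Rightarrow>\<^sub>0 'k::comm_ring_1) \<Rightarrow> (('i, 'e) fclass \<Rightarrow>\<^sub>0 'k)" where
  "Bplus i x = (\<Sum>C\<in>keys x.
     single (cls (graft i (\<lambda>e. rep_fclass (lookup C e)))) (lookup x C))"

definition in_variable :: "'e \<Rightarrow> 'k::comm_ring_1 poly \<Rightarrow> ('e, 'k) mpol" where
  "in_variable e p = (\<Sum>n\<le>degree p. single (single e n) (coeff p n))"

text \<open>The tensor power of a linear map into \<open>K[L]\<close>, with \<open>K[L]\<^bsup>\<otimes>J\<^esup>\<close> identified with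
  \<open>K[L\<^sub>e : e \<in> J]\<close>.\<close>

definition tensor_power :: "'e set \<Rightarrow> ((('i, 'e) fclass \<Rightarrow>\<^sub>0 'k) \<Rightarrow> 'k::comm_ring_1 poly) \<Rightarrow>
    (('e \<Rightarrow>\<^sub>0 ('i, 'e) fclass) \<Rightarrow>\<^sub>0 'k) \<Rightarrow> ('e, 'k) mpol" where
  "tensor_power J \<phi> x = (\<Sum>C\<in>keys x.
     scale (lookup x C) (\<Prod>e\<in>J. in_variable e (\<phi> (single (lookup C e) 1))))"

definition alg_morphism ::
  "'i set \<Rightarrow> ('i \<Rightarrow> 'e set) \<Rightarrow> ((('i, 'e) fclass \<Rightarrow>\<^sub>0 'k) \<Rightarrow> 'k::comm_ring_1 poly) \<Rightarrow> bool" where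
  "alg_morphism I E \<phi> \<longleftrightarrow> \<phi> 1 = 1 \<and>
     (\<forall>x\<in>forest_alg I E. \<forall>y\<in>forest_alg I E. \<phi> (x + y) = \<phi> x + \<phi> y \<and> \<phi> (x * y) = \<phi> x * \<phi> y) \<and>
     (\<forall>c. \<forall>x\<in>forest_alg I E. \<phi> (scale c x) = smult c (\<phi> x))"

definition universal_morphism :: "'i set \<Rightarrow> ('i \<Rightarrow> 'e set) \<Rightarrow>
    ('i \<Rightarrow> ('e, 'k::comm_ring_1) mpol \<Rightarrow> 'k poly) \<Rightarrow>
    ((('i, 'e) fclass \<Rightarrow>\<^sub>0 'k) \<Rightarrow> 'k poly) \<Rightarrow> bool" where
  "universal_morphism I E \<Lambda> \<phi> \<longleftrightarrow> alg_morphism I E \<phi> \<and>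
     (\<forall>i\<in>I. \<forall>x\<in>forest_tensor I E (E i). \<phi> (Bplus i x) = \<Lambda> i (tensor_power (E i) \<phi> x))"


definition tube :: "('v, 'i, 'e) forest \<Rightarrow> 'v set \<Rightarrow> bool" where
  "tube F X \<longleftrightarrow> X \<noteq> {} \<and> X \<subseteq> verts F \<and> induces_connected F X"

definition tubing :: "('v, 'i, 'e) forest \<Rightarrow> 'v set set \<Rightarrow> bool" where
  "tubing F \<tau> \<longleftrightarrow> (\<forall>X\<in>\<tau>. tube F X) \<and> (\<forall>X\<in>\<tau>. \<forall>Y\<in>\<tau>. X \<inter> Y = {} \<or> X \<subseteq> Y \<or> Y \<subseteq> X)"

definition Tub :: "('v, 'i, 'e) forest \<Rightarrow> 'v set set set" where
  "Tub F = {\<tau>. tubing F \<tau> \<and> (\<forall>\<sigma>. tubing F \<sigma> \<and> \<tau> \<subseteq> \<sigma> \<longrightarrow> \<sigma> = \<tau>)}"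

definition root_of :: "('v, 'i, 'e) forest \<Rightarrow> 'v set \<Rightarrow> 'v" where
  "root_of F X = (THE v. v \<in> X \<and> (\<forall>w\<in>X. (w, v) \<in> leq F))"

definition downset :: "('v, 'i, 'e) forest \<Rightarrow> 'v set \<Rightarrow> 'v set \<Rightarrow> bool" where
  "downset F X D \<longleftrightarrow> D \<subseteq> X \<and> (\<forall>x\<in>D. \<forall>y\<in>X. (y, x) \<in> leq F \<longrightarrow> y \<in> D)"

definition upset :: "('v, 'i, 'e) forest \<Rightarrow> 'v set \<Rightarrow> 'v set \<Rightarrow> bool" where
  "upset F X U \<longleftrightarrow> U \<subseteq> X \<and> (\<forall>x\<in>U. \<forall>y\<in>X. (x, y) \<in> leq F \<longrightarrow> y \<in> U)"

definition max_subtubes :: "'v set set \<Rightarrow> 'v set \<Rightarrow> 'v set set" where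
  "max_subtubes \<tau> X = {Y\<in>\<tau>. Y \<subset> X \<and> \<not> (\<exists>Z\<in>\<tau>. Y \<subset> Z \<and> Z \<subset> X)}"

text \<open>\<open>U\<close> is an upper tube of \<open>\<tau>\<close> and \<open>D\<close> is the corresponding lower tube.\<close>

definition upper_lower :: "('v, 'i, 'e) forest \<Rightarrow> 'v set set \<Rightarrow> 'v set \<Rightarrow> 'v set \<Rightarrow> bool" where
  "upper_lower F \<tau> U D \<longleftrightarrow> U \<noteq> D \<and>
     (\<exists>X\<in>\<tau>. max_subtubes \<tau> X = {U, D} \<and> upset F X U \<and> downset F X D)"

definition upper_tubes :: "('v, 'i, 'e) forest \<Rightarrow> 'v set set \<Rightarrow> 'v set set" where
  "upper_tubes F \<tau> = {U. \<exists>D. upper_lower F \<tau> U D}"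

text \<open>
  The path from a vertex \<open>u\<close> to a vertex \<open>x\<close> strictly below it starts with the edge from \<open>u\<close> to the
  child \<open>w\<close> of \<open>u\<close> with \<open>x \<le> w\<close>.
\<close>

definition tube_type :: "('v, 'i, 'e) forest \<Rightarrow> 'v set set \<Rightarrow> 'v set \<Rightarrow> 'e" where
  "tube_type F \<tau> U = (THE e. \<exists>D w. upper_lower F \<tau> U D \<and> (root_of F U, w) \<in> edges F \<and>
     (root_of F D, w) \<in> leq F \<and> e = edec F (root_of F U, w))"

text \<open>The multi-index counting the elements of a set of upper tubes by type.\<close>

definition count_types :: "('v, 'i, 'e) forest \<Rightarrow> 'v set set \<Rightarrow> 'v set set \<Rightarrow> 'e mindex" where
  "count_types F \<tau> S = (\<Sum>U\<in>S. single (tube_type F \<tau> U) 1)"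

definition rk :: "('v, 'i, 'e) forest \<Rightarrow> 'v set set \<Rightarrow> 'v \<Rightarrow> 'e mindex" where
  "rk F \<tau> v = count_types F \<tau> {U \<in> upper_tubes F \<tau>. root_of F U = v}"

abbreviation rt :: "('v, 'i, 'e) forest \<Rightarrow> 'v" where
  "rt F \<equiv> root_of F (verts F)"

definition b_stat :: "('v, 'i, 'e) forest \<Rightarrow> 'v set set \<Rightarrow> nat" where
  "b_stat F \<tau> = card {X\<in>\<tau>. rt F \<in> X}"

text \<open>
  The upper tubes containing the root form a chain, so \<open>U\<close> is among the outermost \<open>k - 1\<close> of them
  iff fewer than \<open>k - 1\<close> of them properly contain \<open>U\<close>.
\<close>

definition beta_stat :: "('v, 'i, 'e) forest \<Rightarrow> 'v set set \<Rightarrow> nat \<Rightarrow> 'e mindex" where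
  "beta_stat F \<tau> k = count_types F \<tau>
     {U \<in> upper_tubes F \<tau>. rt F \<in> U \<and>
        \<not> card {U' \<in> upper_tubes F \<tau>. rt F \<in> U' \<and> U \<subset> U'} < k - 1}"

definition mel ::
  "('i \<Rightarrow> 'e mindex \<Rightarrow> 'k::comm_ring_1) \<Rightarrow> ('v, 'i, 'e) forest \<Rightarrow> 'v set set \<Rightarrow> 'k" where
  "mel a F \<tau> = (\<Prod>v\<in>verts F - {rt F}. a (vdec F v) (rk F \<tau> v))"

end

(*
  Write sigma(t) for the linear coefficient of phi(t). From the explicit form of the 1-cocycles,
  (Lambda f)' and Lambda (D f), where D is the sum of all partial derivatives, differ by a constant,
  the linear coefficient of Lambda f. Induction on forests turns this into
    phi(F)' = sum over vertices v of sigma(F_v) phi(F - F_v),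
  where F_v is the subtree with root v. Removing the outermost tube splits a binary tubing of a
  tree t into binary tubings of t - t_v and of t_v for a unique non-root vertex v, and this is the
  same recursion for the coefficients of L^k with k > 1.
  For k = 1, sigma(t) = sum over alpha of a_alpha |alpha|! [L^alpha] f, where f is the product over
  e of the polynomials phi(f_e)(L_e) of the branches f_e of t. Replacing a by an arbitrary function
  g of alpha makes an induction possible: differentiating f in L_e removes a subtree t_v of f_e, and
  shifts g by e, exactly as the outermost upper tube adds one to the e-component of the rank of
  the root.
*)
theory Submission
  imports Defs
begin

section \<open>Linear functionals and derivatives of multivariate polynomials\<close>

text \<open>The derivative formula has to cover all forests, since differentiating f in L_e calls
  for the derivative of phi on the branch f_e, which is a forest. The product rule takes care of
  several components and the 1-cocycle of a single tree. The constant by which (Lambda f)' and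
  Lambda (D f) differ is the summand of the root: cutting off the whole tree leaves the empty
  forest, where phi is 1. The freedom in g is used twice in each induction step: the piece keeping
  the root of t receives the shifted g, while the cut-off tree t_v receives the coefficients a of
  the decoration of v, which yields sigma(t_v). The weight |alpha|! is compatible with this because
  the sum over e of alpha_e (|alpha| - 1)! is |alpha|! for alpha different from 0. All trees in the
  inductions are vertex subsets of one fixed forest, so that cutting off a subtree is a set
  difference; isomorphism classes matter only for the comparison with the universal
  morphism.\<close>

definition lin_ext :: "('a \<Rightarrow> 'k) \<Rightarrow> ('a \<Rightarrow>\<^sub>0 'k::comm_ring_1) \<Rightarrow> 'k" where
  "lin_ext h f = (\<Sum>x\<in>keys f. lookup f x * h x)"

lemma lin_ext_superset:
  assumes "finite S" "keys f \<subseteq> S"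
  shows "lin_ext h f = (\<Sum>x\<in>S. lookup f x * h x)"
  unfolding lin_ext_def using assms by (intro sum.mono_neutral_left) (auto simp: in_keys_iff)

lemma lin_ext_0 [simp]: "lin_ext h 0 = 0"
  by (simp add: lin_ext_def)

lemma lin_ext_add: "lin_ext h (f + g) = lin_ext h f + lin_ext h g"
proof -
  let ?S = "keys f \<union> keys g"
  have "keys (f + g) \<subseteq> ?S" by (rule keys_add)
  then show ?thesis
    by (simp add: lin_ext_superset[of ?S] lookup_add algebra_simps sum.distrib)
qed

lemma lin_ext_sum: "lin_ext h (\<Sum>x\<in>A. f x) = (\<Sum>x\<in>A. lin_ext h (f x))"
  by (induction A rule: infinite_finite_induct) (simp_all add: lin_ext_add)

lemma lin_ext_single [simp]: "lin_ext h (single x c) = c * h x"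
  by (simp add: lin_ext_def)

lemma lookup_scale [simp]: "lookup (scale c f) x = c * lookup f x"
  by (simp add: scale_def Poly_Mapping.map.rep_eq when_def)

lemma keys_scale: "keys (scale c f) \<subseteq> keys f"
  by (auto simp: in_keys_iff)

lemma lin_ext_scale: "lin_ext h (scale c f) = c * lin_ext h f"
  by (subst lin_ext_superset[OF finite_keys keys_scale]) (simp add: lin_ext_def sum_distrib_left mult.assoc)

lemma sum_monomials: "f = (\<Sum>x\<in>keys f. single x (lookup f x))"
proof (rule poly_mapping_eqI)
  fix y
  have "lookup (\<Sum>x\<in>keys f. single x (lookup f x)) y = (\<Sum>x\<in>keys f. if x = y then lookup f x else 0)"
    by (simp add: lookup_sum lookup_single when_def)
  then show "lookup f y = lookup (\<Sum>x\<in>keys f. single x (lookup f x)) y"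
    by (simp add: sum.delta in_keys_iff)
qed

lemma scale_single: "scale c (single x d) = single x (c * d)"
  by (rule poly_mapping_eqI) (simp add: lookup_single when_def)

lemma mpol_on_0: "0 \<in> mpol_on E"
  by (simp add: mpol_on_def)

lemma mpol_on_add: "f \<in> mpol_on E \<Longrightarrow> g \<in> mpol_on E \<Longrightarrow> f + g \<in> mpol_on E"
  using keys_add[of f g] by (auto simp: mpol_on_def)

lemma mpol_on_sum: "(\<And>x. x \<in> A \<Longrightarrow> f x \<in> mpol_on E) \<Longrightarrow> (\<Sum>x\<in>A. f x) \<in> mpol_on E"
  by (induction A rule: infinite_finite_induct) (simp_all add: mpol_on_0 mpol_on_add)

lemma mpol_on_single: "keys \<alpha> \<subseteq> E \<Longrightarrow> single \<alpha> c \<in> mpol_on E"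
  by (simp add: mpol_on_def)

section \<open>Coefficients of the values of a 1-cocycle\<close>

text \<open>Linearity of \<Lambda> is given on \<open>mpol_on E\<close> only. Passing to single
  coefficients turns it into a functional \<open>lin_ext\<close>, so that identities about \<Lambda>
  need checking on monomials only.\<close>

lemma coeff_linear:
  assumes "one_cocycle E \<Lambda>" and f: "f \<in> mpol_on E"
  shows "coeff (\<Lambda> f) n = lin_ext (\<lambda>\<gamma>. coeff (\<Lambda> (single \<gamma> 1)) n) f"
proof -
  have add: "\<Lambda> (f + g) = \<Lambda> f + \<Lambda> g" if "f \<in> mpol_on E" "g \<in> mpol_on E" for f g
    using assms(1) that by (auto simp: one_cocycle_def)
  have sc: "\<Lambda> (scale c f) = smult c (\<Lambda> f)" if "f \<in> mpol_on E" for f c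
    using assms(1) that by (auto simp: one_cocycle_def)
  have zero: "\<Lambda> 0 = 0"
    using add[of 0 0] by (simp add: mpol_on_0)
  have sum: "\<Lambda> (\<Sum>x\<in>A. g x) = (\<Sum>x\<in>A. \<Lambda> (g x))" if "\<And>x. x \<in> A \<Longrightarrow> g x \<in> mpol_on E" for g and A :: "'a mindex set"
    using that by (induction A rule: infinite_finite_induct) (simp_all add: zero add mpol_on_sum)
  have keys: "keys \<gamma> \<subseteq> E" if "\<gamma> \<in> keys f" for \<gamma>
    using f that by (auto simp: mpol_on_def)
  have "\<Lambda> f = \<Lambda> (\<Sum>\<gamma>\<in>keys f. scale (lookup f \<gamma>) (single \<gamma> 1))"
    by (subst sum_monomials) (simp add: scale_single)
  also have "\<dots> = (\<Sum>\<gamma>\<in>keys f. \<Lambda> (scale (lookup f \<gamma>) (single \<gamma> 1)))"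
    by (intro sum) (simp add: scale_single mpol_on_single keys)
  also have "\<dots> = (\<Sum>\<gamma>\<in>keys f. smult (lookup f \<gamma>) (\<Lambda> (single \<gamma> 1)))"
    by (intro sum.cong refl sc mpol_on_single keys)
  finally show ?thesis
    by (simp add: lin_ext_def coeff_sum)
qed

text \<open>The scalar \<gamma>!/(\<gamma> - \<alpha>)! in the derivative of order \<alpha> of the
  monomial with exponent \<gamma>. By truncated subtraction it is 0 unless \<alpha> lies below
  \<gamma>.\<close>

definition falling :: "'e mindex \<Rightarrow> 'e mindex \<Rightarrow> nat" where
  "falling \<alpha> \<gamma> = (\<Prod>e\<in>keys \<alpha>. \<Prod>j<lookup \<alpha> e. lookup \<gamma> e - j)"

lemma finite_mi_le: "finite {\<alpha>. mi_le \<alpha> \<gamma>}"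
proof -
  let ?B = "PiE (keys \<gamma>) (\<lambda>e. {..lookup \<gamma> e})"
  have "inj_on (\<lambda>\<alpha>. restrict (lookup \<alpha>) (keys \<gamma>)) {\<alpha>. mi_le \<alpha> \<gamma>}"
  proof (rule inj_onI)
    fix \<alpha> \<beta> assume *: "\<alpha> \<in> {\<alpha>. mi_le \<alpha> \<gamma>}" "\<beta> \<in> {\<alpha>. mi_le \<alpha> \<gamma>}"
      and eq: "restrict (lookup \<alpha>) (keys \<gamma>) = restrict (lookup \<beta>) (keys \<gamma>)"
    show "\<alpha> = \<beta>"
    proof (rule poly_mapping_eqI)
      fix e
      show "lookup \<alpha> e = lookup \<beta> e"
      proof (cases "e \<in> keys \<gamma>")
        case True
        then show ?thesis using fun_cong[OF eq, of e] by simp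
      next
        case False
        then have "lookup \<gamma> e = 0" by (simp add: in_keys_iff)
        then show ?thesis using * unfolding mi_le_def by (metis le_zero_eq mem_Collect_eq)
      qed
    qed
  qed
  moreover have "(\<lambda>\<alpha>. restrict (lookup \<alpha>) (keys \<gamma>)) ` {\<alpha>. mi_le \<alpha> \<gamma>} \<subseteq> ?B"
    by (auto simp: mi_le_def)
  moreover have "finite ?B" by (intro finite_PiE) auto
  ultimately show ?thesis
    using inj_on_finite by blast
qed

text \<open>Derivatives whose order is not below \<gamma> annihilate the monomial, so the sum over
  all multi-indices becomes finite.\<close>

lemma diff_op_single:
  "diff_op A (single \<gamma> 1) = (\<Sum>\<alpha> | mi_le \<alpha> \<gamma>. single (\<gamma> - \<alpha>) (A \<alpha> * of_nat (falling \<alpha> \<gamma>)))"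
proof -
  have eq: "scale (A \<alpha>) (mpderiv \<alpha> (single \<gamma> 1)) =
      (if mi_le \<alpha> \<gamma> then single (\<gamma> - \<alpha>) (A \<alpha> * of_nat (falling \<alpha> \<gamma>)) else 0)" for \<alpha>
    by (rule poly_mapping_eqI) (simp add: mpderiv_def falling_def lookup_single when_def)
  have "diff_op A (single \<gamma> 1) = Sum_any (\<lambda>\<alpha>. if mi_le \<alpha> \<gamma> then single (\<gamma> - \<alpha>) (A \<alpha> * of_nat (falling \<alpha> \<gamma>)) else 0)"
    unfolding diff_op_def eq ..
  also have "\<dots> = (\<Sum>\<alpha> | mi_le \<alpha> \<gamma>. if mi_le \<alpha> \<gamma> then single (\<gamma> - \<alpha>) (A \<alpha> * of_nat (falling \<alpha> \<gamma>)) else 0)"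
    by (rule Sum_any.expand_superset[OF finite_mi_le]) auto
  finally show ?thesis by simp
qed

lemma coeff_diag: "coeff (diag f) m = lin_ext (\<lambda>\<gamma>. if mi_deg \<gamma> = m then 1 else 0) f"
  by (simp add: diag_def lin_ext_def coeff_sum) (rule sum.cong, auto)

lemma coeff_poly_integral:
  "coeff (poly_integral p) 0 = 0"
  "coeff (poly_integral p) (Suc n) = coeff p n / of_nat (Suc n)"
proof -
  show "coeff (poly_integral p) 0 = 0"
    by (simp add: poly_integral_def coeff_sum)
  have "coeff (poly_integral p) (Suc n) = (\<Sum>m\<le>degree p. if m = n then coeff p m / of_nat (Suc m) else 0)"
    by (simp add: poly_integral_def coeff_sum)
  also have "\<dots> = coeff p n / of_nat (Suc n)"
    by (auto simp: coeff_eq_0)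
  finally show "coeff (poly_integral p) (Suc n) = coeff p n / of_nat (Suc n)" .
qed

lemma cocycle_coeff_0:
  assumes "cocycle_coeffs E \<Lambda> a" "f \<in> mpol_on E"
  shows "coeff (\<Lambda> f) 0 = 0"
  using assms by (simp add: cocycle_coeffs_def coeff_poly_integral)

text \<open>The factor \<open>Suc m\<close> clears the denominator brought in by the integral. Once
  all variables are set equal, only derivatives lowering the degree to \<open>m\<close>
  contribute.\<close>

lemma cocycle_coeff_Suc_single:
  assumes "cocycle_coeffs E \<Lambda> a" "keys \<gamma> \<subseteq> E"
  shows "of_nat (Suc m) * coeff (\<Lambda> (single \<gamma> 1)) (Suc m) =
    (\<Sum>\<alpha> | mi_le \<alpha> \<gamma>. a \<alpha> * multinomial \<alpha> * of_nat (falling \<alpha> \<gamma>) *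
       (if mi_deg (\<gamma> - \<alpha>) = m then 1 else 0))"
proof -
  have "\<Lambda> (single \<gamma> 1) = poly_integral (diag (diff_op (\<lambda>\<alpha>. a \<alpha> * multinomial \<alpha>) (single \<gamma> 1)))"
    using assms(1) mpol_on_single[OF assms(2)] unfolding cocycle_coeffs_def by blast
  moreover have "of_nat (Suc m) * (x / of_nat (Suc m)) = x" for x :: 'b
    by (metis nonzero_mult_div_cancel_left of_nat_neq_0 times_divide_eq_right)
  ultimately show ?thesis
    by (simp add: coeff_poly_integral coeff_diag diff_op_single lin_ext_sum del: of_nat_Suc)
qed

lemma mi_deg_superset: "finite J \<Longrightarrow> keys \<alpha> \<subseteq> J \<Longrightarrow> mi_deg \<alpha> = (\<Sum>e\<in>J. lookup \<alpha> e)"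
  unfolding mi_deg_def by (intro sum.mono_neutral_left) (auto simp: in_keys_iff)

lemma falling_superset: "finite J \<Longrightarrow> keys \<alpha> \<subseteq> J \<Longrightarrow> falling \<alpha> \<gamma> = (\<Prod>e\<in>J. \<Prod>j<lookup \<alpha> e. lookup \<gamma> e - j)"
  unfolding falling_def by (intro prod.mono_neutral_left) (auto simp: in_keys_iff)

lemma mi_deg_eq_0: "mi_deg \<alpha> = 0 \<longleftrightarrow> \<alpha> = 0"
  by (auto simp: mi_deg_def in_keys_iff poly_mapping_eq_iff fun_eq_iff)

text \<open>In degree 1 only the full derivative \<alpha> = \<gamma> survives. It contributes
  \<gamma>!, which cancels the denominator of the multinomial coefficient and leaves
  |\<gamma>|!.\<close>

lemma cocycle_coeff_1:
  assumes "one_cocycle E \<Lambda>" and c: "cocycle_coeffs E \<Lambda> a" and f: "f \<in> mpol_on E"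
  shows "coeff (\<Lambda> f) 1 = lin_ext (\<lambda>\<gamma>. fact (mi_deg \<gamma>) * a \<gamma>) f"
proof -
  have "coeff (\<Lambda> (single \<gamma> 1)) 1 = fact (mi_deg \<gamma>) * a \<gamma>" if "\<gamma> \<in> keys f" for \<gamma>
  proof -
    have "keys \<gamma> \<subseteq> E" using f that by (auto simp: mpol_on_def)
    then have "coeff (\<Lambda> (single \<gamma> 1)) 1 = (\<Sum>\<alpha> | mi_le \<alpha> \<gamma>. a \<alpha> * multinomial \<alpha> * of_nat (falling \<alpha> \<gamma>) *
       (if mi_deg (\<gamma> - \<alpha>) = 0 then 1 else 0))"
      using cocycle_coeff_Suc_single[OF c, of \<gamma> 0] by simp
    also have "\<dots> = (\<Sum>\<alpha>\<in>{\<gamma>}. a \<alpha> * multinomial \<alpha> * of_nat (falling \<alpha> \<gamma>))"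
    proof (rule sum.mono_neutral_cong_right[OF finite_mi_le])
      show "\<forall>\<alpha>\<in>{\<alpha>. mi_le \<alpha> \<gamma>} - {\<gamma>}. a \<alpha> * multinomial \<alpha> * of_nat (falling \<alpha> \<gamma>) *
         (if mi_deg (\<gamma> - \<alpha>) = 0 then 1 else 0) = 0"
      proof
        fix \<alpha> assume *: "\<alpha> \<in> {\<alpha>. mi_le \<alpha> \<gamma>} - {\<gamma>}"
        then obtain e where "lookup \<alpha> e \<noteq> lookup \<gamma> e" "lookup \<alpha> e \<le> lookup \<gamma> e"
          by (auto simp: mi_le_def poly_mapping_eq_iff fun_eq_iff)
        then have "lookup (\<gamma> - \<alpha>) e \<noteq> 0" by (simp add: lookup_minus)
        then have "\<gamma> - \<alpha> \<noteq> 0" by auto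
        then show "a \<alpha> * multinomial \<alpha> * of_nat (falling \<alpha> \<gamma>) * (if mi_deg (\<gamma> - \<alpha>) = 0 then 1 else 0) = 0"
          by (simp add: mi_deg_eq_0)
      qed
    qed (auto simp: mi_le_def mi_deg_eq_0)
    also have "\<dots> = a \<gamma> * multinomial \<gamma> * of_nat (falling \<gamma> \<gamma>)" by simp
    also have "falling \<gamma> \<gamma> = (\<Prod>e\<in>keys \<gamma>. fact (lookup \<gamma> e))"
      unfolding falling_def by (simp add: fact_prod_rev atLeast0LessThan of_nat_prod)
    finally show ?thesis
      by (simp add: multinomial_def)
  qed
  then show ?thesis
    unfolding coeff_linear[OF assms(1) f] by (simp add: lin_ext_def)
qed

text \<open>The two sides differentiate a monomial by order \<alpha> and once more in L_e, in the
  two possible orders. At the boundary \<gamma> e = \<alpha> e, where subtraction truncates, both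
  sides vanish; the \<open>if\<close> ensures this on the left.\<close>

lemma falling_shift:
  assumes "mi_le \<alpha> \<gamma>"
  shows "lookup \<gamma> e * (if mi_le \<alpha> (\<gamma> - single e 1) then falling \<alpha> (\<gamma> - single e 1) else 0) =
    (lookup \<gamma> e - lookup \<alpha> e) * falling \<alpha> \<gamma>"
proof (cases "mi_le \<alpha> (\<gamma> - single e 1)")
  case True
  let ?J = "insert e (keys \<alpha>)"
  have l: "lookup (\<gamma> - single e 1) x = (if x = e then lookup \<gamma> e - 1 else lookup \<gamma> x)" for x
    by (simp add: lookup_minus lookup_single when_def)
  \<comment> \<open>The product of length \<alpha> e + 1 is split at its first factor here and at
    its last factor below.\<close>
  have "lookup \<gamma> e * (\<Prod>j<lookup \<alpha> e. lookup \<gamma> e - 1 - j) = (\<Prod>j<Suc (lookup \<alpha> e). lookup \<gamma> e - j)"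
    by (subst prod.lessThan_Suc_shift) simp
  also have "\<dots> = (lookup \<gamma> e - lookup \<alpha> e) * (\<Prod>j<lookup \<alpha> e. lookup \<gamma> e - j)"
    by simp
  finally have e: "lookup \<gamma> e * (\<Prod>j<lookup \<alpha> e. lookup \<gamma> e - 1 - j) =
    (lookup \<gamma> e - lookup \<alpha> e) * (\<Prod>j<lookup \<alpha> e. lookup \<gamma> e - j)" .
  have J: "finite ?J" "keys \<alpha> \<subseteq> ?J" "e \<in> ?J" by auto
  have "(\<Prod>x\<in>?J - {e}. \<Prod>j<lookup \<alpha> x. lookup (\<gamma> - single e 1) x - j) =
      (\<Prod>x\<in>?J - {e}. \<Prod>j<lookup \<alpha> x. lookup \<gamma> x - j)"
    by (intro prod.cong refl) (simp add: l del: One_nat_def)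
  moreover have "(\<Prod>j<lookup \<alpha> e. lookup (\<gamma> - single e 1) e - j) = (\<Prod>j<lookup \<alpha> e. lookup \<gamma> e - 1 - j)"
    by (simp add: l del: One_nat_def)
  ultimately show ?thesis
    unfolding falling_superset[OF J(1,2)] prod.remove[OF J(1,3)] if_P[OF True] mult.assoc[symmetric] e[symmetric]
    by simp
next
  case False
  have "lookup \<gamma> e \<le> lookup \<alpha> e"
  proof (rule ccontr)
    assume "\<not> lookup \<gamma> e \<le> lookup \<alpha> e"
    then have "mi_le \<alpha> (\<gamma> - single e 1)"
      using assms by (auto simp: mi_le_def lookup_minus lookup_single when_def)
    then show False using False by simp
  qed
  then show ?thesis using False by simp
qed

lemma mi_deg_minus:
  assumes "finite E" "keys \<gamma> \<subseteq> E"
  shows "mi_deg (\<gamma> - \<alpha>) = (\<Sum>e\<in>E. lookup \<gamma> e - lookup \<alpha> e)"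
proof -
  have "keys (\<gamma> - \<alpha>) \<subseteq> E"
    using assms(2) by (auto simp: in_keys_iff lookup_minus)
  then show ?thesis
    by (simp add: mi_deg_superset[OF assms(1)] lookup_minus)
qed

text \<open>Summed over \<open>e\<close>, the factors \<gamma> e - \<alpha> e of
  \<open>falling_shift\<close> add up to |\<gamma> - \<alpha>|, which is \<open>Suc m\<close> in
  every term that contributes to the coefficient.\<close>

lemma cocycle_coeff_rec_single:
  assumes E: "finite E" and c: "cocycle_coeffs E \<Lambda> a" and \<gamma>: "keys \<gamma> \<subseteq> E"
  shows "of_nat (Suc (Suc m)) * coeff (\<Lambda> (single \<gamma> 1)) (Suc (Suc m)) =
    (\<Sum>e\<in>E. of_nat (lookup \<gamma> e) * coeff (\<Lambda> (single (\<gamma> - single e 1) 1)) (Suc m))"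
proof -
  let ?A = "\<lambda>\<alpha>. a \<alpha> * multinomial \<alpha>"
  let ?Q = "\<lambda>m \<gamma>. \<Sum>\<alpha> | mi_le \<alpha> \<gamma>. ?A \<alpha> * of_nat (falling \<alpha> \<gamma>) * (if mi_deg (\<gamma> - \<alpha>) = m then 1 else 0)"
  have minus: "keys (\<gamma> - single e 1) \<subseteq> E" for e
    using \<gamma> by (auto simp: in_keys_iff lookup_minus)
  have le: "mi_le \<alpha> (\<gamma> - single e 1) \<Longrightarrow> mi_le \<alpha> \<gamma>" for \<alpha> e
    unfolding mi_le_def lookup_minus by (meson diff_le_self le_trans)
  have deg: "lookup \<gamma> e \<noteq> 0 \<Longrightarrow> mi_le \<alpha> (\<gamma> - single e 1) \<Longrightarrow>
      mi_deg (\<gamma> - \<alpha>) = Suc (mi_deg (\<gamma> - single e 1 - \<alpha>))" if "e \<in> E" for e \<alpha>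
  proof -
    assume 0: "lookup \<gamma> e \<noteq> 0" and "mi_le \<alpha> (\<gamma> - single e 1)"
    then have le': "lookup \<alpha> e \<le> lookup \<gamma> e - 1"
      by (metis lookup_minus lookup_single_eq mi_le_def)
    have "(\<Sum>x\<in>E - {e}. lookup (\<gamma> - single e 1) x - lookup \<alpha> x) = (\<Sum>x\<in>E - {e}. lookup \<gamma> x - lookup \<alpha> x)"
      by (intro sum.cong refl) (auto simp: lookup_minus lookup_single when_def)
    then show ?thesis
      using 0 le' unfolding mi_deg_minus[OF E \<gamma>] mi_deg_minus[OF E minus] sum.remove[OF E that]
      by (simp add: lookup_minus)
  qed
  have "(\<Sum>e\<in>E. of_nat (lookup \<gamma> e) * ?Q m (\<gamma> - single e 1)) =
      (\<Sum>e\<in>E. \<Sum>\<alpha> | mi_le \<alpha> \<gamma>. ?A \<alpha> * of_nat ((lookup \<gamma> e - lookup \<alpha> e) * falling \<alpha> \<gamma>) *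
        (if mi_deg (\<gamma> - \<alpha>) = Suc m then 1 else 0))"
  proof (rule sum.cong[OF refl])
    fix e assume e: "e \<in> E"
    have "of_nat (lookup \<gamma> e) * ?Q m (\<gamma> - single e 1) = (\<Sum>\<alpha> | mi_le \<alpha> \<gamma>.
      of_nat (lookup \<gamma> e) * (if mi_le \<alpha> (\<gamma> - single e 1) then ?A \<alpha> * of_nat (falling \<alpha> (\<gamma> - single e 1)) *
        (if mi_deg (\<gamma> - single e 1 - \<alpha>) = m then 1 else 0) else 0))"
      unfolding sum_distrib_left
      by (rule sum.mono_neutral_cong_left[OF finite_mi_le]) (auto dest: le simp del: One_nat_def)
    also have "\<dots> = (\<Sum>\<alpha> | mi_le \<alpha> \<gamma>. ?A \<alpha> * of_nat ((lookup \<gamma> e - lookup \<alpha> e) * falling \<alpha> \<gamma>) *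
        (if mi_deg (\<gamma> - \<alpha>) = Suc m then 1 else 0))"
    proof (rule sum.cong[OF refl])
      fix \<alpha> assume "\<alpha> \<in> {\<alpha>. mi_le \<alpha> \<gamma>}"
      then have \<alpha>: "mi_le \<alpha> \<gamma>" by simp
      show "of_nat (lookup \<gamma> e) * (if mi_le \<alpha> (\<gamma> - single e 1) then ?A \<alpha> * of_nat (falling \<alpha> (\<gamma> - single e 1)) *
          (if mi_deg (\<gamma> - single e 1 - \<alpha>) = m then 1 else 0) else 0) =
        ?A \<alpha> * of_nat ((lookup \<gamma> e - lookup \<alpha> e) * falling \<alpha> \<gamma>) * (if mi_deg (\<gamma> - \<alpha>) = Suc m then 1 else 0)"
        unfolding falling_shift[OF \<alpha>, of e, symmetric] using deg[OF e, of \<alpha>] by auto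
    qed
    finally show "of_nat (lookup \<gamma> e) * ?Q m (\<gamma> - single e 1) = \<dots>" .
  qed
  also have "\<dots> = (\<Sum>\<alpha> | mi_le \<alpha> \<gamma>. \<Sum>e\<in>E. ?A \<alpha> * of_nat ((lookup \<gamma> e - lookup \<alpha> e) * falling \<alpha> \<gamma>) *
        (if mi_deg (\<gamma> - \<alpha>) = Suc m then 1 else 0))"
    by (rule sum.swap)
  also have "\<dots> = (\<Sum>\<alpha> | mi_le \<alpha> \<gamma>. of_nat (mi_deg (\<gamma> - \<alpha>)) * (?A \<alpha> * of_nat (falling \<alpha> \<gamma>) *
        (if mi_deg (\<gamma> - \<alpha>) = Suc m then 1 else 0)))"
    by (intro sum.cong refl)
      (simp add: mi_deg_minus[OF E \<gamma>] of_nat_sum sum_distrib_left sum_distrib_right mult_ac)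
  also have "\<dots> = of_nat (Suc m) * ?Q (Suc m) \<gamma>"
    unfolding sum_distrib_left by (intro sum.cong refl) simp
  finally have *: "(\<Sum>e\<in>E. of_nat (lookup \<gamma> e) * ?Q m (\<gamma> - single e 1)) = of_nat (Suc m) * ?Q (Suc m) \<gamma>" .
  \<comment> \<open>The extra factor \<open>Suc m\<close> puts both coefficients into the form of
    \<open>cocycle_coeff_Suc_single\<close>; it is cancelled at the end.\<close>
  have "of_nat (Suc m) * (of_nat (Suc (Suc m)) * coeff (\<Lambda> (single \<gamma> 1)) (Suc (Suc m))) =
      (\<Sum>e\<in>E. of_nat (lookup \<gamma> e) * (of_nat (Suc m) * coeff (\<Lambda> (single (\<gamma> - single e 1) 1)) (Suc m)))"
    unfolding cocycle_coeff_Suc_single[OF c \<gamma>] cocycle_coeff_Suc_single[OF c minus] * ..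
  also have "\<dots> = of_nat (Suc m) * (\<Sum>e\<in>E. of_nat (lookup \<gamma> e) * coeff (\<Lambda> (single (\<gamma> - single e 1) 1)) (Suc m))"
    by (simp add: sum_distrib_left mult_ac)
  finally show ?thesis
    by (subst (asm) mult_left_cancel) (simp_all del: of_nat_Suc)
qed

section \<open>Partial derivatives and functionals weighted by factorials\<close>

definition partial_d :: "'e \<Rightarrow> ('e, 'k::comm_ring_1) mpol \<Rightarrow> ('e, 'k) mpol" where
  "partial_d e f = (\<Sum>\<gamma>\<in>keys f. single (\<gamma> - single e 1) (lookup f \<gamma> * of_nat (lookup \<gamma> e)))"

lemma lookup_partial_d: "lookup (partial_d e f) \<beta> = of_nat (Suc (lookup \<beta> e)) * lookup f (\<beta> + single e 1)"
proof -
  have "lookup (partial_d e f) \<beta> = (\<Sum>\<gamma>\<in>keys f. if \<gamma> - single e 1 = \<beta> then lookup f \<gamma> * of_nat (lookup \<gamma> e) else 0)"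
    by (simp add: partial_d_def lookup_sum lookup_single when_def)
  also have "\<dots> = (\<Sum>\<gamma>\<in>keys f. if \<gamma> = \<beta> + single e 1 then lookup f \<gamma> * of_nat (lookup \<gamma> e) else 0)"
  proof (rule sum.cong[OF refl])
    fix \<gamma>
    show "(if \<gamma> - single e 1 = \<beta> then lookup f \<gamma> * of_nat (lookup \<gamma> e) else 0) =
        (if \<gamma> = \<beta> + single e 1 then lookup f \<gamma> * of_nat (lookup \<gamma> e) else 0)"
    \<comment> \<open>Truncated subtraction loses information exactly when \<gamma> e = 0, and then
      the coefficient is 0.\<close>
    proof (cases "lookup \<gamma> e = 0")
      case False
      have "\<gamma> - single e 1 = \<beta> \<longleftrightarrow> \<gamma> = \<beta> + single e 1"
      proof
        assume \<beta>: "\<gamma> - single e 1 = \<beta>"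
        show "\<gamma> = \<beta> + single e 1"
          unfolding \<beta>[symmetric] using False by (auto simp: poly_mapping_eq_iff fun_eq_iff lookup_add lookup_minus lookup_single when_def)
      qed simp
      then show ?thesis by simp
    qed simp
  qed
  also have "\<dots> = lookup f (\<beta> + single e 1) * of_nat (lookup (\<beta> + single e 1) e)"
    by (simp add: sum.delta in_keys_iff)
  finally show ?thesis
    by (simp add: lookup_add mult.commute)
qed

text \<open>The transpose of differentiation: derivatives of the argument are moved onto the values
  of the functional on monomials.\<close>

lemma lin_ext_partial_d: "(\<Sum>e\<in>E. lin_ext (h e) (partial_d e f)) = lin_ext (\<lambda>\<gamma>. \<Sum>e\<in>E. of_nat (lookup \<gamma> e) * h e (\<gamma> - single e 1)) f"
  unfolding lin_ext_def[of _ f] partial_d_def lin_ext_sum lin_ext_single sum_distrib_left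
  by (subst sum.swap) (simp add: mult_ac)

lemma mpol_on_partial_d: "f \<in> mpol_on E \<Longrightarrow> partial_d e f \<in> mpol_on E"
  unfolding partial_d_def
proof (intro mpol_on_sum mpol_on_single)
  fix \<gamma> assume "f \<in> mpol_on E" "\<gamma> \<in> keys f"
  then have "keys \<gamma> \<subseteq> E" by (auto simp: mpol_on_def)
  moreover have "keys (\<gamma> - single e 1) \<subseteq> keys \<gamma>"
    by (auto simp: in_keys_iff lookup_minus)
  ultimately show "keys (\<gamma> - single e 1) \<subseteq> E" by blast
qed

text \<open>This compares (Lambda f)' with Lambda (D f) coefficientwise. The index
  \<open>Suc (Suc m)\<close> leaves out precisely the constant term of the derivative, where the two
  differ.\<close>

lemma cocycle_coeff_rec:
  assumes E: "finite E" and "one_cocycle E \<Lambda>" and c: "cocycle_coeffs E \<Lambda> a" and f: "f \<in> mpol_on E"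
  shows "of_nat (Suc (Suc m)) * coeff (\<Lambda> f) (Suc (Suc m)) = (\<Sum>e\<in>E. coeff (\<Lambda> (partial_d e f)) (Suc m))"
proof -
  have "of_nat (Suc (Suc m)) * coeff (\<Lambda> f) (Suc (Suc m)) =
      lin_ext (\<lambda>\<gamma>. of_nat (Suc (Suc m)) * coeff (\<Lambda> (single \<gamma> 1)) (Suc (Suc m))) f"
    by (simp add: coeff_linear[OF assms(2) f] lin_ext_def sum_distrib_left mult_ac)
  also have "\<dots> = lin_ext (\<lambda>\<gamma>. \<Sum>e\<in>E. of_nat (lookup \<gamma> e) * coeff (\<Lambda> (single (\<gamma> - single e 1) 1)) (Suc m)) f"
    unfolding lin_ext_def using f
    by (intro sum.cong refl arg_cong[where f = "(*) _"] cocycle_coeff_rec_single[OF E c]) (auto simp: mpol_on_def)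
  finally show ?thesis
    unfolding coeff_linear[OF assms(2) mpol_on_partial_d[OF f]] lin_ext_partial_d .
qed

lemma lin_ext_split_0: "lin_ext h f = h 0 * lookup f 0 + lin_ext (\<lambda>\<gamma>. if \<gamma> = 0 then 0 else h \<gamma>) f"
proof -
  have "lin_ext h f = (\<Sum>\<gamma>\<in>keys f. (if \<gamma> = 0 then lookup f 0 * h 0 else 0) +
      lookup f \<gamma> * (if \<gamma> = 0 then 0 else h \<gamma>))"
    unfolding lin_ext_def by (rule sum.cong) simp_all
  then show ?thesis
    by (simp add: sum.distrib lin_ext_def sum.delta in_keys_iff mult.commute)
qed

text \<open>Since the sum over \<open>e\<close> of \<gamma> e (|\<gamma>| - 1)! is |\<gamma>|! for
  nonzero \<gamma>, functionals with this weight reproduce themselves with \<open>g\<close> shifted.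
  Only the constant term, which every derivative kills, is left over.\<close>

lemma lin_ext_fact_partial_d:
  assumes E: "finite E" and f: "f \<in> mpol_on E"
  shows "lin_ext (\<lambda>\<gamma>. fact (mi_deg \<gamma>) * g \<gamma>) f =
    g 0 * lookup f 0 + (\<Sum>e\<in>E. lin_ext (\<lambda>\<gamma>. fact (mi_deg \<gamma>) * g (\<gamma> + single e 1)) (partial_d e f))"
proof -
  have "(\<Sum>e\<in>E. of_nat (lookup \<gamma> e) * (fact (mi_deg (\<gamma> - single e 1)) * g (\<gamma> - single e 1 + single e 1))) =
      (if \<gamma> = 0 then 0 else fact (mi_deg \<gamma>) * g \<gamma>)" if "\<gamma> \<in> keys f" for \<gamma>
  proof (cases "\<gamma> = 0")
    case False
    have \<gamma>: "keys \<gamma> \<subseteq> E" using f that by (auto simp: mpol_on_def)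
    have "of_nat (lookup \<gamma> e) * (fact (mi_deg (\<gamma> - single e 1)) * g (\<gamma> - single e 1 + single e 1)) =
        of_nat (lookup \<gamma> e) * (fact (mi_deg \<gamma> - 1) * g \<gamma>)" if "e \<in> E" for e
    proof (cases "lookup \<gamma> e = 0")
      case False
      then have "\<gamma> - single e 1 + single e 1 = \<gamma>"
        by (auto simp: poly_mapping_eq_iff fun_eq_iff lookup_add lookup_minus lookup_single when_def)
      moreover have "mi_deg (\<gamma> - single e 1) = mi_deg \<gamma> - 1"
      proof -
        have "(\<Sum>x\<in>E - {e}. lookup \<gamma> x - lookup (single e 1) x) = (\<Sum>x\<in>E - {e}. lookup \<gamma> x)"
          by (intro sum.cong refl) (auto simp: lookup_single when_def)
        then show ?thesis
          using False unfolding mi_deg_minus[OF E \<gamma>] mi_deg_superset[OF E \<gamma>] sum.remove[OF E that] by simp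
      qed
      ultimately show ?thesis by simp
    qed simp
    then have "(\<Sum>e\<in>E. of_nat (lookup \<gamma> e) * (fact (mi_deg (\<gamma> - single e 1)) * g (\<gamma> - single e 1 + single e 1))) =
      (\<Sum>e\<in>E. of_nat (lookup \<gamma> e)) * (fact (mi_deg \<gamma> - 1) * g \<gamma>)"
      unfolding sum_distrib_right by (rule sum.cong[OF refl])
    also have "\<dots> = of_nat (mi_deg \<gamma>) * fact (mi_deg \<gamma> - 1) * g \<gamma>"
      by (simp add: mi_deg_superset[OF E \<gamma>] mult.assoc)
    also have "of_nat (mi_deg \<gamma>) * fact (mi_deg \<gamma> - 1) = (fact (mi_deg \<gamma>) :: 'b)"
      using False by (metis fact_reduce gr0I mi_deg_eq_0)
    finally show ?thesis using False by simp
  qed simp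
  then have "(\<Sum>e\<in>E. lin_ext (\<lambda>\<gamma>. fact (mi_deg \<gamma>) * g (\<gamma> + single e 1)) (partial_d e f)) =
      lin_ext (\<lambda>\<gamma>. if \<gamma> = 0 then 0 else fact (mi_deg \<gamma>) * g \<gamma>) f"
    unfolding lin_ext_partial_d by (simp add: lin_ext_def)
  then show ?thesis
    by (subst lin_ext_split_0) (simp add: mi_deg_eq_0[THEN iffD2])
qed

section \<open>Products of univariate polynomials in distinct variables\<close>

text \<open>The pure tensor of the \<open>p e\<close>, under the identification of the tensor power
  of K[L] with a polynomial ring in the variables L_e.\<close>

definition mprod :: "'e set \<Rightarrow> ('e \<Rightarrow> 'k::comm_ring_1 poly) \<Rightarrow> ('e, 'k) mpol" where
  "mprod J p = (\<Prod>e\<in>J. in_variable e (p e))"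

text \<open>L_e does not occur in \<open>f\<close>, so the exponent of L_e has to come from the
  first factor and all other exponents from the second.\<close>

lemma lookup_in_variable_mult:
  assumes "\<And>\<gamma>. \<gamma> \<in> keys f \<Longrightarrow> lookup \<gamma> e = 0"
  shows "lookup (in_variable e p * f) \<alpha> = coeff p (lookup \<alpha> e) * lookup f (\<alpha> - single e (lookup \<alpha> e))"
proof -
  have "lookup (single (single e n) c * f) \<alpha> = (if n = lookup \<alpha> e then c * lookup f (\<alpha> - single e n) else 0)" for n and c
  proof -
    have "lookup (single (single e n) c * f) \<alpha> = (\<Sum>\<gamma>\<in>keys f. if single e n + \<gamma> = \<alpha> then c * lookup f \<gamma> else 0)"
    proof -
      have "single (single e n) c * f = (\<Sum>\<gamma>\<in>keys f. single (single e n + \<gamma>) (c * lookup f \<gamma>))"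
        using arg_cong[OF sum_monomials[of f], of "(*) (single (single e n) c)"]
        by (simp only: sum_distrib_left mult_single)
      then show ?thesis
        by (simp add: lookup_sum lookup_single when_def)
    qed
    also have "\<dots> = (\<Sum>\<gamma>\<in>keys f. if \<gamma> = \<alpha> - single e n then (if n = lookup \<alpha> e then c * lookup f \<gamma> else 0) else 0)"
    proof (rule sum.cong[OF refl])
      fix \<gamma> assume "\<gamma> \<in> keys f"
      then have 0: "lookup \<gamma> e = 0" by (rule assms)
      have "single e n + \<gamma> = \<alpha> \<longleftrightarrow> \<gamma> = \<alpha> - single e n \<and> n = lookup \<alpha> e"
      proof
        assume "single e n + \<gamma> = \<alpha>"
        then show "\<gamma> = \<alpha> - single e n \<and> n = lookup \<alpha> e"
          using 0 by (auto simp: lookup_add)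
      next
        assume "\<gamma> = \<alpha> - single e n \<and> n = lookup \<alpha> e"
        then show "single e n + \<gamma> = \<alpha>"
          by (auto simp: poly_mapping_eq_iff fun_eq_iff lookup_add lookup_minus lookup_single when_def)
      qed
      then show "(if single e n + \<gamma> = \<alpha> then c * lookup f \<gamma> else 0) =
        (if \<gamma> = \<alpha> - single e n then (if n = lookup \<alpha> e then c * lookup f \<gamma> else 0) else 0)"
        by simp
    qed
    also have "\<dots> = (if n = lookup \<alpha> e then c * lookup f (\<alpha> - single e n) else 0)"
      by (simp add: sum.delta in_keys_iff)
    finally show ?thesis .
  qed
  then show ?thesis
    by (simp add: in_variable_def sum_distrib_right lookup_sum coeff_eq_0)
qed

lemma lookup_mprod:
  assumes "finite J"
  shows "lookup (mprod J p) \<alpha> = (if keys \<alpha> \<subseteq> J then \<Prod>e\<in>J. coeff (p e) (lookup \<alpha> e) else 0)"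
  using assms
proof (induction J arbitrary: \<alpha>)
  case empty
  show ?case by (simp add: mprod_def lookup_one when_def)
next
  case (insert e J)
  let ?\<beta> = "\<alpha> - single e (lookup \<alpha> e)"
  have l: "lookup ?\<beta> x = (if x = e then 0 else lookup \<alpha> x)" for x
    by (simp add: lookup_minus lookup_single)
  have "lookup \<gamma> e = 0" if "\<gamma> \<in> keys (mprod J p)" for \<gamma>
    using that insert by (auto simp: in_keys_iff split: if_splits)
  then have "lookup (mprod (insert e J) p) \<alpha> = coeff (p e) (lookup \<alpha> e) * lookup (mprod J p) ?\<beta>"
    using insert(1,2) by (simp add: mprod_def lookup_in_variable_mult)
  moreover have "keys ?\<beta> \<subseteq> J \<longleftrightarrow> keys \<alpha> \<subseteq> insert e J"
    using insert(2) by (auto simp: in_keys_iff l subset_iff split: if_splits)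
  moreover have "(\<Prod>x\<in>J. coeff (p x) (lookup ?\<beta> x)) = (\<Prod>x\<in>J. coeff (p x) (lookup \<alpha> x))"
    using insert(2) by (intro prod.cong refl) (auto simp: l)
  ultimately show ?case
    using insert by simp
qed

lemma mpol_on_mprod:
  assumes "finite J"
  shows "mprod J p \<in> mpol_on J"
proof -
  have "keys \<alpha> \<subseteq> J" if "\<alpha> \<in> keys (mprod J p)" for \<alpha>
    using that lookup_mprod[OF assms, of p \<alpha>] by (metis in_keys_iff)
  then show ?thesis by (simp add: mpol_on_def)
qed

text \<open>Only the factor in L_e is differentiated. The hypotheses have the shape of the
  derivative formula for one branch: \<open>x\<close> will range over its vertices, and
  \<open>q x\<close> will be the family of factors after cutting off the subtree at
  \<open>x\<close>.\<close>

lemma partial_d_mprod: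
  assumes J: "finite J" "e \<in> J"
    and p: "pderiv (p e) = (\<Sum>x\<in>A. smult (c x) (q x e))"
    and q: "\<And>x e'. x \<in> A \<Longrightarrow> e' \<in> J \<Longrightarrow> e' \<noteq> e \<Longrightarrow> q x e' = p e'"
  shows "partial_d e (mprod J p) = (\<Sum>x\<in>A. scale (c x) (mprod J (q x)))"
proof (rule poly_mapping_eqI)
  fix \<beta>
  show "lookup (partial_d e (mprod J p)) \<beta> = lookup (\<Sum>x\<in>A. scale (c x) (mprod J (q x))) \<beta>"
  proof (cases "keys \<beta> \<subseteq> J")
    case True
    have l: "lookup (\<beta> + single e 1) x = (if x = e then Suc (lookup \<beta> e) else lookup \<beta> x)" for x
      by (simp add: lookup_add lookup_single)
    have k: "keys (\<beta> + single e 1) \<subseteq> J"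
      using True J(2) by (auto simp: in_keys_iff l subset_iff split: if_splits simp del: One_nat_def)
    have "of_nat (Suc (lookup \<beta> e)) * coeff (p e) (Suc (lookup \<beta> e)) = coeff (pderiv (p e)) (lookup \<beta> e)"
      by (simp add: coeff_pderiv)
    also have "\<dots> = (\<Sum>x\<in>A. c x * coeff (q x e) (lookup \<beta> e))"
      by (simp add: p coeff_sum)
    finally have *: "of_nat (Suc (lookup \<beta> e)) * coeff (p e) (Suc (lookup \<beta> e)) = \<dots>" .
    have **: "(\<Prod>e'\<in>J - {e}. coeff (p e') (lookup (\<beta> + single e 1) e')) =
        (\<Prod>e'\<in>J - {e}. coeff (q x e') (lookup \<beta> e'))" if "x \<in> A" for x
      using q[OF that] by (intro prod.cong refl) (auto simp: l simp del: One_nat_def)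
    have "lookup (partial_d e (mprod J p)) \<beta> = (of_nat (Suc (lookup \<beta> e)) * coeff (p e) (Suc (lookup \<beta> e))) *
        (\<Prod>e'\<in>J - {e}. coeff (p e') (lookup (\<beta> + single e 1) e'))"
      using k by (simp add: lookup_partial_d lookup_mprod J(1) prod.remove[OF J] l mult.assoc del: of_nat_Suc One_nat_def)
    also have "\<dots> = (\<Sum>x\<in>A. c x * (coeff (q x e) (lookup \<beta> e) * (\<Prod>e'\<in>J - {e}. coeff (q x e') (lookup \<beta> e'))))"
      unfolding * sum_distrib_right by (intro sum.cong refl) (simp add: ** mult.assoc del: One_nat_def)
    finally show ?thesis
      using True by (simp add: lookup_sum lookup_mprod J(1) prod.remove[OF J])
  next
    case False
    then have "\<not> keys (\<beta> + single e 1) \<subseteq> J"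
      by (auto simp: in_keys_iff lookup_add subset_iff)
    then show ?thesis using False by (simp add: lookup_partial_d lookup_mprod J(1) lookup_sum)
  qed
qed

section \<open>Induced forests on sets of vertices\<close>

abbreviation induced :: "'v rel \<Rightarrow> 'v set \<Rightarrow> 'v rel" where
  "induced R X \<equiv> R \<inter> X \<times> X"

text \<open>Paths have to stay inside \<open>X\<close>, so that one relation \<open>R\<close> serves
  for all subforests. By reflexivity \<open>v\<close> is included even if it lies outside
  \<open>X\<close>.\<close>

definition desc :: "'v rel \<Rightarrow> 'v set \<Rightarrow> 'v \<Rightarrow> 'v set" where
  "desc R X v = {w. (v, w) \<in> (induced R X)\<^sup>*}"

text \<open>The vertex set of the branch f_e of a tree with root \<open>r\<close>: everything that
  hangs from \<open>r\<close> by edges decorated \<open>e\<close>. It is in general a forest,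
  possibly empty.\<close>

definition branch :: "'v rel \<Rightarrow> ('v \<times> 'v \<Rightarrow> 'e) \<Rightarrow> 'v set \<Rightarrow> 'v \<Rightarrow> 'e \<Rightarrow> 'v set" where
  "branch R \<epsilon> X r e = (\<Union>w\<in>{w\<in>X. (r, w) \<in> R \<and> \<epsilon> (r, w) = e}. desc R X w)"

definition down_closed :: "'v rel \<Rightarrow> 'v set \<Rightarrow> 'v set \<Rightarrow> bool" where
  "down_closed R X Y \<longleftrightarrow> Y \<subseteq> X \<and> (\<forall>(u, w)\<in>R. u \<in> Y \<longrightarrow> w \<in> X \<longrightarrow> w \<in> Y)"

definition is_tree :: "'v rel \<Rightarrow> 'v set \<Rightarrow> 'v \<Rightarrow> bool" where
  "is_tree R X r \<longleftrightarrow> r \<in> X \<and> desc R X r = X"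

lemma desc_self [simp]: "v \<in> desc R X v"
  by (simp add: desc_def)

lemma desc_subset: "v \<in> X \<Longrightarrow> desc R X v \<subseteq> X"
  by (auto simp: desc_def elim: rtranclE)

lemma desc_trans: "w \<in> desc R X v \<Longrightarrow> x \<in> desc R X w \<Longrightarrow> x \<in> desc R X v"
  unfolding desc_def by auto

lemma desc_step: "w \<in> desc R X v \<Longrightarrow> (w, x) \<in> R \<Longrightarrow> w \<in> X \<Longrightarrow> x \<in> X \<Longrightarrow> x \<in> desc R X v"
  unfolding desc_def by (auto intro: rtrancl_into_rtrancl)

lemma desc_child: "v \<in> X \<Longrightarrow> (v, w) \<in> R \<Longrightarrow> w \<in> X \<Longrightarrow> w \<in> desc R X v"
  by (rule desc_step) auto

lemma desc_cases:
  assumes "x \<in> desc R X v"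
  obtains "x = v" | y where "y \<in> desc R X v" "(y, x) \<in> R" "y \<in> X" "x \<in> X"
  using assms unfolding desc_def by (auto elim: rtranclE)

lemma down_closed_desc: "v \<in> X \<Longrightarrow> down_closed R X (desc R X v)"
  unfolding down_closed_def using desc_subset[of v X R] desc_step[of _ R X v] by fast

lemma desc_down_closed:
  assumes "down_closed R X Y" "v \<in> Y"
  shows "desc R Y v = desc R X v"
proof
  show "desc R Y v \<subseteq> desc R X v"
    unfolding desc_def using assms(1)
    by (auto simp: down_closed_def intro: rtrancl_mono[THEN subsetD, rotated])
  have "x \<in> desc R Y v \<and> x \<in> Y" if "(v, x) \<in> (induced R X)\<^sup>*" for x
    using that
  proof induction
    case base
    then show ?case using assms by simp
  next
    case (step y z)
    then have "z \<in> Y" using assms(1) unfolding down_closed_def by blast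
    then show ?case using step by (auto intro: desc_step)
  qed
  then show "desc R X v \<subseteq> desc R Y v"
    by (auto simp: desc_def)
qed

text \<open>A path that ends outside the subtree of \<open>v\<close> never enters it, because this
  subtree is closed under children.\<close>

lemma desc_diff:
  assumes "v \<in> X" "w \<in> X - desc R X v"
  shows "desc R (X - desc R X v) w = desc R X w - desc R X v"
proof
  let ?Y = "X - desc R X v"
  show "desc R ?Y w \<subseteq> desc R X w - desc R X v"
  proof
    fix x assume "x \<in> desc R ?Y w"
    then have "(w, x) \<in> (induced R ?Y)\<^sup>*" by (simp add: desc_def)
    then show "x \<in> desc R X w - desc R X v"
    proof induction
      case base
      then show ?case using assms by simp
    next
      case (step y z)
      then show ?case by (auto intro: desc_step)
    qed
  qed
  show "desc R X w - desc R X v \<subseteq> desc R ?Y w"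
  proof
    fix x assume "x \<in> desc R X w - desc R X v"
    then have "(w, x) \<in> (induced R X)\<^sup>*" and "x \<notin> desc R X v" by (auto simp: desc_def)
    then show "x \<in> desc R ?Y w"
    proof induction
      case (step y z)
      have "y \<notin> desc R X v"
        using step.hyps(2) step.prems by (auto intro: desc_step)
      then show ?case
        using step by (auto intro: desc_step)
    qed simp
  qed
qed

lemma down_closed_branch: "down_closed R X (branch R \<epsilon> X r e)"
  unfolding down_closed_def branch_def using desc_subset[of _ X R] desc_step[of _ R X] by fast

lemma branch_subset: "branch R \<epsilon> X r e \<subseteq> X"
  using down_closed_branch[of R X \<epsilon> r e] by (simp add: down_closed_def)

lemma desc_subset_branch:
  assumes "v \<in> branch R \<epsilon> X r e"
  shows "desc R X v \<subseteq> branch R \<epsilon> X r e"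
  using assms unfolding branch_def by (auto intro: desc_trans)

section \<open>Subtrees and branches for an acyclic relation with unique parents\<close>

locale arborescence =
  fixes R :: "'v rel"
  assumes acyclic: "acyclic R"
    and parent: "(u, w) \<in> R \<Longrightarrow> (v, w) \<in> R \<Longrightarrow> u = v"
begin

lemma wf_induced: "finite X \<Longrightarrow> wf ((induced R X)\<inverse>)"
  by (intro finite_acyclic_wf_converse) (auto intro: acyclic_subset[OF acyclic])

lemma exists_root:
  assumes "finite X" "X \<noteq> {}"
  obtains r where "r \<in> X" "\<And>u. u \<in> X \<Longrightarrow> (u, r) \<notin> R"
proof -
  have "wf (induced R X)"
    using assms(1) by (intro finite_acyclic_wf) (auto intro: acyclic_subset[OF acyclic])
  then obtain r where "r \<in> X" "\<And>u. (u, r) \<in> induced R X \<Longrightarrow> u \<notin> X"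
    using assms(2) by (metis wfE_min ex_in_conv)
  then show ?thesis using that by blast
qed

text \<open>An edge entering the subtree of \<open>r\<close> from outside could end only in
  \<open>r\<close>, since every other vertex of the subtree has its unique parent inside.\<close>

lemma down_closed_remove:
  assumes "\<And>u. u \<in> X \<Longrightarrow> (u, r) \<notin> R"
  shows "down_closed R X (X - desc R X r)"
  unfolding down_closed_def
proof (clarsimp)
  fix u w assume uw: "(u, w) \<in> R" "u \<in> X" "u \<notin> desc R X r" "w \<in> X" "w \<in> desc R X r"
  from uw(5) show False
    by (cases rule: desc_cases) (use uw assms parent in blast)+
qed

lemma desc_antisym:
  assumes "w \<in> desc R X v" "v \<in> desc R X w"
  shows "v = w"
proof -
  have "induced R X \<subseteq> R" by blast
  then have "(v, w) \<in> R\<^sup>*" "(w, v) \<in> R\<^sup>*"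
    using assms unfolding desc_def by (auto intro: rtrancl_mono[THEN subsetD])
  then show ?thesis
    using acyclic acyclic_impl_antisym_rtrancl antisymD by metis
qed

text \<open>Unique parents make the converse relation single-valued, so two ancestors of
  \<open>x\<close> lie on one upward path.\<close>

lemma desc_comparable:
  assumes "x \<in> desc R X v" "x \<in> desc R X w"
  shows "v \<in> desc R X w \<or> w \<in> desc R X v"
proof -
  have "single_valued ((induced R X)\<inverse>)"
    by (auto simp: single_valued_def intro: parent)
  moreover have "(x, v) \<in> ((induced R X)\<inverse>)\<^sup>*" "(x, w) \<in> ((induced R X)\<inverse>)\<^sup>*"
    using assms by (auto simp: desc_def rtrancl_converse)
  ultimately have "(v, w) \<in> ((induced R X)\<inverse>)\<^sup>* \<or> (w, v) \<in> ((induced R X)\<inverse>)\<^sup>*"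
    by (rule single_valued_confluent)
  then show ?thesis
    by (auto simp: desc_def rtrancl_converse)
qed

lemma no_parent_in_desc:
  assumes "(u, v) \<in> R" "v \<in> X"
  shows "u \<notin> desc R X v"
proof
  assume u: "u \<in> desc R X v"
  then have "u \<in> X" using desc_subset[OF assms(2)] by blast
  then have "v \<in> desc R X u" using assms by (intro desc_child)
  then have "u = v" using u desc_antisym by blast
  then show False using assms(1) acyclic by (auto simp: acyclic_def)
qed

text \<open>The last edge of the path from \<open>v\<close> to \<open>w\<close> starts at the unique
  parent of \<open>w\<close>, which is \<open>r\<close>.\<close>

lemma child_comparable:
  assumes "(r, w) \<in> R" "w \<in> desc R X v" "v \<noteq> w"
  shows "r \<in> desc R X v"
  using assms(2)
proof (cases rule: desc_cases)
  case (2 y)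
  then show ?thesis using parent[OF assms(1) 2(2)] by simp
qed (use assms(3) in simp)

lemma branch_root: "r \<notin> branch R \<epsilon> X r e"
  unfolding branch_def using no_parent_in_desc by auto

text \<open>If the subtrees of two distinct children of \<open>r\<close> met, one child would be a
  descendant of the other, and then \<open>r\<close> a descendant of its own child.\<close>

lemma branch_disjoint:
  assumes "x \<in> branch R \<epsilon> X r e" "x \<in> branch R \<epsilon> X r e'"
  shows "e = e'"
proof -
  obtain w w' where w: "w \<in> X" "(r, w) \<in> R" "\<epsilon> (r, w) = e" "x \<in> desc R X w"
    and w': "w' \<in> X" "(r, w') \<in> R" "\<epsilon> (r, w') = e'" "x \<in> desc R X w'"
    using assms by (auto simp: branch_def)
  have "w = w'"
    using desc_comparable[OF w(4) w'(4)] child_comparable[OF w(2), of X w'] child_comparable[OF w'(2), of X w]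
      no_parent_in_desc[OF w(2,1)] no_parent_in_desc[OF w'(2,1)] by blast
  then show ?thesis using w w' by simp
qed

lemma tree_subtree: "v \<in> X \<Longrightarrow> is_tree R (desc R X v) v"
  by (simp add: is_tree_def desc_down_closed[OF down_closed_desc])

lemma tree_root_notin:
  assumes "is_tree R X r" "v \<in> X" "v \<noteq> r"
  shows "r \<notin> desc R X v"
  using assms desc_antisym[of v X r] by (auto simp: is_tree_def)

lemma tree_remove:
  assumes "is_tree R X r" "v \<in> X" "v \<noteq> r"
  shows "is_tree R (X - desc R X v) r"
  using assms tree_root_notin[OF assms] desc_diff[OF assms(2), of r] by (auto simp: is_tree_def)

lemma tree_branches:
  assumes X: "is_tree R X r" and e: "\<And>w. w \<in> X \<Longrightarrow> (r, w) \<in> R \<Longrightarrow> \<epsilon> (r, w) \<in> J"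
  shows "X - {r} = (\<Union>e\<in>J. branch R \<epsilon> X r e)"
proof
  show "(\<Union>e\<in>J. branch R \<epsilon> X r e) \<subseteq> X - {r}"
    using branch_subset branch_root by fast
  show "X - {r} \<subseteq> (\<Union>e\<in>J. branch R \<epsilon> X r e)"
  proof
    fix x assume x: "x \<in> X - {r}"
    then have "(r, x) \<in> (induced R X)\<^sup>*" using X by (auto simp: is_tree_def desc_def)
    then obtain w where w: "(r, w) \<in> induced R X" "(w, x) \<in> (induced R X)\<^sup>*"
      using x by (auto elim: converse_rtranclE)
    then have "x \<in> branch R \<epsilon> X r (\<epsilon> (r, w))"
      by (auto simp: branch_def desc_def)
    then show "x \<in> (\<Union>e\<in>J. branch R \<epsilon> X r e)" using w e by auto
  qed
qed

lemma branch_remove: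
  assumes "v \<in> X"
  shows "branch R \<epsilon> (X - desc R X v) r e = branch R \<epsilon> X r e - desc R X v"
proof -
  let ?C = "{w\<in>X. (r, w) \<in> R \<and> \<epsilon> (r, w) = e}"
  have "branch R \<epsilon> (X - desc R X v) r e = (\<Union>w\<in>?C - desc R X v. desc R (X - desc R X v) w)"
    unfolding branch_def by (rule SUP_cong) auto
  also have "\<dots> = (\<Union>w\<in>?C - desc R X v. desc R X w - desc R X v)"
    by (intro SUP_cong refl desc_diff assms) auto
  \<comment> \<open>Children of \<open>r\<close> inside the removed subtree contribute the empty
    set, so they may be put back.\<close>
  also have "\<dots> = (\<Union>w\<in>?C. desc R X w - desc R X v)"
    by (auto intro: desc_trans)
  also have "\<dots> = branch R \<epsilon> X r e - desc R X v"
    unfolding branch_def by auto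
  finally show ?thesis .
qed

end

section \<open>The polynomial of a forest by recursion on children\<close>

locale cocycles =
  fixes I :: "'i set" and E :: "'i \<Rightarrow> 'e set"
    and \<Lambda> :: "'i \<Rightarrow> ('e, 'k::field_char_0) mpol \<Rightarrow> 'k poly"
    and a :: "'i \<Rightarrow> 'e mindex \<Rightarrow> 'k"
  assumes finite_E: "i \<in> I \<Longrightarrow> finite (E i)"
    and cocycle: "i \<in> I \<Longrightarrow> one_cocycle (E i) (\<Lambda> i)"
    and coeffs: "i \<in> I \<Longrightarrow> cocycle_coeffs (E i) (\<Lambda> i) (a i)"
begin

text \<open>The value of the morphism on the subtree with root \<open>v\<close>, as forced by
  compatibility with grafting: the product over the children along edges decorated \<open>e\<close>
  is its value on the branch f_e.\<close>

definition pol :: "('v \<Rightarrow> 'i) \<Rightarrow> ('v \<times> 'v \<Rightarrow> 'e) \<Rightarrow> 'v rel \<Rightarrow> 'v \<Rightarrow> 'k poly" where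
  "pol d \<epsilon> R = wfrec (R\<inverse>)
     (\<lambda>g v. \<Lambda> (d v) (mprod (E (d v)) (\<lambda>e. \<Prod>w | (v, w) \<in> R \<and> \<epsilon> (v, w) = e. g w)))"

lemma pol_unfold:
  assumes "wf (R\<inverse>)"
  shows "pol d \<epsilon> R v =
    \<Lambda> (d v) (mprod (E (d v)) (\<lambda>e. \<Prod>w | (v, w) \<in> R \<and> \<epsilon> (v, w) = e. pol d \<epsilon> R w))"
  unfolding pol_def
  by (subst wfrec[OF assms]) (simp add: cut_def cong: prod.cong_simp)

text \<open>The recursion at \<open>v\<close> visits only descendants of \<open>v\<close>, so an
  injection that matches children on a set closed under children preserves the result. This covers
  isomorphisms, subforests (with the identity) and the embedding of a forest into a graft.\<close>

lemma pol_transfer: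
  assumes wf: "wf (R\<inverse>)" "wf (R'\<inverse>)"
    and closed: "\<And>v w. v \<in> S \<Longrightarrow> (v, w) \<in> R \<Longrightarrow> w \<in> S"
    and inj: "inj_on h S"
    and ch: "\<And>v. v \<in> S \<Longrightarrow> {w'. (h v, w') \<in> R'} = h ` {w. (v, w) \<in> R}"
    and d: "\<And>v. v \<in> S \<Longrightarrow> d' (h v) = d v"
    and \<epsilon>: "\<And>v w. v \<in> S \<Longrightarrow> (v, w) \<in> R \<Longrightarrow> \<epsilon>' (h v, h w) = \<epsilon> (v, w)"
    and v: "v \<in> S"
  shows "pol d' \<epsilon>' R' (h v) = pol d \<epsilon> R v"
  using v
proof (induction v rule: wf_induct_rule[OF wf(1)])
  case (1 v)
  have "(\<Prod>w' | (h v, w') \<in> R' \<and> \<epsilon>' (h v, w') = e. pol d' \<epsilon>' R' w') =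
      (\<Prod>w | (v, w) \<in> R \<and> \<epsilon> (v, w) = e. pol d \<epsilon> R w)" for e
  proof -
    have "{w'. (h v, w') \<in> R' \<and> \<epsilon>' (h v, w') = e} = h ` {w. (v, w) \<in> R \<and> \<epsilon> (v, w) = e}"
      using ch[OF 1(2)] \<epsilon>[OF 1(2)] by force
    moreover have "inj_on h {w. (v, w) \<in> R \<and> \<epsilon> (v, w) = e}"
      using closed[OF 1(2)] by (auto intro: inj_on_subset[OF inj])
    ultimately show ?thesis
      using 1 closed by (simp add: prod.reindex cong: prod.cong_simp)
  qed
  then show ?case
    using 1(2) by (simp add: pol_unfold[OF wf(2), of _ _ "h v"] pol_unfold[OF wf(1), of _ _ v] d)
qed

text \<open>The product is over the roots of the components of \<open>X\<close>, since an algebra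
  morphism turns disjoint unions into products.\<close>

definition phi :: "('v \<Rightarrow> 'i) \<Rightarrow> ('v \<times> 'v \<Rightarrow> 'e) \<Rightarrow> 'v rel \<Rightarrow> 'v set \<Rightarrow> 'k poly" where
  "phi d \<epsilon> R X = (\<Prod>v | v \<in> X \<and> (\<forall>u\<in>X. (u, v) \<notin> R). pol d \<epsilon> (induced R X) v)"

lemma phi_empty [simp]: "phi d \<epsilon> R {} = 1"
  by (simp add: phi_def)

lemma phi_transfer:
  assumes wf: "wf ((induced R X)\<inverse>)" "wf ((induced R' X')\<inverse>)"
    and h: "bij_betw h X X'"
    and R: "\<And>u v. u \<in> X \<Longrightarrow> v \<in> X \<Longrightarrow> (h u, h v) \<in> R' \<longleftrightarrow> (u, v) \<in> R"
    and d: "\<And>v. v \<in> X \<Longrightarrow> d' (h v) = d v"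
    and \<epsilon>: "\<And>v w. v \<in> X \<Longrightarrow> w \<in> X \<Longrightarrow> (v, w) \<in> R \<Longrightarrow> \<epsilon>' (h v, h w) = \<epsilon> (v, w)"
  shows "phi d' \<epsilon>' R' X' = phi d \<epsilon> R X"
proof -
  have inj: "inj_on h X" and X': "X' = h ` X" using h by (auto simp: bij_betw_def)
  have "{v'. v' \<in> X' \<and> (\<forall>u\<in>X'. (u, v') \<notin> R')} = h ` {v. v \<in> X \<and> (\<forall>u\<in>X. (u, v) \<notin> R)}"
    using R unfolding X' by auto
  moreover have "pol d' \<epsilon>' (induced R' X') (h v) = pol d \<epsilon> (induced R X) v" if "v \<in> X" for v
    by (rule pol_transfer[OF wf, of X]) (use inj R d \<epsilon> that in \<open>auto simp: X'\<close>)
  ultimately show ?thesis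
    unfolding phi_def by (simp add: prod.reindex inj_on_subset[OF inj] cong: prod.cong_simp)
qed

end

section \<open>The derivative formula\<close>

locale decorated = arborescence R + cocycles I E \<Lambda> a
  for R :: "'v rel" and I :: "'i set" and E :: "'i \<Rightarrow> 'e set"
    and \<Lambda> :: "'i \<Rightarrow> ('e, 'k::field_char_0) mpol \<Rightarrow> 'k poly"
    and a :: "'i \<Rightarrow> 'e mindex \<Rightarrow> 'k" +
  fixes d :: "'v \<Rightarrow> 'i" and \<epsilon> :: "'v \<times> 'v \<Rightarrow> 'e" and V :: "'v set"
  assumes finite_V: "finite V"
    and d: "v \<in> V \<Longrightarrow> d v \<in> I"
    and \<epsilon>: "u \<in> V \<Longrightarrow> v \<in> V \<Longrightarrow> (u, v) \<in> R \<Longrightarrow> \<epsilon> (u, v) \<in> E (d u)"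
begin

abbreviation Phi where "Phi \<equiv> phi d \<epsilon> R"

abbreviation sig where "sig Y \<equiv> coeff (Phi Y) 1"

definition branch_poly :: "'v set \<Rightarrow> 'v \<Rightarrow> ('e, 'k) mpol" where
  "branch_poly X r = mprod (E (d r)) (\<lambda>e. Phi (branch R \<epsilon> X r e))"

lemma finite_sub: "X \<subseteq> V \<Longrightarrow> finite X"
  using finite_V finite_subset by blast

lemma pol_down_closed:
  assumes X: "X \<subseteq> V" and Y: "down_closed R X Y" and v: "v \<in> Y"
  shows "pol d \<epsilon> (induced R X) v = pol d \<epsilon> (induced R Y) v"
proof -
  have "pol d \<epsilon> (induced R X) (id v) = pol d \<epsilon> (induced R Y) v"
    by (rule pol_transfer[of _ _ Y])
      (use X Y v in \<open>auto simp: down_closed_def intro: wf_induced finite_sub\<close>)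
  then show ?thesis by simp
qed

lemma Phi_union:
  assumes X: "X \<subseteq> V" and Y: "down_closed R X Y" and Z: "down_closed R X Z"
    and "Y \<inter> Z = {}" "X = Y \<union> Z"
  shows "Phi X = Phi Y * Phi Z"
proof -
  let ?roots = "\<lambda>X. {v. v \<in> X \<and> (\<forall>u\<in>X. (u, v) \<notin> R)}"
  have "?roots X = ?roots Y \<union> ?roots Z" "?roots Y \<inter> ?roots Z = {}"
    using Y Z assms(4,5) unfolding down_closed_def by fast+
  moreover have "finite Y" "finite Z" using X assms(5) finite_sub by auto
  ultimately have "Phi X = (\<Prod>v\<in>?roots Y. pol d \<epsilon> (induced R X) v) * (\<Prod>v\<in>?roots Z. pol d \<epsilon> (induced R X) v)"
    unfolding phi_def by (simp add: prod.union_disjoint)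
  also have "\<dots> = Phi Y * Phi Z"
    unfolding phi_def using pol_down_closed[OF X Y] pol_down_closed[OF X Z]
    by (simp cong: prod.cong_simp)
  finally show ?thesis .
qed

lemma Phi_desc:
  assumes X: "X \<subseteq> V" and v: "v \<in> X"
  shows "Phi (desc R X v) = pol d \<epsilon> (induced R X) v"
proof -
  have "{w. w \<in> desc R X v \<and> (\<forall>u\<in>desc R X v. (u, w) \<notin> R)} = {v}"
    using no_parent_in_desc[OF _ v] by (auto elim: desc_cases)
  then show ?thesis
    unfolding phi_def using pol_down_closed[OF X down_closed_desc[OF v], of v] by simp
qed

text \<open>The roots of the branch are exactly the children of \<open>r\<close> along edges
  decorated \<open>e\<close>. This identifies the inner product in the recursion for
  \<open>pol\<close> with a value of \<open>Phi\<close>.\<close>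

lemma Phi_branch:
  assumes X: "X \<subseteq> V" and "r \<in> X"
  shows "Phi (branch R \<epsilon> X r e) =
    (\<Prod>w | (r, w) \<in> induced R X \<and> \<epsilon> (r, w) = e. pol d \<epsilon> (induced R X) w)"
proof -
  let ?B = "branch R \<epsilon> X r e"
  have "{v. v \<in> ?B \<and> (\<forall>u\<in>?B. (u, v) \<notin> R)} = {w. (r, w) \<in> induced R X \<and> \<epsilon> (r, w) = e}"
  proof (intro set_eqI iffI)
    fix v assume "v \<in> {v. v \<in> ?B \<and> (\<forall>u\<in>?B. (u, v) \<notin> R)}"
    then obtain w where w: "w \<in> X" "(r, w) \<in> R" "\<epsilon> (r, w) = e" "v \<in> desc R X w"
      and *: "\<forall>u\<in>?B. (u, v) \<notin> R" by (auto simp: branch_def)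
    have "v = w"
      using w(4)
    proof (cases rule: desc_cases)
      case (2 y)
      then have "y \<in> ?B" using w by (auto simp: branch_def)
      then show ?thesis using * 2 by blast
    qed
    then show "v \<in> {w. (r, w) \<in> induced R X \<and> \<epsilon> (r, w) = e}" using w assms by simp
  next
    fix v assume v: "v \<in> {w. (r, w) \<in> induced R X \<and> \<epsilon> (r, w) = e}"
    then have "v \<in> ?B" by (auto simp: branch_def)
    moreover have "(u, v) \<notin> R" if "u \<in> ?B" for u
      using parent[of u v r] v that branch_root[of r \<epsilon> X e] by blast
    ultimately show "v \<in> {v. v \<in> ?B \<and> (\<forall>u\<in>?B. (u, v) \<notin> R)}" by blast
  qed
  moreover have "pol d \<epsilon> (induced R ?B) w = pol d \<epsilon> (induced R X) w"
    if "w \<in> {w. (r, w) \<in> induced R X \<and> \<epsilon> (r, w) = e}" for w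
  proof -
    have "w \<in> ?B" using that by (auto simp: branch_def)
    then show ?thesis using pol_down_closed[OF X down_closed_branch] by metis
  qed
  ultimately show ?thesis
    unfolding phi_def by (simp cong: prod.cong_simp)
qed

lemma Phi_tree:
  assumes "X \<subseteq> V" "is_tree R X r"
  shows "Phi X = \<Lambda> (d r) (branch_poly X r)"
proof -
  have r: "r \<in> X" "desc R X r = X" using assms by (auto simp: is_tree_def)
  have "Phi X = pol d \<epsilon> (induced R X) r" using Phi_desc[OF assms(1) r(1)] r(2) by simp
  also have "\<dots> = \<Lambda> (d r) (branch_poly X r)"
    unfolding branch_poly_def Phi_branch[OF assms(1) r(1)]
    by (rule pol_unfold[OF wf_induced[OF finite_sub[OF assms(1)]]])
  finally show ?thesis .
qed

lemma branch_poly_mpol: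
  assumes "X \<subseteq> V" "r \<in> X"
  shows "branch_poly X r \<in> mpol_on (E (d r))"
  unfolding branch_poly_def using assms d finite_E by (intro mpol_on_mprod) auto

lemma Phi_tree_0:
  assumes "X \<subseteq> V" "is_tree R X r"
  shows "coeff (Phi X) 0 = 0"
proof -
  have r: "r \<in> X" using assms by (auto simp: is_tree_def)
  show ?thesis
    unfolding Phi_tree[OF assms] using assms r d
    by (intro cocycle_coeff_0[OF coeffs] branch_poly_mpol) auto
qed

text \<open>Cutting off a subtree inside one branch leaves the other branches unchanged, as branches
  are disjoint. The derivative formula for the branch appears as hypothesis \<open>B\<close> because
  within the proof of \<open>pderiv_Phi\<close> it is available only by induction, the branch being
  smaller than \<open>X\<close>.\<close>

lemma partial_d_branch_poly_aux:
  assumes X: "X \<subseteq> V" "r \<in> X" and e: "e \<in> E (d r)"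
    and B: "pderiv (Phi (branch R \<epsilon> X r e)) =
      (\<Sum>v\<in>branch R \<epsilon> X r e. smult (sig (desc R (branch R \<epsilon> X r e) v))
        (Phi (branch R \<epsilon> X r e - desc R (branch R \<epsilon> X r e) v)))"
  shows "partial_d e (branch_poly X r) =
    (\<Sum>v\<in>branch R \<epsilon> X r e. scale (sig (desc R X v)) (branch_poly (X - desc R X v) r))"
  unfolding branch_poly_def
proof (rule partial_d_mprod[OF _ e])
  show "finite (E (d r))" using X d finite_E by auto
  let ?B = "branch R \<epsilon> X r"
  have v: "v \<in> X" "desc R (?B e) v = desc R X v" "\<And>e'. branch R \<epsilon> (X - desc R X v) r e' = ?B e' - desc R X v"
    if "v \<in> ?B e" for v
  proof -
    show v: "v \<in> X" using that branch_subset by fast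
    show "desc R (?B e) v = desc R X v" by (rule desc_down_closed[OF down_closed_branch that])
    show "branch R \<epsilon> (X - desc R X v) r e' = ?B e' - desc R X v" for e' by (rule branch_remove[OF v])
  qed
  show "pderiv (Phi (?B e)) = (\<Sum>v\<in>?B e. smult (sig (desc R X v)) (Phi (branch R \<epsilon> (X - desc R X v) r e)))"
    unfolding B by (intro sum.cong refl) (simp add: v)
  show "Phi (branch R \<epsilon> (X - desc R X v) r e') = Phi (?B e')" if "v \<in> ?B e" "e' \<in> E (d r)" "e' \<noteq> e" for v e'
  proof -
    have "?B e' \<inter> desc R X v = {}"
      using desc_subset_branch[OF that(1)] branch_disjoint that(3) by fast
    then show ?thesis by (simp add: v(3)[OF that(1)] Diff_triv)
  qed
qed

lemma sum_branches:
  assumes X: "X \<subseteq> V" "is_tree R X r"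
  shows "(\<Sum>e\<in>E (d r). \<Sum>v\<in>branch R \<epsilon> X r e. g v) = (\<Sum>v\<in>X - {r}. g v)"
proof -
  have r: "r \<in> X" using X by (simp add: is_tree_def)
  have "X - {r} = (\<Union>e\<in>E (d r). branch R \<epsilon> X r e)"
    using \<epsilon> X r by (intro tree_branches[OF X(2)]) blast
  moreover have "finite (branch R \<epsilon> X r e)" for e
    using finite_sub[OF X(1)] branch_subset finite_subset by metis
  moreover have "branch R \<epsilon> X r e \<inter> branch R \<epsilon> X r e' = {}" if "e \<noteq> e'" for e e'
    using branch_disjoint[of _ \<epsilon> X r e e'] that by blast
  moreover have "finite (E (d r))" using finite_E d r X(1) by blast
  ultimately show ?thesis
    by (simp add: sum.UNION_disjoint)
qed

theorem pderiv_Phi: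
  assumes "X \<subseteq> V"
  shows "pderiv (Phi X) = (\<Sum>v\<in>X. smult (sig (desc R X v)) (Phi (X - desc R X v)))"
  using assms
proof (induction "card X" arbitrary: X rule: less_induct)
  case less
  have fin: "finite X" using less.prems by (rule finite_sub)
  show ?case
  proof (cases "X = {}")
    case False
    obtain r where r: "r \<in> X" "\<And>u. u \<in> X \<Longrightarrow> (u, r) \<notin> R"
      using exists_root[OF fin False] by blast
    let ?Y = "desc R X r" and ?Z = "X - desc R X r"
    have Y: "down_closed R X ?Y" by (rule down_closed_desc[OF r(1)])
    have desc: "desc R W v = desc R X v" if "down_closed R X W" "v \<in> W" for W v
      by (rule desc_down_closed[OF that])
    show ?thesis
    proof (cases "?Y = X")
      \<comment> \<open>Several components: the tree at \<open>r\<close> and the remaining vertices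
        are both smaller than \<open>X\<close>, and the formula is the product rule.\<close>
      case False
      have Ysub: "?Y \<subseteq> X" by (rule desc_subset[OF r(1)])
      have Z: "down_closed R X ?Z"
        by (rule down_closed_remove[OF r(2)])
      have cY: "card ?Y < card X" using False Ysub fin by (intro psubset_card_mono) auto
      have cZ: "card ?Z < card X"
        by (rule psubset_card_mono[OF fin]) (metis DiffD2 Diff_subset desc_self psubsetI r(1))
      have sub: "?Y \<subseteq> V" "?Z \<subseteq> V" using Ysub less.prems by auto
      have dis: "?Y \<inter> ?Z = {}" "X = ?Y \<union> ?Z" using Ysub by auto
      have PX: "Phi X = Phi ?Y * Phi ?Z"
        by (rule Phi_union[OF less.prems Y Z dis])
      have PY: "Phi (X - desc R X v) = Phi (?Y - desc R ?Y v) * Phi ?Z" if "v \<in> ?Y" for v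
      proof (rule Phi_union)
        have dv: "desc R X v \<subseteq> ?Y" using that by (auto intro: desc_trans)
        then show "X - desc R X v = (?Y - desc R ?Y v) \<union> ?Z" "(?Y - desc R ?Y v) \<inter> ?Z = {}"
          using Ysub unfolding desc[OF Y that] by auto
        show "X - desc R X v \<subseteq> V" using less.prems by auto
        show "down_closed R (X - desc R X v) (?Y - desc R ?Y v)"
          using Y unfolding desc[OF Y that] down_closed_def by blast
        show "down_closed R (X - desc R X v) ?Z"
          using Z dv unfolding down_closed_def by blast
      qed
      have PZ: "Phi (X - desc R X v) = Phi ?Y * Phi (?Z - desc R ?Z v)" if "v \<in> ?Z" for v
      proof (rule Phi_union)
        have dv: "desc R X v \<subseteq> ?Z"
          using desc_subset[of v ?Z R] that desc[OF Z that] by blast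
        then show "X - desc R X v = ?Y \<union> (?Z - desc R ?Z v)" "?Y \<inter> (?Z - desc R ?Z v) = {}"
          using Ysub unfolding desc[OF Z that] by auto
        show "X - desc R X v \<subseteq> V" using less.prems by auto
        show "down_closed R (X - desc R X v) ?Y"
          using Y dv unfolding down_closed_def by blast
        show "down_closed R (X - desc R X v) (?Z - desc R ?Z v)"
          using Z unfolding desc[OF Z that] down_closed_def by blast
      qed
      have "(\<Sum>v\<in>X. smult (sig (desc R X v)) (Phi (X - desc R X v))) =
          (\<Sum>v\<in>?Y. smult (sig (desc R X v)) (Phi (X - desc R X v))) +
          (\<Sum>v\<in>?Z. smult (sig (desc R X v)) (Phi (X - desc R X v)))"
        using sum.subset_diff[OF Ysub fin] by (simp add: add.commute)
      also have "(\<Sum>v\<in>?Y. smult (sig (desc R X v)) (Phi (X - desc R X v))) =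
          (\<Sum>v\<in>?Y. smult (sig (desc R ?Y v)) (Phi (?Y - desc R ?Y v))) * Phi ?Z"
        unfolding sum_distrib_right
      proof (rule sum.cong[OF refl])
        fix v assume v: "v \<in> ?Y"
        show "smult (sig (desc R X v)) (Phi (X - desc R X v)) =
            smult (sig (desc R ?Y v)) (Phi (?Y - desc R ?Y v)) * Phi ?Z"
          unfolding PY[OF v] desc[OF Y v] by simp
      qed
      also have "(\<Sum>v\<in>?Y. smult (sig (desc R ?Y v)) (Phi (?Y - desc R ?Y v))) = pderiv (Phi ?Y)"
        using less.hyps[OF cY sub(1)] by simp
      also have "(\<Sum>v\<in>?Z. smult (sig (desc R X v)) (Phi (X - desc R X v))) =
          Phi ?Y * (\<Sum>v\<in>?Z. smult (sig (desc R ?Z v)) (Phi (?Z - desc R ?Z v)))"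
        unfolding sum_distrib_left
      proof (rule sum.cong[OF refl])
        fix v assume v: "v \<in> ?Z"
        show "smult (sig (desc R X v)) (Phi (X - desc R X v)) =
            Phi ?Y * smult (sig (desc R ?Z v)) (Phi (?Z - desc R ?Z v))"
          unfolding PZ[OF v] desc[OF Z v] by simp
      qed
      also have "(\<Sum>v\<in>?Z. smult (sig (desc R ?Z v)) (Phi (?Z - desc R ?Z v))) = pderiv (Phi ?Z)"
        using less.hyps[OF cZ sub(2)] by simp
      finally show ?thesis
        by (simp add: PX pderiv_mult algebra_simps)
    next
      case True
      then have tree: "is_tree R X r" using r(1) by (simp add: is_tree_def)
      have dr: "d r \<in> I" using r(1) less.prems d by blast
      show ?thesis
      proof (rule poly_eqI)
        fix n
        \<comment> \<open>For v = r nothing of \<open>X\<close> remains, so this summand is the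
          constant \<open>sig X\<close> and shows up in degree 0 only.\<close>
        have split: "coeff (\<Sum>v\<in>X. smult (sig (desc R X v)) (Phi (X - desc R X v))) n =
          (if n = 0 then sig X else 0) + (\<Sum>v\<in>X - {r}. sig (desc R X v) * coeff (Phi (X - desc R X v)) n)"
          using True by (simp add: coeff_sum sum.remove[OF fin r(1)] coeff_pCons split: nat.split)
        have rem: "X - desc R X v \<subseteq> V" "is_tree R (X - desc R X v) r" if "v \<in> X - {r}" for v
          using that less.prems tree_remove[OF tree, of v] by auto
        show "coeff (pderiv (Phi X)) n = coeff (\<Sum>v\<in>X. smult (sig (desc R X v)) (Phi (X - desc R X v))) n"
        proof (cases n)
          \<comment> \<open>Every other summand still contains a tree with root \<open>r\<close>,
            whose polynomial has no constant term.\<close>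
          case 0
          then show ?thesis
            using Phi_tree_0[OF rem] unfolding split by (simp add: coeff_pderiv)
        next
          case (Suc m)
          have partial: "partial_d e (branch_poly X r) =
            (\<Sum>v\<in>branch R \<epsilon> X r e. scale (sig (desc R X v)) (branch_poly (X - desc R X v) r))"
            if "e \<in> E (d r)" for e
          proof (rule partial_d_branch_poly_aux[OF less.prems r(1) that], rule less.hyps)
            show "card (branch R \<epsilon> X r e) < card X"
              using branch_subset[of R \<epsilon> X r e] branch_root[of r \<epsilon> X e] r(1) fin by (intro psubset_card_mono) auto
            show "branch R \<epsilon> X r e \<subseteq> V" using branch_subset less.prems by fast
          qed
          have bX: "branch_poly X r \<in> mpol_on (E (d r))"
            by (rule branch_poly_mpol[OF less.prems r(1)])
          have "coeff (pderiv (Phi X)) n = of_nat (Suc (Suc m)) * coeff (\<Lambda> (d r) (branch_poly X r)) (Suc (Suc m))"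
            unfolding Suc coeff_pderiv Phi_tree[OF less.prems tree] ..
          also have "\<dots> = (\<Sum>e\<in>E (d r). coeff (\<Lambda> (d r) (partial_d e (branch_poly X r))) (Suc m))"
            by (rule cocycle_coeff_rec[OF finite_E[OF dr] cocycle[OF dr] coeffs[OF dr] bX])
          also have "\<dots> = (\<Sum>e\<in>E (d r). \<Sum>v\<in>branch R \<epsilon> X r e.
              sig (desc R X v) * coeff (Phi (X - desc R X v)) (Suc m))"
          proof (rule sum.cong[OF refl])
            fix e assume e: "e \<in> E (d r)"
            have "coeff (\<Lambda> (d r) (partial_d e (branch_poly X r))) (Suc m) =
              (\<Sum>v\<in>branch R \<epsilon> X r e. sig (desc R X v) *
                lin_ext (\<lambda>\<gamma>. coeff (\<Lambda> (d r) (single \<gamma> 1)) (Suc m)) (branch_poly (X - desc R X v) r))"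
              by (subst coeff_linear[OF cocycle[OF dr] mpol_on_partial_d[OF bX]]) (simp only: partial[OF e] lin_ext_sum lin_ext_scale)
            also have "\<dots> = (\<Sum>v\<in>branch R \<epsilon> X r e. sig (desc R X v) * coeff (Phi (X - desc R X v)) (Suc m))"
            proof (rule sum.cong[OF refl])
              fix v assume "v \<in> branch R \<epsilon> X r e"
              then have v: "v \<in> X - {r}" using branch_subset[of R \<epsilon> X r e] branch_root[of r \<epsilon> X e] by auto
              show "sig (desc R X v) * lin_ext (\<lambda>\<gamma>. coeff (\<Lambda> (d r) (single \<gamma> 1)) (Suc m)) (branch_poly (X - desc R X v) r) =
                sig (desc R X v) * coeff (Phi (X - desc R X v)) (Suc m)"
                unfolding Phi_tree[OF rem[OF v]]
                using rem[OF v] by (subst coeff_linear[OF cocycle[OF dr] branch_poly_mpol]) (auto simp: is_tree_def)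
            qed
            finally show "coeff (\<Lambda> (d r) (partial_d e (branch_poly X r))) (Suc m) = \<dots>" .
          qed
          also have "\<dots> = (\<Sum>v\<in>X - {r}. sig (desc R X v) * coeff (Phi (X - desc R X v)) (Suc m))"
            by (rule sum_branches[OF less.prems tree])
          finally show ?thesis unfolding split unfolding Suc by simp
        qed
      qed
    qed
  qed simp
qed

lemma partial_d_branch_poly:
  assumes X: "X \<subseteq> V" "r \<in> X" and e: "e \<in> E (d r)"
  shows "partial_d e (branch_poly X r) =
    (\<Sum>v\<in>branch R \<epsilon> X r e. scale (sig (desc R X v)) (branch_poly (X - desc R X v) r))"
  using branch_subset[of R \<epsilon> X r e] X(1) by (intro partial_d_branch_poly_aux[OF assms] pderiv_Phi) auto

end

section \<open>Rooted forests as posets, and grafting\<close>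

text \<open>In a finite poset a strict relation that is not a covering splits at some
  \<open>z\<close> into two intervals with fewer elements. Induction on the size of the interval
  thus yields a chain of coverings.\<close>

lemma leq_iff_edges:
  assumes F: "rooted_forest F"
  shows "(x, y) \<in> leq F \<longleftrightarrow> x \<in> verts F \<and> (y, x) \<in> (edges F)\<^sup>*"
proof -
  have po: "partial_order_on (verts F) (leq F)" and fin: "finite (verts F)"
    using F by (auto simp: rooted_forest_def)
  note refl = partial_order_onD(1)[OF po] and trans = partial_order_onD(2)[OF po]
    and antisym = partial_order_onD(3)[OF po]
  have "(y, x) \<in> (edges F)\<^sup>*" if "(x, y) \<in> leq F"
    using that
  proof (induction "card {z. (x, z) \<in> leq F \<and> (z, y) \<in> leq F}" arbitrary: x y rule: less_induct)
    case less
    show ?case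
    proof (cases "x = y \<or> (y, x) \<in> edges F")
      case False
      then obtain z where z: "z \<noteq> x" "z \<noteq> y" "(x, z) \<in> leq F" "(z, y) \<in> leq F"
        using less.prems unfolding edges_def by blast
      let ?I = "\<lambda>x y. {z. (x, z) \<in> leq F \<and> (z, y) \<in> leq F}"
      have finI: "finite (?I x y)"
        by (rule finite_subset[OF _ fin]) (auto dest: leq_verts[OF F])
      have xx: "x \<in> ?I x y" "y \<in> ?I x y"
        using less.prems refl leq_verts[OF F less.prems] by (auto simp: refl_on_def)
      have "y \<notin> ?I x z" "x \<notin> ?I z y" "?I x z \<subseteq> ?I x y" "?I z y \<subseteq> ?I x y"
        using z antisymD[OF antisym] transD[OF trans] by blast+
      then have "?I x z \<subset> ?I x y" "?I z y \<subset> ?I x y" using xx by blast+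
      then have "(z, x) \<in> (edges F)\<^sup>*" "(y, z) \<in> (edges F)\<^sup>*"
        using less.hyps z psubset_card_mono[OF finI] by blast+
      then show ?thesis by simp
    qed auto
  qed
  moreover have "(x, y) \<in> leq F" if "(y, x) \<in> (edges F)\<^sup>*" "x \<in> verts F"
    using that
  proof (induction rule: converse_rtrancl_induct)
    case base
    then show ?case using refl by (simp add: refl_on_def)
  next
    case (step y z)
    then show ?case using transD[OF trans, of x z y] by (simp add: edges_def)
  qed
  ultimately show ?thesis using leq_verts[OF F] by blast
qed

lemma arborescence_edges:
  assumes F: "rooted_forest F"
  shows "arborescence (edges F)"
proof
  have po: "partial_order_on (verts F) (leq F)"
    using F by (auto simp: rooted_forest_def)
  show "acyclic (edges F)"
    unfolding acyclic_def
  proof (intro allI notI)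
    fix x assume "(x, x) \<in> (edges F)\<^sup>+"
    then obtain y where y: "(x, y) \<in> edges F" "(y, x) \<in> (edges F)\<^sup>*"
      by (meson tranclD)
    have "(x, y) \<in> leq F"
      using edges_verts[OF F y(1)] y(2) by (auto simp: leq_iff_edges[OF F])
    moreover have "(y, x) \<in> leq F" "x \<noteq> y" using y(1) by (auto simp: edges_def)
    ultimately show False using partial_order_onD(3)[OF po] by (metis antisymD)
  qed
  show "u = v" if "(u, w) \<in> edges F" "(v, w) \<in> edges F" for u v w
    using F that by (rule parent_unique)
qed

lemma induced_edges [simp]: "rooted_forest F \<Longrightarrow> induced (edges F) (verts F) = edges F"
  using edges_verts[of F] by auto

lemma desc_verts:
  assumes F: "rooted_forest F" and v: "v \<in> verts F"
  shows "desc (edges F) (verts F) v = {w. (w, v) \<in> leq F}"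
  using desc_subset[OF v, of "edges F"] by (auto simp: desc_def F leq_iff_edges[OF F] v)

section \<open>Subforests, isomorphisms and splitting into components\<close>

definition restr :: "('v, 'i, 'e) forest \<Rightarrow> 'v set \<Rightarrow> ('v, 'i, 'e) forest" where
  "restr F X = F\<lparr>verts := X, leq := leq F \<inter> X \<times> X\<rparr>"

lemma restr_simps [simp]:
  "verts (restr F X) = X" "leq (restr F X) = leq F \<inter> X \<times> X"
  "vdec (restr F X) = vdec F" "edec (restr F X) = edec F"
  by (simp_all add: restr_def)

lemma down_closed_leq:
  assumes F: "rooted_forest F" and X: "down_closed (edges F) (verts F) X"
    and "(y, x) \<in> leq F" "x \<in> X"
  shows "y \<in> X"
proof -
  have "x \<in> verts F" using X assms(4) by (auto simp: down_closed_def)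
  then have "y \<in> desc (edges F) (verts F) x" using assms(3) by (simp add: desc_verts[OF F])
  then have "y \<in> desc (edges F) X x" by (simp add: desc_down_closed[OF X assms(4)])
  then show ?thesis using desc_subset[OF assms(4)] by blast
qed

text \<open>Whatever lies between two elements of \<open>X\<close> lies below the upper one and
  hence in \<open>X\<close>, so restriction creates no new coverings.\<close>

lemma edges_restr:
  assumes F: "rooted_forest F" and X: "down_closed (edges F) (verts F) X"
  shows "edges (restr F X) = induced (edges F) X"
  using down_closed_leq[OF F X] by (fastforce simp: edges_def)

lemma rooted_forest_restr:
  assumes F: "rooted_forest F" and X: "down_closed (edges F) (verts F) X"
  shows "rooted_forest (restr F X)"
proof -
  have po: "partial_order_on (verts F) (leq F)" and sub: "X \<subseteq> verts F" and fin: "finite (verts F)"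
    using F X by (auto simp: rooted_forest_def down_closed_def)
  have "partial_order_on X (leq F \<inter> X \<times> X)"
    using partial_order_onD[OF po] sub
    unfolding partial_order_on_def preorder_on_def refl_on_def
    by (auto intro: transI antisymI dest: transD antisymD)
  then show ?thesis
    using parent_unique[OF F] finite_subset[OF sub fin]
    unfolding rooted_forest_def edges_restr[OF F X] by auto
qed

lemma well_decorated_restr:
  assumes F: "rooted_forest F" and X: "down_closed (edges F) (verts F) X" and "well_decorated I E F"
  shows "well_decorated I E (restr F X)"
  using assms(3) X unfolding well_decorated_def edges_restr[OF F X] down_closed_def by auto

lemma well_decorated_iso:
  assumes F: "rooted_forest F" and G: "rooted_forest G" and "forest_iso F G" and wd: "well_decorated I E F"
  shows "well_decorated I E G"
proof -
  obtain h where "iso_map h F G" using assms(3) by (auto simp: forest_iso_def)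
  note h = iso_mapD[OF this]
  have im: "verts G = h ` verts F" using h(1) by (simp add: bij_betw_def)
  show ?thesis
    unfolding well_decorated_def
  proof (intro conjI ballI, goal_cases)
    case (1 v)
    then show ?case using wd h(3) by (auto simp: im well_decorated_def)
  next
    case (2 p)
    obtain v w where p: "p = (v, w)" by (cases p)
    with 2 obtain v' w' where vw: "v = h v'" "w = h w'" "v' \<in> verts F" "w' \<in> verts F"
      using edges_verts[OF G, of v w] by (auto simp: im)
    then have "(v', w') \<in> edges F"
      using iso_edges[OF F G h(1,2) vw(3,4)] 2 p by simp
    then show ?case
      using wd h(3)[OF vw(3)] h(4) unfolding p vw well_decorated_def by fastforce
  qed
qed

lemma well_decorated_dunion:
  assumes F: "rooted_forest F" and G: "rooted_forest G"
    and "well_decorated I E F" "well_decorated I E G"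
  shows "well_decorated I E (dunion F G)"
proof -
  have "edec (dunion F G) (x, y) \<in> E (vdec (dunion F G) x)" if "(x, y) \<in> edges (dunion F G)" for x y
    using that assms(3,4) by (cases x; cases y) (auto simp: well_decorated_def)
  then show ?thesis
    using assms(3,4) by (auto simp: well_decorated_def verts_dunion)
qed

lemma cls_empty:
  assumes F: "rooted_forest F" and "verts F = {}"
  shows "cls F = 0"
  unfolding zero_fclass_def
proof (rule cls_eqI[OF F rooted_forest_empty], rule forest_isoI)
  show "bij_betw (\<lambda>_. 0) (verts F) (verts empty_forest)"
    using assms(2) by (simp add: bij_betw_def empty_forest_def)
  show "edec empty_forest (0, 0) = edec F (x, y)" if "(x, y) \<in> edges F" for x y
    using edges_verts[OF F that] assms(2) by simp
qed (use assms(2) in auto)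

lemma cls_split:
  assumes F: "rooted_forest F"
    and X: "down_closed (edges F) (verts F) X" and Y: "down_closed (edges F) (verts F) Y"
    and "X \<inter> Y = {}" "verts F = X \<union> Y"
  shows "forest_iso (dunion (restr F X) (restr F Y)) F"
proof (rule forest_isoI[of "case_sum id id"])
  let ?h = "case_sum id id :: 'a + 'a \<Rightarrow> 'a"
  show "bij_betw ?h (verts (dunion (restr F X) (restr F Y))) (verts F)"
    using assms(4,5) by (auto simp: bij_betw_def verts_dunion inj_on_def image_Un image_image)
  show "(x, y) \<in> leq (dunion (restr F X) (restr F Y)) \<longleftrightarrow> (?h x, ?h y) \<in> leq F"
    if "x \<in> verts (dunion (restr F X) (restr F Y))" "y \<in> verts (dunion (restr F X) (restr F Y))" for x y
  proof -
    have "\<not> (v \<in> X \<and> w \<in> Y)" "\<not> (v \<in> Y \<and> w \<in> X)" if "(v, w) \<in> leq F" for v w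
      using down_closed_leq[OF F X that] down_closed_leq[OF F Y that] assms(4) by blast+
    then show ?thesis
      using that by (cases x; cases y) (auto simp: verts_dunion)
  qed
  show "vdec F (?h x) = vdec (dunion (restr F X) (restr F Y)) x" for x
    by (cases x) simp_all
  show "edec F (?h x, ?h y) = edec (dunion (restr F X) (restr F Y)) (x, y)"
    if "(x, y) \<in> edges (dunion (restr F X) (restr F Y))" for x y
    using that by (cases x; cases y) simp_all
qed

section \<open>Grafting and the decomposition of a tree into branches\<close>

lemma verts_graft: "verts (graft i f) = insert None {Some (e, v) | e v. v \<in> verts (f e)}"
  by (simp add: graft_def Let_def)

lemma leq_graft [simp]:
  "(x, None) \<in> leq (graft i f) \<longleftrightarrow> x \<in> verts (graft i f)"
  "(None, Some p) \<notin> leq (graft i f)"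
  "(Some (e, v), Some (e', w)) \<in> leq (graft i f) \<longleftrightarrow> e = e' \<and> (v, w) \<in> leq (f e)"
  by (auto simp: graft_def Let_def)

lemma dec_graft [simp]:
  "vdec (graft i f) None = i" "vdec (graft i f) (Some (e, v)) = vdec (f e) v"
  "edec (graft i f) (None, Some (e, v)) = e"
  "edec (graft i f) (Some (e, v), Some (e', w)) = edec (f e) (v, w)"
  by (simp_all add: graft_def Let_def)

lemma in_verts_graft [simp]:
  "None \<in> verts (graft i f)" "Some (e, v) \<in> verts (graft i f) \<longleftrightarrow> v \<in> verts (f e)"
  by (auto simp: verts_graft)

lemma ex_graft: "(\<exists>z. P z) \<longleftrightarrow> P None \<or> (\<exists>e v. P (Some (e, v)))"
  by (metis option.exhaust surj_pair)

lemma graft_cases: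
  obtains "x = None" | e v where "x = Some (e, v)"
  by (metis option.exhaust surj_pair)

lemma edges_graft [simp]:
  assumes f: "\<And>e. rooted_forest (f e)"
  shows "(x, None) \<notin> edges (graft i f)"
    and "(Some (e, v), Some (e', w)) \<in> edges (graft i f) \<longleftrightarrow> e = e' \<and> (v, w) \<in> edges (f e)"
    and "(None, Some (e, w)) \<in> edges (graft i f) \<longleftrightarrow> w \<in> verts (f e) \<and> (\<forall>v. (v, w) \<notin> edges (f e))"
proof -
  show "(x, None) \<notin> edges (graft i f)"
    by (cases x rule: graft_cases) (auto simp: edges_def)
  show "(Some (e, v), Some (e', w)) \<in> edges (graft i f) \<longleftrightarrow> e = e' \<and> (v, w) \<in> edges (f e)"
    unfolding edges_def mem_Collect_eq prod.case ex_graft[of "\<lambda>z. z \<noteq> _ \<and> _ z"] by auto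
  have "(None, Some (e, w)) \<in> edges (graft i f) \<longleftrightarrow> w \<in> verts (f e) \<and> \<not> (\<exists>v. v \<noteq> w \<and> (w, v) \<in> leq (f e))"
    unfolding edges_def mem_Collect_eq prod.case ex_graft[of "\<lambda>z. z \<noteq> _ \<and> _ z"]
    using leq_verts[OF f] by auto
  also have "(\<exists>v. v \<noteq> w \<and> (w, v) \<in> leq (f e)) \<longleftrightarrow> (\<exists>v. (v, w) \<in> edges (f e))"
  proof
    assume "\<exists>v. v \<noteq> w \<and> (w, v) \<in> leq (f e)"
    then obtain v where "v \<noteq> w" "(v, w) \<in> (edges (f e))\<^sup>*" by (auto simp: leq_iff_edges[OF f])
    then show "\<exists>v. (v, w) \<in> edges (f e)" by (auto elim: rtranclE)
  qed (auto simp: edges_def)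
  finally show "(None, Some (e, w)) \<in> edges (graft i f) \<longleftrightarrow> w \<in> verts (f e) \<and> (\<forall>v. (v, w) \<notin> edges (f e))"
    by simp
qed

text \<open>The family \<open>f\<close> is indexed by a whole type; finiteness of the graft comes
  from its members being empty outside the finite set \<open>J\<close>.\<close>

lemma rooted_forest_graft:
  assumes f: "\<And>e. rooted_forest (f e)" and J: "finite J" "\<And>e. e \<notin> J \<Longrightarrow> verts (f e) = {}"
  shows "rooted_forest (graft i f)"
proof -
  have po: "partial_order_on (verts (f e)) (leq (f e))" and fin: "finite (verts (f e))" for e
    using f by (auto simp: rooted_forest_def)
  have sub: "leq (graft i f) \<subseteq> verts (graft i f) \<times> verts (graft i f)"
    using leq_verts[OF f] by (auto simp: graft_def Let_def)
  have "refl_on (verts (graft i f)) (leq (graft i f))"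
    using partial_order_onD(1)[OF po] by (auto simp: verts_graft refl_on_def)
  moreover have "trans (leq (graft i f))"
  proof (rule transI)
    fix x y z assume xy: "(x, y) \<in> leq (graft i f)" and yz: "(y, z) \<in> leq (graft i f)"
    show "(x, z) \<in> leq (graft i f)"
    proof (cases z rule: graft_cases)
      case 1
      then show ?thesis using sub xy by auto
    next
      case (2 e w)
      then obtain v where y: "y = Some (e, v)" "(v, w) \<in> leq (f e)"
        using yz by (cases y rule: graft_cases) auto
      then obtain u where x: "x = Some (e, u)" "(u, v) \<in> leq (f e)"
        using xy by (cases x rule: graft_cases) auto
      show ?thesis
        using transD[OF partial_order_onD(2)[OF po] x(2) y(2)] by (simp add: 2 x)
    qed
  qed
  moreover have "antisym (leq (graft i f))"
  proof (rule antisymI)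
    fix x y assume "(x, y) \<in> leq (graft i f)" "(y, x) \<in> leq (graft i f)"
    then show "x = y"
      using antisymD[OF partial_order_onD(3)[OF po]]
      by (cases x rule: graft_cases; cases y rule: graft_cases) auto
  qed
  moreover have "u = v" if "(u, w) \<in> edges (graft i f)" "(v, w) \<in> edges (graft i f)" for u v w
    using that f parent_unique[OF f]
    by (cases u rule: graft_cases; cases v rule: graft_cases; cases w rule: graft_cases) auto
  moreover have "finite (verts (graft i f))"
  proof -
    have "verts (graft i f) \<subseteq> insert None (Some ` (SIGMA e:J. verts (f e)))"
      using J(2) by (fastforce simp: verts_graft)
    moreover have "finite (insert None (Some ` (SIGMA e:J. verts (f e))))"
      using J(1) fin by auto
    ultimately show ?thesis by (rule finite_subset)
  qed
  ultimately show ?thesis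
    using sub unfolding rooted_forest_def partial_order_on_def preorder_on_def by blast
qed

lemma well_decorated_graft:
  assumes f: "\<And>e. rooted_forest (f e)" and wd: "\<And>e. well_decorated I E (f e)"
    and i: "i \<in> I" and J: "\<And>e. e \<notin> E i \<Longrightarrow> verts (f e) = {}"
  shows "well_decorated I E (graft i f)"
proof -
  have "vdec (graft i f) x \<in> I" if "x \<in> verts (graft i f)" for x
    using that wd i by (cases x rule: graft_cases) (auto simp: well_decorated_def)
  moreover have "edec (graft i f) (x, y) \<in> E (vdec (graft i f) x)" if "(x, y) \<in> edges (graft i f)" for x y
  proof (cases x rule: graft_cases; cases y rule: graft_cases)
    fix e v assume "x = None" "y = Some (e, v)"
    then show ?thesis using that J[of e] f by auto
  next
    fix e v e' w assume xy: "x = Some (e, v)" "y = Some (e', w)"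
    then have "(v, w) \<in> edges (f e)" using that f unfolding xy by auto
    then show ?thesis using wd[of e] by (auto simp: xy well_decorated_def)
  qed (use that f in auto)
  ultimately show ?thesis by (auto simp: well_decorated_def)
qed

lemma forest_iso_graft:
  assumes f: "\<And>e. rooted_forest (f e)" and g: "\<And>e. rooted_forest (g e)"
    and iso: "\<And>e. forest_iso (f e) (g e)"
  shows "forest_iso (graft i f) (graft i g)"
proof -
  obtain h where "\<And>e. iso_map (h e) (f e) (g e)"
    using iso unfolding forest_iso_def by metis
  note h = iso_mapD[OF this]
  have hv: "h e v \<in> verts (g e)" if "v \<in> verts (f e)" for e v
    using h(1)[of e] that by (auto simp: bij_betw_def)
  have hi: "h e v = h e w \<longleftrightarrow> v = w" if "v \<in> verts (f e)" "w \<in> verts (f e)" for e v w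
    using h(1)[of e] that by (auto simp: bij_betw_def inj_on_def)
  have hs: "\<exists>v\<in>verts (f e). w = h e v" if "w \<in> verts (g e)" for e w
    using h(1)[of e] that by (auto simp: bij_betw_def)
  let ?k = "map_option (\<lambda>(e, v). (e, h e v))"
  show ?thesis
  proof (rule forest_isoI[of ?k])
    have "inj_on ?k (verts (graft i f))"
    proof (rule inj_onI)
      fix x y assume "x \<in> verts (graft i f)" "y \<in> verts (graft i f)" "?k x = ?k y"
      then show "x = y"
        by (cases x rule: graft_cases; cases y rule: graft_cases) (auto simp: hi)
    qed
    moreover have "?k ` verts (graft i f) = verts (graft i g)"
    proof
      show "?k ` verts (graft i f) \<subseteq> verts (graft i g)"
        using hv by (auto simp: verts_graft)
      show "verts (graft i g) \<subseteq> ?k ` verts (graft i f)"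
      proof
        fix y assume y: "y \<in> verts (graft i g)"
        show "y \<in> ?k ` verts (graft i f)"
        proof (cases y rule: graft_cases)
          case 1
          then show ?thesis by (intro image_eqI[of _ _ None]) simp_all
        next
          case (2 e w)
          then obtain v where "v \<in> verts (f e)" "w = h e v" using hs y by auto
          then show ?thesis using 2 by (intro image_eqI[of _ _ "Some (e, v)"]) simp_all
        qed
      qed
    qed
    ultimately show "bij_betw ?k (verts (graft i f)) (verts (graft i g))"
      by (simp add: bij_betw_def)
    show "(x, y) \<in> leq (graft i f) \<longleftrightarrow> (?k x, ?k y) \<in> leq (graft i g)"
      if "x \<in> verts (graft i f)" "y \<in> verts (graft i f)" for x y
      using that by (cases x rule: graft_cases; cases y rule: graft_cases) (auto simp: h(2) hv)
    show "vdec (graft i g) (?k x) = vdec (graft i f) x" if "x \<in> verts (graft i f)" for x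
      using that by (cases x rule: graft_cases) (auto simp: h(3))
    show "edec (graft i g) (?k x, ?k y) = edec (graft i f) (x, y)" if "(x, y) \<in> edges (graft i f)" for x y
      using that f by (cases x rule: graft_cases; cases y rule: graft_cases) (auto simp: h(4))
  qed
qed

text \<open>Every tree is recovered by grafting its branches: \<open>None\<close> goes to the root
  and \<open>Some (e, x)\<close> to \<open>x\<close>, injectively because the branches are
  disjoint.\<close>

lemma forest_iso_graft_branches:
  assumes F: "rooted_forest F" and tree: "is_tree (edges F) (verts F) r"
    and J: "\<And>w. (r, w) \<in> edges F \<Longrightarrow> edec F (r, w) \<in> J" "i = vdec F r"
    and J': "\<And>e. e \<notin> J \<Longrightarrow> branch (edges F) (edec F) (verts F) r e = {}"
  shows "forest_iso (graft i (\<lambda>e. restr F (branch (edges F) (edec F) (verts F) r e))) F"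
proof -
  interpret arborescence "edges F" by (rule arborescence_edges[OF F])
  let ?B = "branch (edges F) (edec F) (verts F) r"
  let ?G = "graft i (\<lambda>e. restr F (?B e))"
  let ?g = "case_option r snd :: ('c \<times> 'a) option \<Rightarrow> 'a"
  have r: "r \<in> verts F" "\<And>x. x \<in> verts F \<Longrightarrow> (x, r) \<in> leq F"
    using tree by (auto simp: is_tree_def desc_verts[OF F])
  have B: "verts F - {r} = (\<Union>e\<in>J. ?B e)"
    using J(1) by (intro tree_branches[OF tree])
  have rB: "r \<notin> ?B e" for e by (rule branch_root)
  have Bsub: "?B e \<subseteq> verts F" for e by (rule branch_subset)
  have Brf: "rooted_forest (restr F (?B e))" for e
    by (rule rooted_forest_restr[OF F down_closed_branch])
  have antisym: "x = y" if "(x, y) \<in> leq F" "(y, x) \<in> leq F" for x y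
    using F that unfolding rooted_forest_def by (meson antisymD partial_order_onD(3))
  show ?thesis
  proof (rule forest_isoI[of ?g])
    have "inj_on ?g (verts ?G)"
    proof (rule inj_onI)
      fix x y assume "x \<in> verts ?G" "y \<in> verts ?G" "?g x = ?g y"
      then show "x = y"
        using rB branch_disjoint[of _ "edec F" "verts F" r]
        by (cases x rule: graft_cases; cases y rule: graft_cases) auto
    qed
    moreover have "?g ` verts ?G = verts F"
    proof
      show "?g ` verts ?G \<subseteq> verts F"
        using r Bsub[THEN subsetD] by (auto simp: verts_graft)
      show "verts F \<subseteq> ?g ` verts ?G"
      proof
        fix x assume x: "x \<in> verts F"
        show "x \<in> ?g ` verts ?G"
        proof (cases "x = r")
          case True
          then show ?thesis by (intro image_eqI[of _ _ None]) simp_all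
        next
          case False
          then obtain e where "x \<in> ?B e" using B x by blast
          then show ?thesis by (intro image_eqI[of _ _ "Some (e, x)"]) simp_all
        qed
      qed
    qed
    ultimately show "bij_betw ?g (verts ?G) (verts F)"
      by (simp add: bij_betw_def)
    show "(x, y) \<in> leq ?G \<longleftrightarrow> (?g x, ?g y) \<in> leq F" if "x \<in> verts ?G" "y \<in> verts ?G" for x y
    proof (cases x rule: graft_cases; cases y rule: graft_cases)
      fix e v assume xy: "x = None" "y = Some (e, v)"
      then show ?thesis using antisym[of r v] r(2)[of v] rB[of e] Bsub[of e, THEN subsetD] that by auto
    next
      fix e v e' w assume xy: "x = Some (e, v)" "y = Some (e', w)"
      have "e = e'" if "(v, w) \<in> leq F"
        using down_closed_leq[OF F down_closed_branch that, of "edec F" r e'] branch_disjoint[of v "edec F" "verts F" r e e']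
          \<open>x \<in> verts ?G\<close> \<open>y \<in> verts ?G\<close> xy by simp
      then show ?thesis using that xy by auto
    qed (use that r Bsub[THEN subsetD] in auto)
    show "vdec F (?g x) = vdec ?G x" for x
      using J(2) by (cases x rule: graft_cases) simp_all
    show "edec F (?g x, ?g y) = edec ?G (x, y)" if xy: "(x, y) \<in> edges ?G" for x y
    proof (cases x rule: graft_cases; cases y rule: graft_cases)
      fix e w assume *: "x = None" "y = Some (e, w)"
      then have w: "w \<in> ?B e" "\<And>v. (v, w) \<notin> edges (restr F (?B e))" using xy Brf by auto
      then obtain u where u: "u \<in> verts F" "(r, u) \<in> edges F" "edec F (r, u) = e"
        "w \<in> desc (edges F) (verts F) u" by (auto simp: branch_def)
      \<comment> \<open>A vertex of the branch other than a child of \<open>r\<close> has its parent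
        in the same branch, whereas \<open>w\<close> has none there.\<close>
      have "w = u"
        using u(4)
      proof (cases rule: desc_cases)
        case (2 y)
        then have "y \<in> ?B e" using u by (auto simp: branch_def)
        then show ?thesis using w 2 by (auto simp: edges_restr[OF F down_closed_branch])
      qed
      then show ?thesis using * u by simp
    qed (use xy Brf in auto)
  qed
qed

section \<open>The polynomial of a forest under isomorphism, union and grafting\<close>

context cocycles
begin

definition forest_poly :: "('v, 'i, 'e) forest \<Rightarrow> 'k poly" where
  "forest_poly F = phi (vdec F) (edec F) (edges F) (verts F)"

lemma wf_edges: "rooted_forest F \<Longrightarrow> wf ((edges F)\<inverse>)"
  using arborescence.wf_induced[OF arborescence_edges, of F "verts F"] by (simp add: rooted_forest_def)

lemma forest_poly_iso:
  assumes F: "rooted_forest F" and G: "rooted_forest G" and "forest_iso F G"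
  shows "forest_poly G = forest_poly F"
proof -
  obtain h where "iso_map h F G" using assms(3) by (auto simp: forest_iso_def)
  note h = iso_mapD[OF this]
  show ?thesis
    unfolding forest_poly_def
    by (rule phi_transfer[OF _ _ h(1)]) (simp_all add: F G wf_edges iso_edges[OF F G h(1,2)] h(3,4))
qed

lemma decorated_forest:
  assumes "rooted_forest F" "well_decorated I E F"
  shows "decorated (edges F) I E \<Lambda> a (vdec F) (edec F) (verts F)"
proof -
  interpret arborescence "edges F" by (rule arborescence_edges[OF assms(1)])
  show ?thesis
    by unfold_locales (use assms in \<open>auto simp: rooted_forest_def well_decorated_def\<close>)
qed

lemma forest_poly_dunion:
  assumes F: "rooted_forest F" "well_decorated I E F" and G: "rooted_forest G" "well_decorated I E G"
  shows "forest_poly (dunion F G) = forest_poly F * forest_poly G"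
proof -
  let ?H = "dunion F G"
  have H: "rooted_forest ?H" by (rule rooted_forest_dunion[OF F(1) G(1)])
  interpret decorated "edges ?H" I E \<Lambda> a "vdec ?H" "edec ?H" "verts ?H"
    by (rule decorated_forest[OF H well_decorated_dunion[OF F(1) G(1) F(2) G(2)]])
  have "forest_poly ?H = Phi (Inl ` verts F) * Phi (Inr ` verts G)"
    unfolding forest_poly_def
    by (rule Phi_union) (auto simp: down_closed_def verts_dunion)
  moreover have fin: "finite (verts F)" "finite (verts G)"
    using F G by (auto simp: rooted_forest_def)
  moreover have "Phi (Inl ` verts F) = forest_poly F"
    unfolding forest_poly_def
    by (rule phi_transfer) (auto simp: wf_edges F wf_induced fin bij_betw_def)
  moreover have "Phi (Inr ` verts G) = forest_poly G"
    unfolding forest_poly_def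
    by (rule phi_transfer) (auto simp: wf_edges G wf_induced fin bij_betw_def)
  ultimately show ?thesis by simp
qed

text \<open>The graft has \<open>None\<close> as its only root, and the children of
  \<open>None\<close> along edges decorated \<open>e\<close> are the roots of
  \<open>f e\<close>.\<close>

lemma forest_poly_graft:
  assumes f: "\<And>e. rooted_forest (f e)" and G: "rooted_forest (graft i f)"
  shows "forest_poly (graft i f) = \<Lambda> i (mprod (E i) (\<lambda>e. forest_poly (f e)))"
proof -
  let ?G = "graft i f"
  have pol: "pol (vdec ?G) (edec ?G) (edges ?G) (Some (e, v)) = pol (vdec (f e)) (edec (f e)) (edges (f e)) v"
    if "v \<in> verts (f e)" for e v
  proof -
    have "pol (vdec ?G) (edec ?G) (edges ?G) ((\<lambda>v. Some (e, v)) v) = pol (vdec (f e)) (edec (f e)) (edges (f e)) v"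
    proof (rule pol_transfer[of _ _ "verts (f e)"])
      show "{w'. (Some (e, v), w') \<in> edges ?G} = (\<lambda>v. Some (e, v)) ` {w. (v, w) \<in> edges (f e)}" for v
      proof (intro set_eqI)
        fix x show "x \<in> {w'. (Some (e, v), w') \<in> edges ?G} \<longleftrightarrow> x \<in> (\<lambda>v. Some (e, v)) ` {w. (v, w) \<in> edges (f e)}"
          using f by (cases x rule: graft_cases) auto
      qed
    qed (use that f G in \<open>auto simp: wf_edges inj_on_def dest: edges_verts[OF f]\<close>)
    then show ?thesis by simp
  qed
  have roots: "{v. v \<in> verts ?G \<and> (\<forall>u\<in>verts ?G. (u, v) \<notin> edges ?G)} = {None}"
  proof -
    have "\<exists>u\<in>verts ?G. (u, Some (e, v)) \<in> edges ?G" if "v \<in> verts (f e)" for e v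
    proof (cases "\<exists>u. (u, v) \<in> edges (f e)")
      case True
      then obtain u where "(u, v) \<in> edges (f e)" by blast
      then show ?thesis using edges_verts[OF f] by (intro bexI[of _ "Some (e, u)"]) (auto simp: f)
    next
      case False
      then show ?thesis using that by (intro bexI[of _ None]) (auto simp: f)
    qed
    then have "x \<in> {v. v \<in> verts ?G \<and> (\<forall>u\<in>verts ?G. (u, v) \<notin> edges ?G)} \<longleftrightarrow> x \<in> {None}" for x
      by (cases x rule: graft_cases) (use f in auto)
    then show ?thesis by blast
  qed
  have "(\<Prod>w | (None, w) \<in> edges ?G \<and> edec ?G (None, w) = e. pol (vdec ?G) (edec ?G) (edges ?G) w) = forest_poly (f e)" for e
  proof -
    have "{w. (None, w) \<in> edges ?G \<and> edec ?G (None, w) = e} =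
        (\<lambda>v. Some (e, v)) ` {v. v \<in> verts (f e) \<and> (\<forall>u\<in>verts (f e). (u, v) \<notin> edges (f e))}" (is "?L = ?R")
    proof (intro set_eqI)
      fix x show "x \<in> ?L \<longleftrightarrow> x \<in> ?R"
        using edges_verts[OF f] by (cases x rule: graft_cases) (auto simp: f)
    qed
    then show ?thesis
      by (simp add: forest_poly_def phi_def f prod.reindex inj_on_def pol cong: prod.cong_simp)
  qed
  then show ?thesis
    by (simp add: forest_poly_def[of ?G] phi_def roots G pol_unfold[OF wf_edges[OF G], of _ _ None])
qed

end

section \<open>Existence and uniqueness of the universal morphism\<close>

definition poly_ext :: "('a \<Rightarrow> 'k poly) \<Rightarrow> ('a \<Rightarrow>\<^sub>0 'k::comm_ring_1) \<Rightarrow> 'k poly" where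
  "poly_ext h x = (\<Sum>c\<in>keys x. smult (lookup x c) (h c))"

lemma coeff_poly_ext: "coeff (poly_ext h x) n = lin_ext (\<lambda>c. coeff (h c) n) x"
  by (simp add: poly_ext_def lin_ext_def coeff_sum)

lemma poly_ext_add: "poly_ext h (x + y) = poly_ext h x + poly_ext h y"
  by (rule poly_eqI) (simp add: coeff_poly_ext lin_ext_add)

lemma poly_ext_sum: "poly_ext h (\<Sum>i\<in>A. f i) = (\<Sum>i\<in>A. poly_ext h (f i))"
  by (rule poly_eqI) (simp add: coeff_poly_ext lin_ext_sum coeff_sum)

lemma poly_ext_scale: "poly_ext h (scale c x) = smult c (poly_ext h x)"
  by (rule poly_eqI) (simp add: coeff_poly_ext lin_ext_scale)

lemma poly_ext_single [simp]: "poly_ext h (single x c) = smult c (h x)"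
  by (rule poly_eqI) (simp add: coeff_poly_ext)

lemma mult_monomials:
  fixes x y :: "'a::monoid_add \<Rightarrow>\<^sub>0 'k::comm_ring_1"
  shows "x * y = (\<Sum>c\<in>keys x. \<Sum>d\<in>keys y. single (c + d) (lookup x c * lookup y d))"
proof -
  have "x * y = (\<Sum>c\<in>keys x. single c (lookup x c)) * (\<Sum>d\<in>keys y. single d (lookup y d))"
    using sum_monomials by metis
  then show ?thesis by (simp add: sum_product mult_single)
qed

lemma poly_ext_mult:
  fixes x y :: "'a::monoid_add \<Rightarrow>\<^sub>0 'k::comm_ring_1"
  assumes "\<And>c d. c \<in> keys x \<Longrightarrow> d \<in> keys y \<Longrightarrow> h (c + d) = h c * h d"
  shows "poly_ext h (x * y) = poly_ext h x * poly_ext h y"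
  by (simp add: mult_monomials[of x y] poly_ext_sum poly_ext_def[of h x] poly_ext_def[of h y] sum_product assms mult_ac
      cong: sum.cong_simp)

lemma keys_sum_subset: "(\<And>i. i \<in> A \<Longrightarrow> keys (f i) \<subseteq> S) \<Longrightarrow> keys (\<Sum>i\<in>A. f i) \<subseteq> S"
proof (induction A rule: infinite_finite_induct)
  case (insert i A)
  then have "keys (f i) \<union> keys (sum f A) \<subseteq> S" by simp
  then show ?case
    using insert(1,2) keys_add[of "f i" "sum f A"] by (simp add: subset_trans)
qed simp_all

section \<open>The algebra spanned by decorated forests\<close>

lemma fclass_rep:
  assumes "C \<in> fclasses I E"
  shows "well_decorated I E (rep_fclass C)"
proof -
  obtain F :: "(nat, 'a, 'b) forest" where F: "C = cls F" "rooted_forest F" "well_decorated I E F"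
    using assms by (auto simp: fclasses_def)
  show ?thesis
    unfolding F(1)
    by (rule well_decorated_iso[OF F(2) rooted_forest_rep_cls[OF F(2)] forest_iso_rep_cls[OF F(2)] F(3)])
qed

text \<open>\<open>fclasses\<close> is defined by forests on natural numbers; a forest on another
  vertex type is replaced by the representative of its class.\<close>

lemma cls_in_fclasses:
  fixes F :: "('v, 'i, 'e) forest"
  assumes F: "rooted_forest F" "well_decorated I E F"
  shows "cls F \<in> fclasses I E"
proof -
  have "well_decorated I E (rep_fclass (cls F))"
    by (rule well_decorated_iso[OF F(1) rooted_forest_rep_cls[OF F(1)] forest_iso_rep_cls[OF F(1)] F(2)])
  then show ?thesis
    using rooted_forest_rep[of "cls F"] cls_rep[of "cls F"] unfolding fclasses_def by (intro CollectI) metis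
qed

lemma zero_in_fclasses: "0 \<in> fclasses I E"
  unfolding zero_fclass_def
  by (rule cls_in_fclasses[OF rooted_forest_empty]) (auto simp: well_decorated_def empty_forest_def edges_def)

lemma plus_in_fclasses: "C \<in> fclasses I E \<Longrightarrow> D \<in> fclasses I E \<Longrightarrow> C + D \<in> fclasses I E"
  unfolding plus_fclass_def
  by (intro cls_in_fclasses rooted_forest_dunion well_decorated_dunion rooted_forest_rep fclass_rep)

lemma forest_alg_mult:
  assumes "x \<in> forest_alg I E" "y \<in> forest_alg I E"
  shows "x * (y :: ('i, 'e) fclass \<Rightarrow>\<^sub>0 'k::comm_ring_1) \<in> forest_alg I E"
  using assms unfolding mult_monomials[of x y] forest_alg_def
  by (auto intro!: keys_sum_subset plus_in_fclasses split: if_split_asm)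

lemma forest_alg_add:
  "x \<in> forest_alg I E \<Longrightarrow> y \<in> forest_alg I E \<Longrightarrow> x + y \<in> forest_alg I E"
  unfolding forest_alg_def using keys_add by fast

lemma forest_alg_scale: "x \<in> forest_alg I E \<Longrightarrow> scale c x \<in> forest_alg I E"
  unfolding forest_alg_def using keys_scale by fast

lemma forest_alg_sum:
  "(\<And>i. i \<in> A \<Longrightarrow> f i \<in> forest_alg I E) \<Longrightarrow> (\<Sum>i\<in>A. f i) \<in> forest_alg I E"
  unfolding forest_alg_def using keys_sum_subset[of A f] by simp

lemma forest_alg_single: "C \<in> fclasses I E \<Longrightarrow> single C c \<in> forest_alg I E"
  by (simp add: forest_alg_def)

lemma alg_morphism_poly_ext:
  assumes \<phi>: "alg_morphism I E \<phi>" and x: "x \<in> forest_alg I E"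
  shows "\<phi> x = poly_ext (\<lambda>C. \<phi> (single C 1)) x"
proof -
  have add: "\<phi> (x + y) = \<phi> x + \<phi> y" if "x \<in> forest_alg I E" "y \<in> forest_alg I E" for x y
    using \<phi> that by (auto simp: alg_morphism_def)
  have sc: "\<phi> (scale c x) = smult c (\<phi> x)" if "x \<in> forest_alg I E" for c x
    using \<phi> that by (auto simp: alg_morphism_def)
  have zero: "\<phi> 0 = 0"
    using add[of 0 0] by (simp add: forest_alg_def)
  have sum: "\<phi> (\<Sum>i\<in>A. f i) = (\<Sum>i\<in>A. \<phi> (f i))" if "\<And>i. i \<in> A \<Longrightarrow> f i \<in> forest_alg I E"
    for f and A :: "('a, 'b) fclass set"
    using that by (induction A rule: infinite_finite_induct) (simp_all add: zero add forest_alg_sum)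
  have C: "single C 1 \<in> forest_alg I E" if "C \<in> keys x" for C
    using x that by (auto simp: forest_alg_def)
  have "\<phi> x = \<phi> (\<Sum>C\<in>keys x. scale (lookup x C) (single C 1))"
    using sum_monomials[of x] by (simp add: scale_single)
  also have "\<dots> = (\<Sum>C\<in>keys x. \<phi> (scale (lookup x C) (single C 1)))"
    by (intro sum forest_alg_scale C)
  also have "\<dots> = poly_ext (\<lambda>C. \<phi> (single C 1)) x"
    unfolding poly_ext_def by (intro sum.cong refl sc C)
  finally show ?thesis .
qed

section \<open>Construction and uniqueness of the morphism\<close>

context cocycles
begin

definition class_poly :: "('i, 'e) fclass \<Rightarrow> 'k poly" where
  "class_poly C = forest_poly (rep_fclass C)"

lemma class_poly_cls: "rooted_forest F \<Longrightarrow> class_poly (cls F) = forest_poly F"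
  unfolding class_poly_def by (intro forest_poly_iso rooted_forest_rep_cls forest_iso_rep_cls)

lemma class_poly_0: "class_poly 0 = 1"
proof -
  have "class_poly 0 = forest_poly (empty_forest :: (nat, 'i, 'e) forest)"
    unfolding zero_fclass_def by (rule class_poly_cls[OF rooted_forest_empty])
  then show ?thesis by (simp add: forest_poly_def empty_forest_def)
qed

lemma class_poly_plus:
  assumes "C \<in> fclasses I E" "D \<in> fclasses I E"
  shows "class_poly (C + D) = class_poly C * class_poly D"
proof -
  have "class_poly (C + D) = forest_poly (dunion (rep_fclass C) (rep_fclass D))"
    unfolding plus_fclass_def by (intro class_poly_cls rooted_forest_dunion rooted_forest_rep)
  also have "\<dots> = class_poly C * class_poly D"
    unfolding class_poly_def
    by (intro forest_poly_dunion rooted_forest_rep fclass_rep assms)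
  finally show ?thesis .
qed

lemma cocycle_linear:
  assumes i: "i \<in> I" and f: "\<And>x. x \<in> A \<Longrightarrow> f x \<in> mpol_on (E i)"
  shows "\<Lambda> i (\<Sum>x\<in>A. scale (c x) (f x)) = (\<Sum>x\<in>A. smult (c x) (\<Lambda> i (f x)))"
proof (rule poly_eqI)
  fix n
  have sc: "scale (c x) (f x) \<in> mpol_on (E i)" if "x \<in> A" for x
    using f[OF that] keys_scale[of "c x" "f x"] by (auto simp: mpol_on_def)
  show "coeff (\<Lambda> i (\<Sum>x\<in>A. scale (c x) (f x))) n = coeff (\<Sum>x\<in>A. smult (c x) (\<Lambda> i (f x))) n"
    by (simp add: coeff_linear[OF cocycle[OF i] mpol_on_sum[OF sc]] coeff_linear[OF cocycle[OF i] f]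
        lin_ext_sum lin_ext_scale coeff_sum cong: sum.cong_simp)
qed

lemma rooted_forest_graft_rep:
  assumes i: "i \<in> I" and C: "keys C \<subseteq> E i"
  shows "rooted_forest (graft i (\<lambda>e. rep_fclass (lookup C e)))"
    and "\<And>e. e \<notin> E i \<Longrightarrow> verts (rep_fclass (lookup C e)) = {}"
proof -
  have 0: "verts (rep_fclass (0 :: ('i, 'e) fclass)) = {}"
  proof -
    have "forest_iso (empty_forest :: (nat, 'i, 'e) forest) (rep_fclass 0)"
      unfolding zero_fclass_def by (rule forest_iso_rep_cls[OF rooted_forest_empty])
    then show ?thesis
      by (auto simp: forest_iso_def iso_map_def bij_betw_def empty_forest_def)
  qed
  show *: "verts (rep_fclass (lookup C e)) = {}" if "e \<notin> E i" for e
  proof -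
    have "e \<notin> keys C" using that C by blast
    then show ?thesis using 0 by (simp add: in_keys_iff)
  qed
  show "rooted_forest (graft i (\<lambda>e. rep_fclass (lookup C e)))"
    by (rule rooted_forest_graft[OF rooted_forest_rep finite_E[OF i] *])
qed

text \<open>The multiplicative recursion for \<open>phi\<close> gives the algebra morphism, and the
  recursion at a root gives compatibility with \<open>Bplus\<close>. The value
  \<open>undefined\<close> off the algebra selects the extensional representative, the one for which
  uniqueness is stated.\<close>

lemma universal_exists:
  "universal_morphism I E \<Lambda> (\<lambda>x. if x \<in> forest_alg I E then poly_ext class_poly x else undefined)"
    (is "universal_morphism I E \<Lambda> ?\<phi>")
proof -
  have one: "(1 :: ('i, 'e) fclass \<Rightarrow>\<^sub>0 'k) \<in> forest_alg I E"
    by (simp add: forest_alg_def zero_in_fclasses)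
  have "alg_morphism I E ?\<phi>"
    unfolding alg_morphism_def
  proof (intro conjI ballI allI)
    have "?\<phi> 1 = poly_ext class_poly (single 0 1)" using one by (simp del: poly_ext_single)
    then show "?\<phi> 1 = 1" by (simp only: poly_ext_single class_poly_0 smult_1_left)
  next
    fix x y :: "('i, 'e) fclass \<Rightarrow>\<^sub>0 'k" assume xy: "x \<in> forest_alg I E" "y \<in> forest_alg I E"
    show "?\<phi> (x + y) = ?\<phi> x + ?\<phi> y"
      using xy forest_alg_add[OF xy] by (simp add: poly_ext_add)
    have "poly_ext class_poly (x * y) = poly_ext class_poly x * poly_ext class_poly y"
      using xy by (intro poly_ext_mult class_poly_plus) (auto simp: forest_alg_def)
    then show "?\<phi> (x * y) = ?\<phi> x * ?\<phi> y"
      using xy forest_alg_mult[OF xy] by simp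
  next
    fix c and x :: "('i, 'e) fclass \<Rightarrow>\<^sub>0 'k" assume x: "x \<in> forest_alg I E"
    show "?\<phi> (scale c x) = smult c (?\<phi> x)"
      using x forest_alg_scale[OF x] by (simp add: poly_ext_scale)
  qed
  moreover have "?\<phi> (Bplus i x) = \<Lambda> i (tensor_power (E i) ?\<phi> x)"
    if i: "i \<in> I" and x: "x \<in> forest_tensor I E (E i)" for i x
  proof -
    let ?G = "\<lambda>C. graft i (\<lambda>e. rep_fclass (lookup C e))"
    have C: "keys C \<subseteq> E i" "\<And>e. e \<in> E i \<Longrightarrow> lookup C e \<in> fclasses I E" if "C \<in> keys x" for C
      using x that by (auto simp: forest_tensor_def)
    have wd: "well_decorated I E (rep_fclass (lookup C e))" if "C \<in> keys x" for C e
    proof -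
      have "lookup C e \<in> fclasses I E"
        using C[OF that] zero_in_fclasses by (metis in_keys_iff subsetD)
      then show ?thesis by (rule fclass_rep)
    qed
    have G: "rooted_forest (?G C)" "well_decorated I E (?G C)" if "C \<in> keys x" for C
      using rooted_forest_graft_rep[OF i C(1)[OF that]] wd[OF that] i
      by (auto intro!: well_decorated_graft rooted_forest_rep)
    have alg: "Bplus i x \<in> forest_alg I E"
      unfolding Bplus_def by (intro forest_alg_sum forest_alg_single cls_in_fclasses G)
    have "?\<phi> (Bplus i x) = (\<Sum>C\<in>keys x. smult (lookup x C) (class_poly (cls (?G C))))"
      using alg by (simp add: Bplus_def poly_ext_sum)
    also have "\<dots> = (\<Sum>C\<in>keys x. smult (lookup x C) (\<Lambda> i (mprod (E i) (\<lambda>e. class_poly (lookup C e)))))"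
    proof (rule sum.cong[OF refl])
      fix C assume "C \<in> keys x"
      then have r: "rooted_forest (?G C)" by (rule G)
      show "smult (lookup x C) (class_poly (cls (?G C))) =
          smult (lookup x C) (\<Lambda> i (mprod (E i) (\<lambda>e. class_poly (lookup C e))))"
        unfolding class_poly_cls[OF r] unfolding class_poly_def
        by (subst forest_poly_graft[OF rooted_forest_rep r]) simp
    qed
    also have "\<dots> = \<Lambda> i (\<Sum>C\<in>keys x. scale (lookup x C) (mprod (E i) (\<lambda>e. class_poly (lookup C e))))"
      by (subst cocycle_linear[OF i]) (auto intro: mpol_on_mprod finite_E i)
    also have "(\<Sum>C\<in>keys x. scale (lookup x C) (mprod (E i) (\<lambda>e. class_poly (lookup C e)))) =
        tensor_power (E i) ?\<phi> x"
      unfolding tensor_power_def mprod_def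
      by (intro sum.cong refl arg_cong[of _ _ "scale _"] prod.cong)
        (simp add: forest_alg_single C)
    finally show ?thesis .
  qed
  ultimately show ?thesis
    unfolding universal_morphism_def by blast
qed

text \<open>Every forest arises from the empty one by disjoint unions and grafting, and both
  operations determine the value of the morphism. The vertex type is arbitrary, so that the lemma
  applies both to representatives of classes and to the trees of the final formula.\<close>

lemma universal_cls:
  fixes F :: "('v, 'i, 'e) forest"
  assumes univ: "universal_morphism I E \<Lambda> \<phi>" and "rooted_forest F" "well_decorated I E F"
  shows "\<phi> (single (cls F) 1) = forest_poly F"
  using assms(2,3)
proof (induction "card (verts F)" arbitrary: F rule: less_induct)
  case less
  note F = less.prems(1) and wd = less.prems(2)
  have alg: "alg_morphism I E \<phi>" using univ by (simp add: universal_morphism_def)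
  have fin: "finite (verts F)" using F by (simp add: rooted_forest_def)
  interpret decorated "edges F" I E \<Lambda> a "vdec F" "edec F" "verts F"
    by (rule decorated_forest[OF F wd])
  have IH: "\<phi> (single (cls (restr F X)) 1) = forest_poly (restr F X)"
    if "down_closed (edges F) (verts F) X" "X \<noteq> verts F" for X
  proof (rule less.hyps)
    show "card (verts (restr F X)) < card (verts F)"
      using that fin by (auto simp: down_closed_def intro!: psubset_card_mono)
  qed (use that F wd rooted_forest_restr well_decorated_restr in blast)+
  show ?case
  proof (cases "verts F = {}")
    case True
    have "cls F = 0" by (rule cls_empty[OF F True])
    moreover have "\<phi> 1 = 1" using alg by (simp add: alg_morphism_def)
    ultimately show ?thesis by (simp add: forest_poly_def True)
  next
    case False
    obtain r where r: "r \<in> verts F" "\<And>u. u \<in> verts F \<Longrightarrow> (u, r) \<notin> edges F"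
      using exists_root[OF fin False] by blast
    let ?Y = "desc (edges F) (verts F) r"
    have Y: "down_closed (edges F) (verts F) ?Y" by (rule down_closed_desc[OF r(1)])
    show ?thesis
    proof (cases "?Y = verts F")
      \<comment> \<open>Several components: the class is a sum of two classes of smaller forests, so
        the basis element is a product.\<close>
      case False
      let ?Z = "verts F - ?Y"
      have Z: "down_closed (edges F) (verts F) ?Z"
        by (rule down_closed_remove[OF r(2)])
      have "?Z \<noteq> verts F" using r(1) desc_self[of r "edges F" "verts F"] by blast
      note IH = IH[OF Y False] IH[OF Z this]
      have sub: "?Y \<subseteq> verts F" by (rule desc_subset[OF r(1)])
      note YF = rooted_forest_restr[OF F Y] well_decorated_restr[OF F Y wd]
      note ZF = rooted_forest_restr[OF F Z] well_decorated_restr[OF F Z wd]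
      have iso: "forest_iso (dunion (restr F ?Y) (restr F ?Z)) F"
        by (rule cls_split[OF F Y Z]) (use sub in auto)
      have rd: "rooted_forest (dunion (restr F ?Y) (restr F ?Z))"
        by (rule rooted_forest_dunion[OF YF(1) ZF(1)])
      have "cls F = cls (restr F ?Y) + cls (restr F ?Z)"
        unfolding cls_dunion[OF YF(1) ZF(1), symmetric] by (rule cls_eqI[OF rd F iso, symmetric])
      then have "\<phi> (single (cls F) 1) = \<phi> (single (cls (restr F ?Y)) 1 * single (cls (restr F ?Z)) 1)"
        by (simp add: mult_single)
      also have "\<dots> = \<phi> (single (cls (restr F ?Y)) 1) * \<phi> (single (cls (restr F ?Z)) 1)"
        using alg YF ZF by (simp add: alg_morphism_def forest_alg_single cls_in_fclasses)
      also have "\<dots> = forest_poly (dunion (restr F ?Y) (restr F ?Z))"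
        unfolding IH forest_poly_dunion[OF YF ZF] ..
      also have "\<dots> = forest_poly F"
        by (rule forest_poly_iso[OF rd F iso, symmetric])
      finally show ?thesis .
    next
      case True
      then have tree: "is_tree (edges F) (verts F) r" using r by (simp add: is_tree_def)
      let ?B = "branch (edges F) (edec F) (verts F) r"
      let ?i = "vdec F r"
      have i: "?i \<in> I" using d r(1) by blast
      have eE: "edec F (r, w) \<in> E ?i" if "(r, w) \<in> edges F" for w
        using \<epsilon> edges_verts[OF F that] that by blast
      have B: "down_closed (edges F) (verts F) (?B e)" "?B e \<noteq> verts F" for e
        using branch_root[of r "edec F" "verts F" e] r(1) by (auto intro: down_closed_branch)
      note BF = rooted_forest_restr[OF F B(1)] well_decorated_restr[OF F B(1) wd]
      have Bempty: "?B e = {}" if "e \<notin> E ?i" for e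
        using that eE by (auto simp: branch_def)
      have Bcls: "cls (restr F (?B e)) = 0" if "e \<notin> E ?i" for e
        using Bempty[OF that] by (intro cls_empty BF) simp
      \<comment> \<open>The basis element of the tensor power given by the classes of the branches.
        Branches for decorations outside \<open>E ?i\<close> are empty and have class 0, so its
        value at every \<open>e\<close> is the class of the branch.\<close>
      define C where "C = (\<Sum>e\<in>E ?i. single e (cls (restr F (?B e))))"
      have lC: "lookup C e = cls (restr F (?B e))" for e
      proof -
        have "lookup C e = (\<Sum>e'\<in>E ?i. if e' = e then cls (restr F (?B e')) else 0)"
          by (simp add: C_def lookup_sum lookup_single when_def)
        also have "\<dots> = (if e \<in> E ?i then cls (restr F (?B e)) else 0)"
          using finite_E[OF i] by (simp add: sum.delta)
        also have "\<dots> = cls (restr F (?B e))"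
          using Bcls[of e] by simp
        finally show ?thesis .
      qed
      have kC: "keys C \<subseteq> E ?i"
        using Bcls lC by (metis in_keys_iff subsetI)
      have C: "single C (1 :: 'k) \<in> forest_tensor I E (E ?i)"
        using kC cls_in_fclasses[OF BF] by (auto simp: forest_tensor_def lC)
      let ?G = "graft ?i (\<lambda>e. restr F (?B e))"
      have G: "rooted_forest ?G"
        by (rule rooted_forest_graft[OF BF(1) finite_E[OF i]]) (simp add: Bempty)
      have iso: "forest_iso ?G F"
        by (rule forest_iso_graft_branches[OF F tree]) (auto simp: eE Bempty)
      have G': "rooted_forest (graft ?i (\<lambda>e. rep_fclass (lookup C e)))"
        by (rule rooted_forest_graft_rep(1)[OF i kC])
      have "forest_iso ?G (graft ?i (\<lambda>e. rep_fclass (lookup C e)))"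
        unfolding lC by (intro forest_iso_graft BF rooted_forest_rep forest_iso_rep_cls)
      then have "cls F = cls (graft ?i (\<lambda>e. rep_fclass (lookup C e)))"
        using cls_eqI[OF G F iso] cls_eqI[OF G G'] by simp
      then have "single (cls F) (1 :: 'k) = Bplus ?i (single C 1)"
        by (simp add: Bplus_def)
      then have "\<phi> (single (cls F) 1) = \<Lambda> ?i (tensor_power (E ?i) \<phi> (single C 1))"
        using univ C i by (simp add: universal_morphism_def)
      also have "tensor_power (E ?i) \<phi> (single C 1) = scale 1 (mprod (E ?i) (\<lambda>e. forest_poly (restr F (?B e))))"
        by (simp add: tensor_power_def mprod_def lC IH[OF B])
      also have "\<dots> = mprod (E ?i) (\<lambda>e. forest_poly (restr F (?B e)))"
        by (rule poly_mapping_eqI) simp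
      also have "\<Lambda> ?i \<dots> = forest_poly ?G"
        by (rule forest_poly_graft[OF BF(1) G, symmetric])
      also have "\<dots> = forest_poly F"
        by (rule forest_poly_iso[OF G F iso, symmetric])
      finally show ?thesis .
    qed
  qed
qed

lemma universal_unique:
  "\<exists>!\<phi>. \<phi> \<in> extensional (forest_alg I E) \<and> universal_morphism I E \<Lambda> \<phi>"
proof (rule ex1I, rule conjI)
  show "(\<lambda>x. if x \<in> forest_alg I E then poly_ext class_poly x else undefined) \<in> extensional (forest_alg I E)"
    by (simp add: extensional_def)
  show "universal_morphism I E \<Lambda> (\<lambda>x. if x \<in> forest_alg I E then poly_ext class_poly x else undefined)"
    by (rule universal_exists)
next
  fix \<phi> assume "\<phi> \<in> extensional (forest_alg I E) \<and> universal_morphism I E \<Lambda> \<phi>"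
  then have univ: "universal_morphism I E \<Lambda> \<phi>" and ext: "\<phi> \<in> extensional (forest_alg I E)" by auto
  show "\<phi> = (\<lambda>x. if x \<in> forest_alg I E then poly_ext class_poly x else undefined)"
  proof
    fix x
    show "\<phi> x = (if x \<in> forest_alg I E then poly_ext class_poly x else undefined)"
    proof (cases "x \<in> forest_alg I E")
      case True
      have "\<phi> (single C 1) = class_poly C" if "C \<in> keys x" for C
      proof -
        have "C \<in> fclasses I E" using True that by (auto simp: forest_alg_def)
        from universal_cls[OF univ rooted_forest_rep fclass_rep[OF this]]
        show ?thesis by (simp add: cls_rep class_poly_def)
      qed
      then show ?thesis
        using True univ alg_morphism_poly_ext[of I E \<phi> x]
        by (simp add: universal_morphism_def poly_ext_def)
    qed (use ext in \<open>simp add: extensional_def\<close>)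
  qed
qed

end

section \<open>Recursive structure of binary tubings\<close>

text \<open>Binary tubings of the subforest on \<open>X\<close>, kept as families of tubes of
  \<open>F\<close>. This lets the tubings of the two pieces of a split be united without renaming
  vertices.\<close>

definition Tub_on :: "('v, 'i, 'e) forest \<Rightarrow> 'v set \<Rightarrow> 'v set set set" where
  "Tub_on F X = {\<tau>. tubing F \<tau> \<and> \<Union>\<tau> \<subseteq> X \<and> (\<forall>\<sigma>. tubing F \<sigma> \<and> \<Union>\<sigma> \<subseteq> X \<and> \<tau> \<subseteq> \<sigma> \<longrightarrow> \<sigma> = \<tau>)}"

lemma Tub_eq_Tub_on: "Tub F = Tub_on F (verts F)"
proof -
  have "tubing F \<tau> \<and> \<Union>\<tau> \<subseteq> verts F \<and> A \<longleftrightarrow> tubing F \<tau> \<and> A" for \<tau> A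
    by (auto simp: tubing_def tube_def)
  then show ?thesis unfolding Tub_def Tub_on_def by presburger
qed

lemma Tub_onD:
  assumes "\<tau> \<in> Tub_on F X"
  shows "\<And>Y. Y \<in> \<tau> \<Longrightarrow> tube F Y"
    and "\<And>Y. Y \<in> \<tau> \<Longrightarrow> Y \<subseteq> X"
    and "\<And>Y Z. Y \<in> \<tau> \<Longrightarrow> Z \<in> \<tau> \<Longrightarrow> Y \<inter> Z = {} \<or> Y \<subseteq> Z \<or> Z \<subseteq> Y"
proof -
  have "tubing F \<tau>" "\<Union>\<tau> \<subseteq> X" using assms by (simp_all add: Tub_on_def)
  then show "\<And>Y. Y \<in> \<tau> \<Longrightarrow> tube F Y" "\<And>Y. Y \<in> \<tau> \<Longrightarrow> Y \<subseteq> X"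
    "\<And>Y Z. Y \<in> \<tau> \<Longrightarrow> Z \<in> \<tau> \<Longrightarrow> Y \<inter> Z = {} \<or> Y \<subseteq> Z \<or> Z \<subseteq> Y"
    unfolding tubing_def by blast+
qed

text \<open>The form in which maximality is used: adding a tube compatible with all members gives a
  tubing again, so the tube was already there.\<close>

lemma Tub_on_maximal:
  assumes "\<tau> \<in> Tub_on F X" and "tube F Y" "Y \<subseteq> X"
    and "\<And>Z. Z \<in> \<tau> \<Longrightarrow> Y \<inter> Z = {} \<or> Y \<subseteq> Z \<or> Z \<subseteq> Y"
  shows "Y \<in> \<tau>"
proof -
  have "tubing F (insert Y \<tau>)"
    unfolding tubing_def
  proof (intro conjI ballI)
    show "tube F Z" if "Z \<in> insert Y \<tau>" for Z
      using that assms(2) Tub_onD(1)[OF assms(1)] by blast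
    show "Z \<inter> W = {} \<or> Z \<subseteq> W \<or> W \<subseteq> Z" if "Z \<in> insert Y \<tau>" "W \<in> insert Y \<tau>" for Z W
      using that assms(4) Tub_onD(3)[OF assms(1)] by blast
  qed
  moreover have "\<Union>(insert Y \<tau>) \<subseteq> X" using assms(3) Tub_onD(2)[OF assms(1)] by blast
  ultimately have "insert Y \<tau> = \<tau>"
    using assms(1) subset_insertI[of \<tau> Y] by (simp add: Tub_on_def)
  then show ?thesis by blast
qed

lemma finite_Tub_on:
  assumes "finite X"
  shows "finite (Tub_on F X)" "\<tau> \<in> Tub_on F X \<Longrightarrow> finite \<tau>"
proof -
  have "Tub_on F X \<subseteq> Pow (Pow X)" by (auto simp: Tub_on_def)
  then show "finite (Tub_on F X)" "\<tau> \<in> Tub_on F X \<Longrightarrow> finite \<tau>"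
    using assms by (meson finite_Pow_iff finite_subset PowD subsetD)+
qed

lemma upper_lowerD:
  assumes "\<tau> \<in> Tub_on F X" "upper_lower F \<tau> U D"
  shows "U \<in> \<tau>" "D \<in> \<tau>" "U \<subset> X"
proof -
  obtain Z where "Z \<in> \<tau>" "max_subtubes \<tau> Z = {U, D}"
    using assms(2) by (auto simp: upper_lower_def)
  then have "U \<in> max_subtubes \<tau> Z" "D \<in> max_subtubes \<tau> Z" by auto
  then show "U \<in> \<tau>" "D \<in> \<tau>" "U \<subset> X"
    using Tub_onD(2)[OF assms(1) \<open>Z \<in> \<tau>\<close>] unfolding max_subtubes_def by blast+
qed

lemma upper_tubes_subset: "\<tau> \<in> Tub_on F X \<Longrightarrow> upper_tubes F \<tau> \<subseteq> {U \<in> \<tau>. U \<subset> X}"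
  unfolding upper_tubes_def using upper_lowerD(1,3)[of \<tau> F X] by (intro subsetI CollectI) (elim CollectE exE, blast)

lemma finite_upper_tubes: "\<tau> \<in> Tub_on F X \<Longrightarrow> finite X \<Longrightarrow> finite (upper_tubes F \<tau>)"
  using upper_tubes_subset[of \<tau> F X] finite_Tub_on(2)[of X \<tau> F] finite_subset[of _ \<tau>] by blast

section \<open>Tubes as subtrees, and the outermost split of a tubing\<close>

locale forest_tubings =
  fixes F :: "('v, 'i, 'e) forest"
  assumes F: "rooted_forest F"
begin

abbreviation "R \<equiv> edges F"
abbreviation "V \<equiv> verts F"

sublocale arborescence R by (rule arborescence_edges[OF F])

lemma finV: "finite V"
  using F by (simp add: rooted_forest_def)

lemma leq_rtrancl: "(x, y) \<in> leq F \<longleftrightarrow> x \<in> V \<and> (y, x) \<in> R\<^sup>*"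
  by (rule leq_iff_edges[OF F])

lemma desc_rtrancl: "w \<in> desc R X v \<Longrightarrow> (v, w) \<in> R\<^sup>*"
  unfolding desc_def by (auto intro: rtrancl_mono[THEN subsetD, rotated])

lemma leq_antisym: "(x, y) \<in> leq F \<Longrightarrow> (y, x) \<in> leq F \<Longrightarrow> x = y"
  using F unfolding rooted_forest_def by (meson antisymD partial_order_onD(3))

lemma tree_tube:
  assumes "X \<subseteq> V" "is_tree R X r"
  shows "tube F X"
proof -
  let ?S = "(R \<union> R\<inverse>) \<inter> X \<times> X"
  have "sym ?S" by (auto simp: sym_def)
  then have sym: "sym (?S\<^sup>*)" by (rule sym_rtrancl)
  have "induced R X \<subseteq> ?S" by blast
  then have "(r, x) \<in> ?S\<^sup>*" if "x \<in> X" for x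
    using assms(2) that rtrancl_mono[of "induced R X" ?S] by (auto simp: is_tree_def desc_def)
  then have "(x, y) \<in> ?S\<^sup>*" if "x \<in> X" "y \<in> X" for x y
    using that symD[OF sym] by (meson rtrancl_trans)
  then show ?thesis
    using assms by (auto simp: tube_def induces_connected_def is_tree_def)
qed

text \<open>Start an undirected path at a vertex \<open>r\<close> without parent in
  \<open>X\<close>. A step downward stays among the descendants of \<open>r\<close>; a step upward
  leads to the unique parent, which is again such a descendant.\<close>

lemma tube_tree:
  assumes "tube F X"
  obtains r where "is_tree R X r"
proof -
  have X: "X \<subseteq> V" "X \<noteq> {}" "induces_connected F X" using assms by (auto simp: tube_def)
  obtain r where r: "r \<in> X" "\<And>u. u \<in> X \<Longrightarrow> (u, r) \<notin> R"
    using exists_root[OF finite_subset[OF X(1) finV] X(2)] by blast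
  have "x \<in> desc R X r" if "(r, x) \<in> ((R \<union> R\<inverse>) \<inter> X \<times> X)\<^sup>*" for x
    using that
  proof induction
    case (step y z)
    show ?case
    proof (cases "(y, z) \<in> R")
      case True
      then show ?thesis using step by (auto intro: desc_step)
    next
      case False
      then have zy: "(z, y) \<in> R" "z \<in> X" using step by auto
      from step.IH show ?thesis
        by (cases rule: desc_cases) (use zy r parent in blast)+
    qed
  qed simp
  then have "desc R X r = X"
    using X(3) r(1) desc_subset[OF r(1), of R] unfolding induces_connected_def by blast
  then show ?thesis using that r(1) by (simp add: is_tree_def)
qed

lemma root_of_tree:
  assumes "X \<subseteq> V" "is_tree R X r"
  shows "root_of F X = r"
proof -
  have r: "r \<in> X" "\<And>w. w \<in> X \<Longrightarrow> (w, r) \<in> leq F"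
    using assms desc_rtrancl[of _ X r] by (auto simp: is_tree_def leq_rtrancl)
  show ?thesis
    unfolding root_of_def by (rule the_equality) (use r leq_antisym in blast)+
qed

lemma tree_no_parent:
  assumes "is_tree R X r" "u \<in> X"
  shows "(u, r) \<notin> R"
  using assms no_parent_in_desc[of u r X] by (auto simp: is_tree_def)

lemma tree_parent:
  assumes "is_tree R X r" "x \<in> X" "x \<noteq> r"
  obtains u where "u \<in> X" "(u, x) \<in> R"
proof -
  have "x \<in> desc R X r" using assms by (simp add: is_tree_def)
  then show ?thesis by (cases rule: desc_cases) (use assms(3) that in auto)
qed

lemma tree_root_mem:
  assumes "is_tree R X r" "is_tree R Y s" "Y \<subseteq> X" "r \<in> Y"
  shows "s = r"
  using tree_parent[OF assms(2,4)] tree_no_parent[OF assms(1)] assms(3) by blast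

text \<open>The vertices on the path from \<open>y\<close> to \<open>x\<close> are met by climbing
  from \<open>x\<close> through unique parents. Only the root of \<open>X\<close> could have its
  parent outside, and by acyclicity it is not reached before \<open>y\<close>.\<close>

lemma tree_convex:
  assumes X: "is_tree R X r" "X \<subseteq> V" and "(y, x) \<in> R\<^sup>*" "x \<in> X" "y \<in> X"
  shows "x \<in> desc R X y"
  using assms(3,4)
proof (induction rule: rtrancl_induct)
  case (step z x)
  have "x \<noteq> r"
  proof
    assume "x = r"
    moreover have "(r, y) \<in> R\<^sup>*"
      using X(1) assms(5) desc_rtrancl[of y X r] by (simp add: is_tree_def)
    ultimately have "(r, r) \<in> R\<^sup>+" using step.hyps by (meson rtrancl_into_trancl1 rtrancl_trans)
    then show False using acyclic by (simp add: acyclic_def)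
  qed
  then obtain u where "u \<in> X" "(u, x) \<in> R" using tree_parent[OF X(1) step.prems] by blast
  then have "z \<in> X" using parent[OF step.hyps(2)] by blast
  then show ?case using step by (auto intro: desc_step)
qed simp

lemma tree_singleton: "is_tree R {x} x"
  using desc_subset[of x "{x}" R] by (auto simp: is_tree_def)

lemma singleton_in_Tub_on:
  assumes "\<tau> \<in> Tub_on F X" "x \<in> X" "X \<subseteq> V"
  shows "{x} \<in> \<tau>"
  using assms tree_singleton by (intro Tub_on_maximal[OF assms(1)] tree_tube) auto

lemma whole_in_Tub_on:
  assumes "\<tau> \<in> Tub_on F X" "is_tree R X r" "X \<subseteq> V"
  shows "X \<in> \<tau>"
  using assms Tub_onD(2)[OF assms(1)] by (intro Tub_on_maximal[OF assms(1)] tree_tube) auto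

lemma Tub_on_singleton: "r \<in> V \<Longrightarrow> Tub_on F {r} = {{{r}}}"
proof (intro equalityI subsetI)
  fix \<tau> assume r: "r \<in> V" and \<tau>: "\<tau> \<in> Tub_on F {r}"
  then have "{r} \<in> \<tau>" by (intro singleton_in_Tub_on[OF \<tau>]) auto
  moreover have "Y = {r}" if "Y \<in> \<tau>" for Y
    using Tub_onD(1,2)[OF \<tau> that] by (auto simp: tube_def)
  ultimately show "\<tau> \<in> {{{r}}}" by blast
next
  fix \<tau> assume r: "r \<in> V" and "\<tau> \<in> {{{r}}}"
  then have \<tau>: "\<tau> = {{r}}" by simp
  have "tube F {r}" using tree_tube[OF _ tree_singleton] r by simp
  then have "tubing F \<tau>" by (simp add: \<tau> tubing_def)
  moreover have "\<sigma> = \<tau>" if "tubing F \<sigma>" "\<Union>\<sigma> \<subseteq> {r}" "\<tau> \<subseteq> \<sigma>" for \<sigma>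
  proof -
    have "Y = {r}" if "Y \<in> \<sigma>" for Y
    proof -
      have "Y \<noteq> {}" using \<open>tubing F \<sigma>\<close> that by (simp add: tubing_def tube_def)
      moreover have "Y \<subseteq> {r}" using \<open>\<Union>\<sigma> \<subseteq> {r}\<close> that by blast
      ultimately show ?thesis by blast
    qed
    then show ?thesis using \<open>\<tau> \<subseteq> \<sigma>\<close> \<tau> by blast
  qed
  moreover have "\<Union>\<tau> \<subseteq> {r}" by (simp add: \<tau>)
  ultimately show "\<tau> \<in> Tub_on F {r}" unfolding Tub_on_def by (intro CollectI conjI allI impI) simp_all
qed

text \<open>Let \<open>P\<close> be a maximal proper tube containing \<open>r\<close>, let (p, q) be
  an edge leaving it, and \<open>Q\<close> a maximal proper tube containing \<open>q\<close>. Then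
  the union of \<open>P\<close> and \<open>Q\<close> is a tube compatible with every member of the
  tubing; if it were proper it would contradict the maximality of \<open>P\<close>. Hence it is
  \<open>X\<close>, and \<open>Q\<close> is the full subtree at \<open>q\<close>.\<close>

lemma Tub_on_split:
  assumes \<tau>: "\<tau> \<in> Tub_on F X" and X: "X \<subseteq> V" "is_tree R X r" "X \<noteq> {r}"
  obtains v where "v \<in> X" "v \<noteq> r"
    "\<And>Y. Y \<in> \<tau> \<Longrightarrow> Y = X \<or> Y \<subseteq> X - desc R X v \<or> Y \<subseteq> desc R X v"
proof -
  let ?M = "\<lambda>Y. Y \<in> \<tau> \<and> Y \<subset> X \<and> (\<forall>Z\<in>\<tau>. Y \<subseteq> Z \<longrightarrow> Z \<subset> X \<longrightarrow> Z = Y)"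
  have finX: "finite X" using X(1) finV finite_subset by blast
  have rX: "r \<in> X" using X(2) by (simp add: is_tree_def)
  have lam: "Y \<inter> Z = {} \<or> Y \<subseteq> Z \<or> Z \<subseteq> Y" if "Y \<in> \<tau>" "Z \<in> \<tau>" for Y Z
    using Tub_onD(3)[OF \<tau> that] .
  have max: "\<exists>M. ?M M \<and> Y \<subseteq> M" if "Y \<in> \<tau>" "Y \<subset> X" for Y
  proof -
    let ?A = "{Z \<in> \<tau>. Z \<subset> X}"
    have "finite ?A" using finite_Tub_on(2)[OF finX \<tau>] by simp
    moreover have "Y \<in> ?A" using that by simp
    ultimately have "\<exists>M\<in>?A. Y \<subseteq> M \<and> (\<forall>Z\<in>?A. M \<subseteq> Z \<longrightarrow> M = Z)"
      by (rule finite_has_maximal2)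
    then obtain M where "M \<in> ?A" "Y \<subseteq> M" "\<forall>Z\<in>?A. M \<subseteq> Z \<longrightarrow> M = Z" by (elim bexE conjE)
    then show ?thesis by (intro exI[of _ M]) auto
  qed
  have "{r} \<subset> X" using rX X(3) by blast
  from max[OF singleton_in_Tub_on[OF \<tau> rX X(1)] this]
  obtain P where P: "?M P" "r \<in> P" by auto
  have Psub: "P \<subseteq> X" using P(1) by blast
  obtain s where "is_tree R P s" using tube_tree Tub_onD(1)[OF \<tau>] P(1) by metis
  then have Ptree: "is_tree R P r" using tree_root_mem[OF X(2) _ Psub P(2)] by metis
  obtain x where x: "x \<in> X" "x \<notin> P" using P(1) by blast
  have "\<exists>p q. p \<in> P \<and> q \<in> X - P \<and> (p, q) \<in> R"
  proof (rule ccontr)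
    assume no: "\<nexists>p q. p \<in> P \<and> q \<in> X - P \<and> (p, q) \<in> R"
    have "(r, x) \<in> (induced R X)\<^sup>*" using x X(2) by (auto simp: is_tree_def desc_def)
    then have "x \<in> P"
      by induction (use no P(2) in blast)+
    then show False using x by simp
  qed
  then obtain p q where pq: "p \<in> P" "q \<in> X" "q \<notin> P" "(p, q) \<in> R" by blast
  have "{q} \<in> \<tau>" by (rule singleton_in_Tub_on[OF \<tau> pq(2) X(1)])
  moreover have "{q} \<subset> X" using pq(2,3) P(2) rX by blast
  ultimately have "\<exists>Q. ?M Q \<and> {q} \<subseteq> Q" by (rule max)
  then obtain Q where Q: "?M Q" "q \<in> Q" by auto
  \<comment> \<open>\<open>P\<close> inside \<open>Q\<close> would give equality by the maximality
    of \<open>P\<close>, although \<open>q\<close> lies outside \<open>P\<close>.\<close>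
  have PQ: "P \<inter> Q = {}"
  proof -
    have "\<not> Q \<subseteq> P" using Q(2) pq(3) by blast
    moreover from this have "\<not> P \<subseteq> Q" using P(1) Q(1) by auto
    ultimately show ?thesis using lam[of P Q] P(1) Q(1) by simp
  qed
  obtain s where s: "is_tree R Q s" using tube_tree Tub_onD(1)[OF \<tau>] Q(1) by metis
  \<comment> \<open>The parent of \<open>q\<close> is \<open>p\<close>, which lies in
    \<open>P\<close>, so \<open>q\<close> has no parent in \<open>Q\<close>.\<close>
  have "s = q"
  proof (rule ccontr)
    assume "s \<noteq> q"
    then obtain u where "u \<in> Q" "(u, q) \<in> R" using tree_parent[OF s Q(2)] by blast
    then show False using parent[OF _ pq(4)] pq(1) PQ by blast
  qed
  then have Qtree: "is_tree R Q q" using s by simp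
  have qr: "q \<noteq> r" using pq(3) P(2) by blast
  have PQtree: "is_tree R (P \<union> Q) r"
  proof -
    have "x \<in> desc R (P \<union> Q) r" if "x \<in> P" for x
    proof -
      have "(r, x) \<in> (induced R P)\<^sup>*" using that Ptree by (auto simp: is_tree_def desc_def)
      then show ?thesis
        unfolding desc_def by (auto intro: rtrancl_mono[THEN subsetD, rotated])
    qed
    then have "q \<in> desc R (P \<union> Q) r"
      using pq Q(2) by (intro desc_step[OF _ pq(4)]) auto
    moreover have "x \<in> desc R (P \<union> Q) q" if "x \<in> Q" for x
    proof -
      have "(q, x) \<in> (induced R Q)\<^sup>*" using that Qtree by (auto simp: is_tree_def desc_def)
      then show ?thesis
        unfolding desc_def by (auto intro: rtrancl_mono[THEN subsetD, rotated])
    qed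
    ultimately show ?thesis
      using \<open>\<And>x. x \<in> P \<Longrightarrow> x \<in> desc R (P \<union> Q) r\<close> P(2) desc_subset[of r "P \<union> Q" R] desc_trans[of q R "P \<union> Q" r]
      unfolding is_tree_def by blast
  qed
  have XPQ: "P \<union> Q = X"
  proof (rule ccontr)
    assume ne: "P \<union> Q \<noteq> X"
    have sub: "P \<union> Q \<subseteq> X" using P(1) Q(1) by blast
    have "P \<union> Q \<in> \<tau>"
    proof (rule Tub_on_maximal[OF \<tau> tree_tube[OF _ PQtree] sub])
      show "P \<union> Q \<subseteq> V" using sub X(1) by blast
      fix Z assume Z: "Z \<in> \<tau>"
      show "(P \<union> Q) \<inter> Z = {} \<or> P \<union> Q \<subseteq> Z \<or> Z \<subseteq> P \<union> Q"
      proof (cases "Z = X")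
        case False
        then have ZX: "Z \<subset> X" using Tub_onD(2)[OF \<tau> Z] by blast
        have "P \<subseteq> Z \<Longrightarrow> Z = P" "Q \<subseteq> Z \<Longrightarrow> Z = Q" using P(1) Q(1) Z ZX by simp_all
        moreover have "Z \<inter> P = {} \<or> Z \<subseteq> P \<or> P \<subseteq> Z" "Z \<inter> Q = {} \<or> Z \<subseteq> Q \<or> Q \<subseteq> Z"
          using lam[OF Z] P(1) Q(1) by simp_all
        ultimately show ?thesis by blast
      qed (use sub in blast)
    qed
    then have "P \<union> Q = P" using P(1) sub ne by blast
    then show False using Q(2) pq(3) by blast
  qed
  \<comment> \<open>A path inside \<open>P\<close> starting at \<open>r\<close> could enter the
    subtree of \<open>q\<close> only at \<open>q\<close>, which is not in \<open>P\<close>.\<close>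
  have "desc R X q \<inter> P = {}"
  proof -
    have "x \<notin> desc R X q" if "(r, x) \<in> (induced R P)\<^sup>*" for x
      using that
    proof induction
      case base
      show ?case by (rule tree_root_notin[OF X(2) pq(2) qr])
    next
      case (step y z)
      then show ?case using child_comparable[of y z X q] pq(3) by blast
    qed
    then show ?thesis using Ptree by (auto simp: is_tree_def desc_def)
  qed
  moreover have "Q \<subseteq> desc R X q"
  proof
    fix x assume "x \<in> Q"
    then have "(q, x) \<in> (induced R Q)\<^sup>*" using Qtree by (auto simp: is_tree_def desc_def)
    then show "x \<in> desc R X q"
      unfolding desc_def using XPQ by (auto intro: rtrancl_mono[THEN subsetD, rotated])
  qed
  ultimately have eq: "desc R X q = Q" "X - desc R X q = P"
    using XPQ PQ desc_subset[OF pq(2), of R] by blast+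
  show ?thesis
  proof (rule that[OF pq(2) qr])
    fix Y assume Y: "Y \<in> \<tau>"
    show "Y = X \<or> Y \<subseteq> X - desc R X q \<or> Y \<subseteq> desc R X q"
    proof (cases "Y = X")
      case False
      then have YX: "Y \<subset> X" using Tub_onD(2)[OF \<tau> Y] by blast
      have "P \<subseteq> Y \<Longrightarrow> Y = P" "Q \<subseteq> Y \<Longrightarrow> Y = Q" using P(1) Q(1) Y YX by simp_all
      moreover have "Y \<inter> P = {} \<or> Y \<subseteq> P \<or> P \<subseteq> Y" "Y \<inter> Q = {} \<or> Y \<subseteq> Q \<or> Q \<subseteq> Y"
        using lam[OF Y] P(1) Q(1) by simp_all
      ultimately show ?thesis unfolding eq using XPQ YX by blast
    qed simp
  qed
qed

end

section \<open>Tubing statistics under joining two pieces\<close>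

locale tubing_split = forest_tubings F
  for F :: "('v, 'i, 'e) forest" +
  fixes X :: "'v set" and r v :: 'v
  assumes X: "X \<subseteq> V" "is_tree R X r" and v: "v \<in> X" "v \<noteq> r"
begin

abbreviation "P \<equiv> X - desc R X v"
abbreviation "Q \<equiv> desc R X v"

lemma trees: "is_tree R P r" "is_tree R Q v"
  using tree_remove[OF X(2) v] tree_subtree[OF v(1)] by auto

lemma subs: "P \<subseteq> V" "Q \<subseteq> V" "Q \<subseteq> X" "r \<in> P" "v \<in> Q" "r \<in> X" "P \<subset> X" "Q \<subset> X" "P \<noteq> Q"
proof -
  show r: "r \<in> P" using trees by (simp add: is_tree_def)
  show "Q \<subseteq> X" by (rule desc_subset[OF v(1)])
  then show "P \<subseteq> V" "Q \<subseteq> V" "v \<in> Q" "r \<in> X" "P \<subset> X" "Q \<subset> X" "P \<noteq> Q"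
    using X(1) r desc_self[of v R X] v(1) by blast+
qed

lemma finX: "finite X" "finite P" "finite Q"
proof -
  show "finite X" by (rule finite_subset[OF X(1) finV])
  then show "finite P" "finite Q" using finite_subset[OF subs(3)] by auto
qed

text \<open>A tube inside one piece is automatically compatible with \<open>X\<close> and with all
  tubes inside the other piece, so maximality passes from the whole tubing to each piece.\<close>

lemma Tub_on_restrict:
  assumes \<tau>: "\<tau> \<in> Tub_on F X" and s: "\<And>Y. Y \<in> \<tau> \<Longrightarrow> Y = X \<or> Y \<subseteq> P \<or> Y \<subseteq> Q"
  shows "{Y \<in> \<tau>. Y \<subseteq> P} \<in> Tub_on F P" "{Y \<in> \<tau>. Y \<subseteq> Q} \<in> Tub_on F Q"
    and "\<tau> = insert X ({Y \<in> \<tau>. Y \<subseteq> P} \<union> {Y \<in> \<tau>. Y \<subseteq> Q})"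
proof -
  have aux: "{Y \<in> \<tau>. Y \<subseteq> A} \<in> Tub_on F A"
    if A: "A \<subseteq> X" and dis: "\<And>Y. Y \<in> \<tau> \<Longrightarrow> Y = X \<or> Y \<subseteq> A \<or> Y \<inter> A = {}" for A
    unfolding Tub_on_def
  proof (intro CollectI conjI allI impI)
    show "tubing F {Y \<in> \<tau>. Y \<subseteq> A}"
      using Tub_onD(1,3)[OF \<tau>] unfolding tubing_def by blast
    show "\<Union>{Y \<in> \<tau>. Y \<subseteq> A} \<subseteq> A" by blast
    fix \<sigma> assume \<sigma>: "tubing F \<sigma> \<and> \<Union>\<sigma> \<subseteq> A \<and> {Y \<in> \<tau>. Y \<subseteq> A} \<subseteq> \<sigma>"
    have "Y \<in> \<tau>" if Y: "Y \<in> \<sigma>" for Y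
    proof (rule Tub_on_maximal[OF \<tau>])
      show "tube F Y" using \<sigma> Y by (simp add: tubing_def)
      have YA: "Y \<subseteq> A" using \<sigma> Y by blast
      then show "Y \<subseteq> X" using A by blast
      fix Z assume Z: "Z \<in> \<tau>"
      consider "Z = X" | "Z \<subseteq> A" | "Z \<inter> A = {}" using dis[OF Z] by blast
      then show "Y \<inter> Z = {} \<or> Y \<subseteq> Z \<or> Z \<subseteq> Y"
      proof cases
        case 2
        then have "Z \<in> \<sigma>" using Z \<sigma> by blast
        then show ?thesis using \<sigma> Y unfolding tubing_def by blast
      qed (use YA A in blast)+
    qed
    then show "\<sigma> = {Y \<in> \<tau>. Y \<subseteq> A}" using \<sigma> by blast
  qed
  show "{Y \<in> \<tau>. Y \<subseteq> P} \<in> Tub_on F P" by (rule aux) (use s in blast)+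
  show "{Y \<in> \<tau>. Y \<subseteq> Q} \<in> Tub_on F Q" by (rule aux) (use s subs in blast)+
  show "\<tau> = insert X ({Y \<in> \<tau>. Y \<subseteq> P} \<union> {Y \<in> \<tau>. Y \<subseteq> Q})"
    using s whole_in_Tub_on[OF \<tau> X(2,1)] by blast
qed

context
  fixes \<tau>' \<tau>'' \<tau>
  assumes \<tau>': "\<tau>' \<in> Tub_on F P" and \<tau>'': "\<tau>'' \<in> Tub_on F Q"
    and \<tau>_def: "\<tau> = insert X (\<tau>' \<union> \<tau>'')"
begin

lemma in_split: "P \<in> \<tau>'" "Q \<in> \<tau>''"
  using whole_in_Tub_on[OF \<tau>' trees(1) subs(1)] whole_in_Tub_on[OF \<tau>'' trees(2) subs(2)] by auto

lemma in_\<tau>':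
  assumes "Y \<in> \<tau>'"
  shows "Y \<subseteq> P" "Y \<noteq> {}" "Y \<subseteq> V" "tube F Y"
  using Tub_onD(1,2)[OF \<tau>' assms] by (auto simp: tube_def)

lemma in_\<tau>'':
  assumes "Y \<in> \<tau>''"
  shows "Y \<subseteq> Q" "Y \<noteq> {}" "Y \<subseteq> V" "tube F Y"
  using Tub_onD(1,2)[OF \<tau>'' assms] by (auto simp: tube_def)

text \<open>A tube in \<open>X\<close> compatible with both \<open>P\<close> and \<open>Q\<close> is
  \<open>X\<close> itself or lies inside one of them, where the maximality of that part
  applies.\<close>

lemma join_Tub_on: "\<tau> \<in> Tub_on F X"
proof -
  have lam: "Y \<inter> Z = {} \<or> Y \<subseteq> Z \<or> Z \<subseteq> Y" if YZ: "Y \<in> \<tau>" "Z \<in> \<tau>" for Y Z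
  proof -
    have sub: "Y \<subseteq> X" "Z \<subseteq> X" using YZ in_\<tau>'(1) in_\<tau>''(1) subs(3) unfolding \<tau>_def by blast+
    consider "Y = X \<or> Z = X" | "Y \<in> \<tau>'" "Z \<in> \<tau>'" | "Y \<in> \<tau>''" "Z \<in> \<tau>''" | "Y \<in> \<tau>'" "Z \<in> \<tau>''" | "Y \<in> \<tau>''" "Z \<in> \<tau>'"
      using YZ unfolding \<tau>_def by blast
    then show ?thesis
    proof cases
      case 1 then show ?thesis using sub by blast
    next
      case 2 then show ?thesis using Tub_onD(3)[OF \<tau>'] by blast
    next
      case 3 then show ?thesis using Tub_onD(3)[OF \<tau>''] by blast
    next
      case 4 then show ?thesis using in_\<tau>'(1) in_\<tau>''(1) by blast
    next
      case 5 then show ?thesis using in_\<tau>'(1) in_\<tau>''(1) by blast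
    qed
  qed
  have tub: "tubing F \<tau>"
    unfolding tubing_def using lam tree_tube[OF X] in_\<tau>'(4) in_\<tau>''(4) by (auto simp: \<tau>_def)
  have "\<sigma> = \<tau>" if \<sigma>: "tubing F \<sigma>" "\<Union>\<sigma> \<subseteq> X" "\<tau> \<subseteq> \<sigma>" for \<sigma>
  proof -
    have l: "Y \<inter> Z = {} \<or> Y \<subseteq> Z \<or> Z \<subseteq> Y" "tube F Y" "Y \<noteq> {}" if "Y \<in> \<sigma>" "Z \<in> \<sigma>" for Y Z
      using \<sigma>(1) that unfolding tubing_def tube_def by blast+
    have PQ\<sigma>: "P \<in> \<sigma>" "Q \<in> \<sigma>" using in_split \<sigma>(3) by (auto simp: \<tau>_def)
    have "Z \<in> \<tau>" if Z: "Z \<in> \<sigma>" for Z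
    proof -
      have ZX: "Z \<subseteq> X" using \<sigma>(2) Z by blast
      have "Z = X \<or> Z \<subseteq> P \<or> Z \<subseteq> Q"
        using l(1)[OF Z PQ\<sigma>(1)] l(1)[OF Z PQ\<sigma>(2)] ZX subs(3) by blast
      then show ?thesis
      proof (elim disjE)
        assume "Z \<subseteq> P"
        then have "Z \<in> \<tau>'"
          by (rule Tub_on_maximal[OF \<tau>' l(2)[OF Z Z]]) (use l(1)[OF Z] \<sigma>(3) \<tau>_def in blast)
        then show ?thesis by (simp add: \<tau>_def)
      next
        assume "Z \<subseteq> Q"
        then have "Z \<in> \<tau>''"
          by (rule Tub_on_maximal[OF \<tau>'' l(2)[OF Z Z]]) (use l(1)[OF Z] \<sigma>(3) \<tau>_def in blast)
        then show ?thesis by (simp add: \<tau>_def)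
      qed (simp add: \<tau>_def)
    qed
    then show ?thesis using \<sigma>(3) by blast
  qed
  moreover have "\<Union>\<tau> \<subseteq> X" using in_\<tau>'(1) in_\<tau>''(1) subs(3) unfolding \<tau>_def by blast
  ultimately show ?thesis using tub unfolding Tub_on_def by blast
qed

text \<open>A member properly inside a tube of one part can neither be \<open>X\<close> nor come
  from the other part, so joining changes nothing below the tubes of the two parts.\<close>

lemma max_subtubes_join:
  "max_subtubes \<tau> X = {P, Q}"
  "Z \<in> \<tau>' \<Longrightarrow> max_subtubes \<tau> Z = max_subtubes \<tau>' Z"
  "Z \<in> \<tau>'' \<Longrightarrow> max_subtubes \<tau> Z = max_subtubes \<tau>'' Z"
proof -
  have PQ: "P \<in> \<tau>" "Q \<in> \<tau>" using in_split by (auto simp: \<tau>_def)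
  have c: "Y = X \<or> Y \<subseteq> P \<or> Y \<subseteq> Q" if "Y \<in> \<tau>" for Y
    using that in_\<tau>'(1) in_\<tau>''(1) unfolding \<tau>_def by blast
  show "max_subtubes \<tau> X = {P, Q}"
  proof
    show "max_subtubes \<tau> X \<subseteq> {P, Q}"
    proof
      fix Y assume "Y \<in> max_subtubes \<tau> X"
      then have Y: "Y \<in> \<tau>" "Y \<subset> X" "\<And>Z. Z \<in> \<tau> \<Longrightarrow> Y \<subset> Z \<Longrightarrow> \<not> Z \<subset> X"
        by (auto simp: max_subtubes_def)
      have "\<not> Y \<subset> P" "\<not> Y \<subset> Q" using Y(3)[OF PQ(1)] Y(3)[OF PQ(2)] subs(7,8) by blast+
      then show "Y \<in> {P, Q}" using c[OF Y(1)] Y(2) by blast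
    qed
    have "\<not> (\<exists>Z\<in>\<tau>. P \<subset> Z \<and> Z \<subset> X)" "\<not> (\<exists>Z\<in>\<tau>. Q \<subset> Z \<and> Z \<subset> X)"
      using c subs(4,5) by blast+
    then show "{P, Q} \<subseteq> max_subtubes \<tau> X"
      using PQ subs(7,8) unfolding max_subtubes_def by blast
  qed
  show "max_subtubes \<tau> Z = max_subtubes \<tau>' Z" if Z: "Z \<in> \<tau>'"
  proof -
    have "Y \<in> \<tau> \<longleftrightarrow> Y \<in> \<tau>'" if "Y \<subset> Z" for Y
      using that in_\<tau>'(1)[OF Z] in_\<tau>''(1,2)[of Y] subs(7) unfolding \<tau>_def by blast
    then show ?thesis unfolding max_subtubes_def by blast
  qed
  show "max_subtubes \<tau> Z = max_subtubes \<tau>'' Z" if Z: "Z \<in> \<tau>''"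
  proof -
    have "Y \<in> \<tau> \<longleftrightarrow> Y \<in> \<tau>''" if "Y \<subset> Z" for Y
      using that in_\<tau>''(1)[OF Z] in_\<tau>'(1,2)[of Y] subs(8) unfolding \<tau>_def by blast
    then show ?thesis unfolding max_subtubes_def by blast
  qed
qed

lemma upper_lower_join:
  "upper_lower F \<tau> U D \<longleftrightarrow> U = P \<and> D = Q \<or> upper_lower F \<tau>' U D \<or> upper_lower F \<tau>'' U D"
proof -
  have conv: "y \<in> desc R X x" if "(y, x) \<in> leq F" "x \<in> X" "y \<in> X" for x y
    using tree_convex[OF X(2,1)] that by (simp add: leq_rtrancl)
  have up: "upset F X P" unfolding upset_def
    using conv desc_trans[of _ R X v] by blast
  have down: "downset F X Q" unfolding downset_def
    using conv desc_trans[of _ R X v] subs(3) by blast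
  have "(v, r) \<in> leq F"
    using X v desc_rtrancl[of v X r] by (auto simp: leq_rtrancl is_tree_def)
  \<comment> \<open>This orients the pair: the root \<open>r\<close> lies above \<open>v\<close> but
    outside \<open>Q\<close>, so only \<open>P\<close> can be the upper tube.\<close>
  then have nup: "\<not> upset F X Q"
    unfolding upset_def using subs by blast
  have "upper_lower F \<tau> U D \<longleftrightarrow> U \<noteq> D \<and> (max_subtubes \<tau> X = {U, D} \<and> upset F X U \<and> downset F X D \<or>
      (\<exists>Z\<in>\<tau>'. max_subtubes \<tau> Z = {U, D} \<and> upset F Z U \<and> downset F Z D) \<or>
      (\<exists>Z\<in>\<tau>''. max_subtubes \<tau> Z = {U, D} \<and> upset F Z U \<and> downset F Z D))"
    unfolding upper_lower_def by (auto simp: \<tau>_def)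
  also have "\<dots> \<longleftrightarrow> U \<noteq> D \<and> (max_subtubes \<tau> X = {U, D} \<and> upset F X U \<and> downset F X D) \<or>
      upper_lower F \<tau>' U D \<or> upper_lower F \<tau>'' U D"
    unfolding upper_lower_def using max_subtubes_join(2,3) by auto
  also have "U \<noteq> D \<and> (max_subtubes \<tau> X = {U, D} \<and> upset F X U \<and> downset F X D) \<longleftrightarrow> U = P \<and> D = Q"
    unfolding max_subtubes_join(1) using up down nup subs(9) by (auto simp: doubleton_eq_iff)
  finally show ?thesis .
qed

lemma upper_join: "upper_tubes F \<tau> = insert P (upper_tubes F \<tau>' \<union> upper_tubes F \<tau>'')"
  unfolding upper_tubes_def by (auto simp: upper_lower_join)

lemma in_upper':
  assumes "U \<in> upper_tubes F \<tau>'"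
  shows "U \<in> \<tau>'" "U \<subset> P"
  using upper_tubes_subset[OF \<tau>'] assms by blast+

lemma in_upper'':
  assumes "U \<in> upper_tubes F \<tau>''"
  shows "U \<in> \<tau>''" "U \<subset> Q"
  using upper_tubes_subset[OF \<tau>''] assms by blast+

lemma upper_disjoint:
  "P \<notin> upper_tubes F \<tau>'" "P \<notin> upper_tubes F \<tau>''" "upper_tubes F \<tau>' \<inter> upper_tubes F \<tau>'' = {}"
proof -
  show "P \<notin> upper_tubes F \<tau>'" using in_upper'(2) by blast
  show "P \<notin> upper_tubes F \<tau>''" using in_upper''(2) subs(4) by blast
  show "upper_tubes F \<tau>' \<inter> upper_tubes F \<tau>'' = {}"
    using in_upper'(2) in_upper''(2) in_\<tau>'(2)[OF in_upper'(1)] by blast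
qed

lemma tube_type_join:
  "U \<in> upper_tubes F \<tau>' \<Longrightarrow> tube_type F \<tau> U = tube_type F \<tau>' U"
  "U \<in> upper_tubes F \<tau>'' \<Longrightarrow> tube_type F \<tau> U = tube_type F \<tau>'' U"
proof -
  show "tube_type F \<tau> U = tube_type F \<tau>' U" if U: "U \<in> upper_tubes F \<tau>'"
  proof -
    have "U \<noteq> P" "U \<notin> upper_tubes F \<tau>''" using U upper_disjoint by auto
    then have "upper_lower F \<tau> U D \<longleftrightarrow> upper_lower F \<tau>' U D" for D
      unfolding upper_lower_join by (auto simp: upper_tubes_def)
    then show ?thesis by (simp add: tube_type_def)
  qed
  show "tube_type F \<tau> U = tube_type F \<tau>'' U" if U: "U \<in> upper_tubes F \<tau>''"
  proof -
    have "U \<noteq> P" "U \<notin> upper_tubes F \<tau>'" using U upper_disjoint by auto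
    then have "upper_lower F \<tau> U D \<longleftrightarrow> upper_lower F \<tau>'' U D" for D
      unfolding upper_lower_join by (auto simp: upper_tubes_def)
    then show ?thesis by (simp add: tube_type_def)
  qed
qed

lemma tube_type_P:
  assumes "v \<in> branch R (edec F) X r e"
  shows "tube_type F \<tau> P = e"
proof -
  have ul: "upper_lower F \<tau> P D \<longleftrightarrow> D = Q" for D
    unfolding upper_lower_join using upper_disjoint(1,2) by (auto simp: upper_tubes_def)
  have roots: "root_of F P = r" "root_of F Q = v"
    using root_of_tree trees subs by auto
  have vV: "v \<in> V" using v X by blast
  \<comment> \<open>The type of a tube refers to the order of the whole forest, so the possible
    first edges are compared through branches of \<open>V\<close> instead of
    \<open>X\<close>.\<close>
  have br: "v \<in> branch R (edec F) V r e'" if "(r, w) \<in> R" "(v, w) \<in> leq F" "edec F (r, w) = e'" for w e'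
  proof -
    have "w \<in> V" using edges_verts[OF F that(1)] by simp
    moreover have "v \<in> desc R V w" using that(2) by (simp add: desc_verts[OF F \<open>w \<in> V\<close>])
    ultimately show ?thesis using that by (auto simp: branch_def)
  qed
  obtain w where w: "w \<in> X" "(r, w) \<in> R" "edec F (r, w) = e" "v \<in> desc R X w"
    using assms by (auto simp: branch_def)
  have wl: "(v, w) \<in> leq F" using desc_rtrancl[OF w(4)] vV by (simp add: leq_rtrancl)
  show ?thesis
    unfolding tube_type_def ul roots
  proof (rule the_equality)
    show "\<exists>D w. D = Q \<and> (r, w) \<in> R \<and> (root_of F D, w) \<in> leq F \<and> e = edec F (r, w)"
      using w wl roots by (intro exI[of _ Q] exI[of _ w]) simp
    fix e' assume "\<exists>D w. D = Q \<and> (r, w) \<in> R \<and> (root_of F D, w) \<in> leq F \<and> e' = edec F (r, w)"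
    then obtain w' where "(r, w') \<in> R" "(v, w') \<in> leq F" "edec F (r, w') = e'"
      using roots by auto
    then show "e' = e" using branch_disjoint br br[OF w(2) wl w(3)] by metis
  qed
qed

lemma root_upper':
  assumes "U \<in> upper_tubes F \<tau>'"
  shows "root_of F U \<in> U" "root_of F U \<in> P" "r \<in> U \<longleftrightarrow> root_of F U = r"
proof -
  note U = in_\<tau>'[OF in_upper'(1)[OF assms]]
  obtain s where s: "is_tree R U s" using tube_tree[OF U(4)] .
  have "root_of F U = s" by (rule root_of_tree[OF U(3) s])
  then show "root_of F U \<in> U" "root_of F U \<in> P" "r \<in> U \<longleftrightarrow> root_of F U = r"
    using s U(1) tree_root_mem[OF trees(1) s U(1)] unfolding is_tree_def by blast+
qed

lemma root_upper'':
  assumes "U \<in> upper_tubes F \<tau>''"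
  shows "root_of F U \<in> Q" "r \<notin> U"
proof -
  note U = in_\<tau>''[OF in_upper''(1)[OF assms]]
  obtain s where s: "is_tree R U s" using tube_tree[OF U(4)] .
  have "root_of F U = s" by (rule root_of_tree[OF U(3) s])
  then show "root_of F U \<in> Q" "r \<notin> U"
    using s U(1) subs(4) unfolding is_tree_def by blast+
qed

lemma root_P: "root_of F P = r"
  by (rule root_of_tree[OF subs(1) trees(1)])

text \<open>The only new upper tube is \<open>P\<close>; its root is \<open>r\<close>, and its type
  is the decoration of the branch containing \<open>v\<close>.\<close>

lemma rk_join:
  "x \<in> P \<Longrightarrow> x \<noteq> r \<Longrightarrow> rk F \<tau> x = rk F \<tau>' x"
  "x \<in> Q \<Longrightarrow> rk F \<tau> x = rk F \<tau>'' x"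
  "v \<in> branch R (edec F) X r e \<Longrightarrow> rk F \<tau> r = rk F \<tau>' r + single e 1"
proof -
  have fin: "finite (upper_tubes F \<tau>')" by (rule finite_upper_tubes[OF \<tau>' finX(2)])
  have ne: "root_of F U \<noteq> r" if "U \<in> upper_tubes F \<tau>''" for U
    using root_upper''(1)[OF that] subs(4) by (metis DiffD2)
  show "rk F \<tau> x = rk F \<tau>' x" if x: "x \<in> P" "x \<noteq> r"
  proof -
    have "{U \<in> upper_tubes F \<tau>. root_of F U = x} = {U \<in> upper_tubes F \<tau>'. root_of F U = x}"
      unfolding upper_join using root_upper''(1) root_P x by auto
    then show ?thesis
      unfolding rk_def count_types_def by (auto intro!: sum.cong simp: tube_type_join)
  qed
  show "rk F \<tau> x = rk F \<tau>'' x" if x: "x \<in> Q"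
  proof -
    have "x \<noteq> r" using x subs(4) by blast
    then have "{U \<in> upper_tubes F \<tau>. root_of F U = x} = {U \<in> upper_tubes F \<tau>''. root_of F U = x}"
      unfolding upper_join using root_upper'(2) root_P x by auto
    then show ?thesis
      unfolding rk_def count_types_def by (auto intro!: sum.cong simp: tube_type_join)
  qed
  show "rk F \<tau> r = rk F \<tau>' r + single e 1" if "v \<in> branch R (edec F) X r e"
  proof -
    have "{U \<in> upper_tubes F \<tau>. root_of F U = r} = insert P {U \<in> upper_tubes F \<tau>'. root_of F U = r}"
      unfolding upper_join using ne by (auto simp: root_P)
    moreover have "P \<notin> {U \<in> upper_tubes F \<tau>'. root_of F U = r}" using upper_disjoint(1) by blast
    moreover have "(\<Sum>U\<in>{U \<in> upper_tubes F \<tau>'. root_of F U = r}. single (tube_type F \<tau> U) (1::nat)) =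
        (\<Sum>U\<in>{U \<in> upper_tubes F \<tau>'. root_of F U = r}. single (tube_type F \<tau>' U) 1)"
      by (intro sum.cong refl) (simp add: tube_type_join)
    ultimately show ?thesis
      using fin unfolding rk_def count_types_def by (simp add: tube_type_P[OF that] add.commute)
  qed
qed

lemma card_root_join: "card {Y \<in> \<tau>. r \<in> Y} = Suc (card {Y \<in> \<tau>'. r \<in> Y})"
proof -
  have "{Y \<in> \<tau>. r \<in> Y} = insert X {Y \<in> \<tau>'. r \<in> Y}"
    using in_\<tau>''(1) subs(4,6) unfolding \<tau>_def by blast
  moreover have "X \<notin> {Y \<in> \<tau>'. r \<in> Y}" using in_\<tau>'(1) subs(7) by blast
  ultimately show ?thesis using finite_Tub_on(2)[OF finX(2) \<tau>'] by simp
qed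

end

end

text \<open>\<open>beta_stat\<close> refers to the root of the whole forest; with the root as a
  parameter the statistic makes sense for tubings of subtrees.\<close>

definition beta_at :: "('v, 'i, 'e) forest \<Rightarrow> 'v \<Rightarrow> 'v set set \<Rightarrow> nat \<Rightarrow> 'e mindex" where
  "beta_at F r \<tau> k = count_types F \<tau>
     {U \<in> upper_tubes F \<tau>. r \<in> U \<and> \<not> card {U' \<in> upper_tubes F \<tau>. r \<in> U' \<and> U \<subset> U'} < k - 1}"

context tubing_split
begin

text \<open>\<open>P\<close> properly contains every other upper tube through \<open>r\<close>. It
  is therefore the first one to be excluded and raises the count above each of the others by one.
  The index starts at 2, because for index 1 nothing is excluded and \<open>P\<close> itself
  counts.\<close>

lemma beta_join:
  assumes \<tau>': "\<tau>' \<in> Tub_on F P" and \<tau>'': "\<tau>'' \<in> Tub_on F Q"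
    and \<tau>_def: "\<tau> = insert X (\<tau>' \<union> \<tau>'')"
  shows "beta_at F r \<tau> (Suc (Suc k)) = beta_at F r \<tau>' (Suc k)"
proof -
  note join = \<tau>' \<tau>'' \<tau>_def
  note up = upper_join[OF join] and ty = tube_type_join[OF join]
  have fin: "finite (upper_tubes F \<tau>')" by (rule finite_upper_tubes[OF \<tau>' finX(2)])
  have r: "r \<notin> U" if "U \<in> upper_tubes F \<tau>''" for U using root_upper''(2)[OF join that] .
  have sub: "U \<subset> P" if "U \<in> upper_tubes F \<tau>'" for U using in_upper'(2)[OF join that] .
  let ?up = "\<lambda>\<tau> U. {U' \<in> upper_tubes F \<tau>. r \<in> U' \<and> U \<subset> U'}"
  have P: "?up \<tau> P = {}"
    unfolding up using r sub by blast
  have U: "?up \<tau> U = insert P (?up \<tau>' U)" "P \<notin> ?up \<tau>' U" if "U \<in> upper_tubes F \<tau>'" for U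
    unfolding up using r sub[OF that] subs(4) upper_disjoint(1)[OF join] by blast+
  have "{U \<in> upper_tubes F \<tau>. r \<in> U \<and> \<not> card (?up \<tau> U) < Suc (Suc k) - 1} =
      {U \<in> upper_tubes F \<tau>'. r \<in> U \<and> \<not> card (?up \<tau>' U) < Suc k - 1}" (is "?L = ?R")
  proof (intro set_eqI)
    fix U
    consider "U = P" | "U \<in> upper_tubes F \<tau>'" | "U \<in> upper_tubes F \<tau>''" "U \<noteq> P" "U \<notin> upper_tubes F \<tau>'" | "U \<notin> upper_tubes F \<tau>"
      unfolding up using upper_disjoint[OF join] by blast
    then show "U \<in> ?L \<longleftrightarrow> U \<in> ?R"
    proof cases
      case 1
      have "P \<notin> ?L" by (simp only: mem_Collect_eq P card.empty) simp
      moreover have "P \<notin> ?R" using upper_disjoint(1)[OF join] by simp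
      ultimately show ?thesis using 1 by metis
    next
      case 2
      have "card (?up \<tau> U) = Suc (card (?up \<tau>' U))"
        using fin U(2)[OF 2] unfolding U(1)[OF 2] by simp
      then show ?thesis using 2 by (simp add: up)
    next
      case 3
      then show ?thesis using r by simp
    next
      case 4
      then show ?thesis by (auto simp: up)
    qed
  qed
  then show ?thesis
    unfolding beta_at_def count_types_def by (auto intro!: sum.cong simp: ty)
qed

end

context forest_tubings
begin

text \<open>Nothing is excluded for index 1, and an upper tube contains \<open>r\<close> precisely
  when \<open>r\<close> is its root, \<open>r\<close> having no parent in \<open>X\<close>.\<close>

lemma beta_1:
  assumes X: "X \<subseteq> V" "is_tree R X r" and \<tau>: "\<tau> \<in> Tub_on F X"
  shows "beta_at F r \<tau> 1 = rk F \<tau> r"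
proof -
  have "r \<in> U \<longleftrightarrow> root_of F U = r" if U: "U \<in> upper_tubes F \<tau>" for U
  proof -
    have U\<tau>: "U \<in> \<tau>" "U \<subseteq> X" using upper_tubes_subset[OF \<tau>] U by blast+
    then obtain s where s: "is_tree R U s" using tube_tree Tub_onD(1)[OF \<tau>] by metis
    have "root_of F U = s" using root_of_tree[OF _ s] U\<tau>(2) X(1) by blast
    then show ?thesis using s tree_root_mem[OF X(2) s U\<tau>(2)] by (auto simp: is_tree_def)
  qed
  then show ?thesis
    unfolding beta_at_def rk_def by (auto intro!: arg_cong[of _ _ "count_types F \<tau>"])
qed

lemma rk_singleton: "rk F {{r}} x = 0"
proof -
  have "upper_tubes F {{r}} = {}"
    by (auto simp: upper_tubes_def upper_lower_def max_subtubes_def)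
  then show ?thesis by (simp add: rk_def count_types_def)
qed

text \<open>The split vertex and the two parts can be recovered from the joined tubing, so outermost
  splits give a bijection between tubings and triples.\<close>

lemma sum_Tub_on:
  assumes X: "X \<subseteq> V" "is_tree R X r" "X \<noteq> {r}"
  shows "(\<Sum>\<tau>\<in>Tub_on F X. f \<tau>) = (\<Sum>v\<in>X - {r}. \<Sum>\<tau>'\<in>Tub_on F (X - desc R X v).
    \<Sum>\<tau>''\<in>Tub_on F (desc R X v). f (insert X (\<tau>' \<union> \<tau>'')))"
proof -
  let ?P = "\<lambda>v. X - desc R X v" and ?Q = "\<lambda>v. desc R X v"
  let ?S = "SIGMA v:X - {r}. Tub_on F (?P v) \<times> Tub_on F (?Q v)"
  let ?j = "\<lambda>(v, \<tau>', \<tau>''). insert X (\<tau>' \<union> \<tau>'')"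
  have split: "tubing_split F X r v" if "v \<in> X - {r}" for v
    by unfold_locales (use X that in auto)
  have fin: "finite (Tub_on F Y)" if "Y \<subseteq> X" for Y
    using finite_Tub_on(1) X(1) finV that by (metis finite_subset)
  have dsub: "?Q v \<subseteq> X" if "v \<in> X" for v by (rule desc_subset[OF that])
  have inj: "inj_on ?j ?S"
  proof (rule inj_onI)
    fix s t assume s: "s \<in> ?S" and t: "t \<in> ?S" and eq: "?j s = ?j t"
    obtain v \<tau>' \<tau>'' where sv: "s = (v, \<tau>', \<tau>'')" by (cases s)
    obtain w \<sigma>' \<sigma>'' where tw: "t = (w, \<sigma>', \<sigma>'')" by (cases t)
    have v: "v \<in> X - {r}" "\<tau>' \<in> Tub_on F (?P v)" "\<tau>'' \<in> Tub_on F (?Q v)" using s sv by auto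
    have w: "w \<in> X - {r}" "\<sigma>' \<in> Tub_on F (?P w)" "\<sigma>'' \<in> Tub_on F (?Q w)" using t tw by auto
    \<comment> \<open>The piece left by cutting at \<open>v\<close> is a member other than
      \<open>X\<close> containing \<open>r\<close>, so it belongs to the part of the other splitting
      that contains \<open>r\<close>. By symmetry the two cut-off subtrees coincide, and
      antisymmetry then gives equal vertices.\<close>
    have aux: "?Q w \<subseteq> ?Q v"
      if v: "v \<in> X - {r}" "\<tau>' \<in> Tub_on F (?P v)" "\<tau>'' \<in> Tub_on F (?Q v)"
        and w: "w \<in> X - {r}" "\<sigma>' \<in> Tub_on F (?P w)" "\<sigma>'' \<in> Tub_on F (?Q w)"
        and eq: "insert X (\<tau>' \<union> \<tau>'') = insert X (\<sigma>' \<union> \<sigma>'')"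
      for v \<tau>' \<tau>'' w \<sigma>' \<sigma>''
    proof -
      interpret v: tubing_split F X r v by (rule split[OF v(1)])
      interpret w: tubing_split F X r w by (rule split[OF w(1)])
      have "?P v \<in> insert X (\<sigma>' \<union> \<sigma>'')"
        unfolding eq[symmetric] using v.in_split(1)[OF v(2,3) refl] by simp
      moreover have "?P v \<notin> \<sigma>''"
      proof
        assume "?P v \<in> \<sigma>''"
        then have "?P v \<subseteq> ?Q w" by (rule w.in_\<tau>''(1)[OF w(2,3) refl])
        then show False using v.subs(4) w.subs(4) by blast
      qed
      ultimately have "?P v \<in> \<sigma>'" using v.subs(7) by blast
      then have "?P v \<subseteq> ?P w" by (rule w.in_\<tau>'(1)[OF w(2,3) refl])
      then show ?thesis using dsub w(1) by blast
    qed
    have eq': "insert X (\<tau>' \<union> \<tau>'') = insert X (\<sigma>' \<union> \<sigma>'')" using eq sv tw by simp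
    have "?Q v = ?Q w" using aux[OF v w eq'] aux[OF w v eq'[symmetric]] by blast
    then have vw: "v = w" using desc_antisym desc_self by metis
    interpret v: tubing_split F X r v by (rule split[OF v(1)])
    have rec: "\<tau>' = {Y \<in> insert X (\<tau>' \<union> \<tau>''). Y \<subseteq> ?P v}" "\<tau>'' = {Y \<in> insert X (\<tau>' \<union> \<tau>''). Y \<subseteq> ?Q v}"
      if "\<tau>' \<in> Tub_on F (?P v)" "\<tau>'' \<in> Tub_on F (?Q v)" for \<tau>' \<tau>''
      using v.in_\<tau>'(1,2)[OF that refl] v.in_\<tau>''(1,2)[OF that refl] v.subs(7,8) by blast+
    have "\<tau>' = \<sigma>'" "\<tau>'' = \<sigma>''"
      using rec[OF v(2,3)] rec[OF w(2,3)[folded vw]] eq' by metis+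
    then show "s = t" by (simp add: sv tw vw)
  qed
  have "?j ` ?S = Tub_on F X"
  proof
    show "?j ` ?S \<subseteq> Tub_on F X"
      using tubing_split.join_Tub_on[OF split] by fastforce
    show "Tub_on F X \<subseteq> ?j ` ?S"
    proof
      fix \<tau> assume \<tau>: "\<tau> \<in> Tub_on F X"
      obtain v where v: "v \<in> X" "v \<noteq> r" "\<And>Y. Y \<in> \<tau> \<Longrightarrow> Y = X \<or> Y \<subseteq> ?P v \<or> Y \<subseteq> ?Q v"
        using Tub_on_split[OF \<tau> X] by metis
      interpret v: tubing_split F X r v by (rule split) (use v in simp)
      show "\<tau> \<in> ?j ` ?S"
        using v(1,2) v.Tub_on_restrict[OF \<tau> v(3)]
        by (intro image_eqI[of _ _ "(v, {Y \<in> \<tau>. Y \<subseteq> ?P v}, {Y \<in> \<tau>. Y \<subseteq> ?Q v})"]) simp_all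
    qed
  qed
  then have "(\<Sum>\<tau>\<in>Tub_on F X. f \<tau>) = (\<Sum>s\<in>?S. f (?j s))"
    using sum.reindex[OF inj, of f] by (simp add: o_def)
  also have "\<dots> = (\<Sum>v\<in>X - {r}. \<Sum>p\<in>Tub_on F (?P v) \<times> Tub_on F (?Q v). f (?j (v, p)))"
    using fin dsub finV X(1) finite_subset
    by (subst sum.Sigma) (auto simp: case_prod_beta intro: finite_subset)
  also have "\<dots> = (\<Sum>v\<in>X - {r}. \<Sum>\<tau>'\<in>Tub_on F (?P v). \<Sum>\<tau>''\<in>Tub_on F (?Q v). f (insert X (\<tau>' \<union> \<tau>'')))"
    by (intro sum.cong refl) (simp add: sum.cartesian_product case_prod_beta)
  finally show ?thesis .
qed

end

section \<open>The tubing expansion\<close>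

text \<open>The Mellin monomial of a tubing of the subtree on \<open>X\<close> with root
  \<open>r\<close>, computed inside the whole forest.\<close>

definition mel_at :: "('i \<Rightarrow> 'e mindex \<Rightarrow> 'k::comm_ring_1) \<Rightarrow> ('v, 'i, 'e) forest \<Rightarrow> 'v set \<Rightarrow> 'v \<Rightarrow>
    'v set set \<Rightarrow> 'k" where
  "mel_at a F X r \<tau> = (\<Prod>x\<in>X - {r}. a (vdec F x) (rk F \<tau> x))"

text \<open>The vertex \<open>v\<close> is the root of \<open>Q\<close> but not of \<open>X\<close>,
  so it contributes a factor missing from the Mellin monomial of the lower part. This factor makes
  the lower part a summand of the linear coefficient of \<open>Phi Q\<close>.\<close>

lemma (in tubing_split) mel_join:
  assumes join: "\<tau>' \<in> Tub_on F P" "\<tau>'' \<in> Tub_on F Q" "\<tau> = insert X (\<tau>' \<union> \<tau>'')"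
  shows "mel_at a F X r \<tau> = mel_at a F P r \<tau>' * (mel_at a F Q v \<tau>'' * a (vdec F v) (rk F \<tau>'' v))"
proof -
  let ?f = "\<lambda>x. a (vdec F x) (rk F \<tau> x)"
  have "X - {r} = (P - {r}) \<union> Q" "(P - {r}) \<inter> Q = {}" using subs by blast+
  then have "mel_at a F X r \<tau> = (\<Prod>x\<in>P - {r}. ?f x) * (\<Prod>x\<in>Q. ?f x)"
    using finX unfolding mel_at_def by (simp add: prod.union_disjoint)
  also have "(\<Prod>x\<in>P - {r}. ?f x) = mel_at a F P r \<tau>'"
    unfolding mel_at_def by (intro prod.cong refl) (simp add: rk_join(1)[OF join])
  also have "(\<Prod>x\<in>Q. ?f x) = (\<Prod>x\<in>Q. a (vdec F x) (rk F \<tau>'' x))"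
    by (intro prod.cong refl) (simp add: rk_join(2)[OF join])
  also have "\<dots> = mel_at a F Q v \<tau>'' * a (vdec F v) (rk F \<tau>'' v)"
    by (simp add: mel_at_def prod.remove[OF finX(3) subs(5)] mult.commute)
  finally show ?thesis .
qed

locale decorated_tubings = forest_tubings F + cocycles I E \<Lambda> a
  for F :: "('v, 'i, 'e) forest" and I :: "'i set" and E :: "'i \<Rightarrow> 'e set"
    and \<Lambda> :: "'i \<Rightarrow> ('e, 'k::field_char_0) mpol \<Rightarrow> 'k poly"
    and a :: "'i \<Rightarrow> 'e mindex \<Rightarrow> 'k" +
  assumes wd: "well_decorated I E F"
begin

sublocale decorated R I E \<Lambda> a "vdec F" "edec F" V
  by (rule decorated_forest[OF F wd])

lemma Phi_coeff_0:
  assumes X: "X \<subseteq> V" "X \<noteq> {}"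
  shows "coeff (Phi X) 0 = 0"
proof -
  obtain r where r: "r \<in> X" "\<And>u. u \<in> X \<Longrightarrow> (u, r) \<notin> R"
    using exists_root[OF finite_sub[OF X(1)] X(2)] by blast
  let ?S = "{v. v \<in> X \<and> (\<forall>u\<in>X. (u, v) \<notin> R)}"
  have "coeff (pol (vdec F) (edec F) (induced R X) r) 0 = 0"
    unfolding Phi_desc[OF X(1) r(1), symmetric]
    by (rule Phi_tree_0[OF order_trans[OF desc_subset[OF r(1)] X(1)] tree_subtree[OF r(1)]])
  moreover have "finite ?S" "r \<in> ?S" using r finite_sub[OF X(1)] by simp_all
  ultimately show ?thesis
    unfolding phi_def by (simp add: prod.remove coeff_mult_0)
qed

text \<open>A nonempty branch has a polynomial without constant term, so the product has one only if
  all branches are empty.\<close>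

lemma lookup_branch_poly_0:
  assumes X: "X \<subseteq> V" "is_tree R X r"
  shows "lookup (branch_poly X r) 0 = (if X = {r} then 1 else 0)"
proof -
  have r: "r \<in> X" using X by (simp add: is_tree_def)
  have fin: "finite (E (vdec F r))" using finite_E d X(1) r by blast
  have lk: "lookup (branch_poly X r) 0 = (\<Prod>e\<in>E (vdec F r). coeff (Phi (branch R (edec F) X r e)) 0)"
    by (simp add: branch_poly_def lookup_mprod[OF fin])
  have un: "X - {r} = (\<Union>e\<in>E (vdec F r). branch R (edec F) X r e)"
    using \<epsilon> X(1) r by (intro tree_branches[OF X(2)]) blast
  show ?thesis
  proof (cases "X = {r}")
    case True
    then have "branch R (edec F) X r e = {}" if "e \<in> E (vdec F r)" for e
      using un that by blast
    then have "lookup (branch_poly X r) 0 = 1" unfolding lk by simp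
    then show ?thesis using True by simp
  next
    case False
    then obtain e where e: "e \<in> E (vdec F r)" "branch R (edec F) X r e \<noteq> {}"
      using un r by blast
    have "coeff (Phi (branch R (edec F) X r e)) 0 = 0"
      by (rule Phi_coeff_0[OF order_trans[OF branch_subset X(1)] e(2)])
    then show ?thesis using False e(1) fin unfolding lk by (auto simp: prod_zero_iff)
  qed
qed

theorem lin_ext_branch_poly:
  assumes "X \<subseteq> V" "is_tree R X r"
  shows "lin_ext (\<lambda>\<gamma>. fact (mi_deg \<gamma>) * g \<gamma>) (branch_poly X r) =
    (\<Sum>\<tau>\<in>Tub_on F X. mel_at a F X r \<tau> * g (rk F \<tau> r))"
  using assms
proof (induction "card X" arbitrary: X r g rule: less_induct)
  case less
  note X = less.prems
  have r: "r \<in> X" "r \<in> V" using X by (auto simp: is_tree_def)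
  have dr: "vdec F r \<in> I" using d r by blast
  have fin: "finite X" by (rule finite_sub[OF X(1)])
  show ?case
  proof (cases "X = {r}")
    \<comment> \<open>No vertex can be cut off: only the constant term of the branch polynomial is
      left, and the only tubing has rank 0.\<close>
    case True
    have "Tub_on F X = {{{r}}}" using Tub_on_singleton[OF r(2)] True by simp
    moreover have "branch R (edec F) X r e = {}" for e
      using branch_subset[of R "edec F" X r e] branch_root[of r "edec F" X e] True by blast
    then have "partial_d e (branch_poly X r) = 0" if "e \<in> E (vdec F r)" for e
      by (simp add: partial_d_branch_poly[OF X(1) r(1) that])
    moreover have "lookup (branch_poly X r) 0 = 1" using lookup_branch_poly_0[OF X] True by simp
    moreover have "mel_at a F X r {{r}} = 1" using True by (simp add: mel_at_def)
    ultimately show ?thesis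
      by (subst lin_ext_fact_partial_d[OF finite_E[OF dr] branch_poly_mpol[OF X(1) r(1)]]) (simp add: rk_singleton)
  next
    case False
    \<comment> \<open>The decoration becomes a function of the vertex, so that
      \<open>sum_branches\<close> can merge the sums over decorations and over branches into one sum
      over non-root vertices.\<close>
    define ty where "ty v = (THE e. v \<in> branch R (edec F) X r e)" for v
    have ty: "ty v = e" if "v \<in> branch R (edec F) X r e" for v e
      unfolding ty_def by (rule the_equality, rule that, rule branch_disjoint[OF _ that])
    let ?G = "\<lambda>v. (\<Sum>\<tau>''\<in>Tub_on F (desc R X v). mel_at a F (desc R X v) v \<tau>'' * a (vdec F v) (rk F \<tau>'' v)) *
        (\<Sum>\<tau>'\<in>Tub_on F (X - desc R X v). mel_at a F (X - desc R X v) r \<tau>' * g (rk F \<tau>' r + single (ty v) 1))"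
    have step: "sig (desc R X v) * lin_ext (\<lambda>\<gamma>. fact (mi_deg \<gamma>) * g (\<gamma> + single e 1)) (branch_poly (X - desc R X v) r) = ?G v"
      if ve: "v \<in> branch R (edec F) X r e" for v e
    proof -
      have v: "v \<in> X" "v \<noteq> r"
        using ve branch_subset[of R "edec F" X r e] branch_root[of r "edec F" X e] by auto
      interpret s: tubing_split F X r v
        by unfold_locales (use X v in auto)
      have dv: "vdec F v \<in> I" using d v X(1) by blast
      have "sig (desc R X v) = coeff (\<Lambda> (vdec F v) (branch_poly (desc R X v) v)) 1"
        by (simp only: Phi_tree[OF s.subs(2) s.trees(2)])
      also have "\<dots> = lin_ext (\<lambda>\<gamma>. fact (mi_deg \<gamma>) * a (vdec F v) \<gamma>) (branch_poly (desc R X v) v)"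
        by (rule cocycle_coeff_1[OF cocycle[OF dv] coeffs[OF dv] branch_poly_mpol[OF s.subs(2,5)]])
      \<comment> \<open>The induction hypothesis with the coefficients at \<open>v\<close> in place
        of \<open>g\<close>; for the piece containing \<open>r\<close> it is used with the shifted
        \<open>g\<close>.\<close>
      also have "\<dots> = (\<Sum>\<tau>''\<in>Tub_on F (desc R X v). mel_at a F (desc R X v) v \<tau>'' * a (vdec F v) (rk F \<tau>'' v))"
        by (rule less.hyps[OF psubset_card_mono[OF fin s.subs(8)] s.subs(2) s.trees(2)])
      finally show ?thesis
        by (simp only: less.hyps[OF psubset_card_mono[OF fin s.subs(7)] s.subs(1) s.trees(1)] ty[OF ve])
    qed
    have "lin_ext (\<lambda>\<gamma>. fact (mi_deg \<gamma>) * g \<gamma>) (branch_poly X r) =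
        (\<Sum>e\<in>E (vdec F r). lin_ext (\<lambda>\<gamma>. fact (mi_deg \<gamma>) * g (\<gamma> + single e 1)) (partial_d e (branch_poly X r)))"
      by (subst lin_ext_fact_partial_d[OF finite_E[OF dr] branch_poly_mpol[OF X(1) r(1)]])
        (simp add: lookup_branch_poly_0[OF X] False)
    also have "\<dots> = (\<Sum>e\<in>E (vdec F r). \<Sum>v\<in>branch R (edec F) X r e. ?G v)"
    proof (rule sum.cong[OF refl])
      fix e assume e: "e \<in> E (vdec F r)"
      show "lin_ext (\<lambda>\<gamma>. fact (mi_deg \<gamma>) * g (\<gamma> + single e 1)) (partial_d e (branch_poly X r)) =
          (\<Sum>v\<in>branch R (edec F) X r e. ?G v)"
        unfolding partial_d_branch_poly[OF X(1) r(1) e] lin_ext_sum lin_ext_scale by (intro sum.cong refl step)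
    qed
    also have "\<dots> = (\<Sum>v\<in>X - {r}. ?G v)"
      by (rule sum_branches[OF X])
    also have "\<dots> = (\<Sum>v\<in>X - {r}. \<Sum>\<tau>'\<in>Tub_on F (X - desc R X v). \<Sum>\<tau>''\<in>Tub_on F (desc R X v).
        mel_at a F X r (insert X (\<tau>' \<union> \<tau>'')) * g (rk F (insert X (\<tau>' \<union> \<tau>'')) r))"
    proof (rule sum.cong[OF refl])
      fix v assume v: "v \<in> X - {r}"
      interpret s: tubing_split F X r v
        by unfold_locales (use X v in auto)
      have "X - {r} = (\<Union>e\<in>E (vdec F r). branch R (edec F) X r e)"
        using \<epsilon> X(1) r by (intro tree_branches[OF X(2)]) blast
      then obtain e where ve: "v \<in> branch R (edec F) X r e" using v by blast
      have "?G v = (\<Sum>\<tau>'\<in>Tub_on F (X - desc R X v). \<Sum>\<tau>''\<in>Tub_on F (desc R X v).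
        (mel_at a F (desc R X v) v \<tau>'' * a (vdec F v) (rk F \<tau>'' v)) *
        (mel_at a F (X - desc R X v) r \<tau>' * g (rk F \<tau>' r + single e 1)))"
        unfolding sum_product ty[OF ve] by (rule sum.swap)
      also have "\<dots> = (\<Sum>\<tau>'\<in>Tub_on F (X - desc R X v). \<Sum>\<tau>''\<in>Tub_on F (desc R X v).
        mel_at a F X r (insert X (\<tau>' \<union> \<tau>'')) * g (rk F (insert X (\<tau>' \<union> \<tau>'')) r))"
        by (intro sum.cong refl)
          (simp only: s.mel_join[OF _ _ refl] s.rk_join(3)[OF _ _ refl ve] mult_ac)
      finally show "?G v = \<dots>" .
    qed
    also have "\<dots> = (\<Sum>\<tau>\<in>Tub_on F X. mel_at a F X r \<tau> * g (rk F \<tau> r))"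
      by (rule sum_Tub_on[OF X False, symmetric])
    finally show ?thesis .
  qed
qed

lemma sig_tree:
  assumes X: "X \<subseteq> V" "is_tree R X r"
  shows "sig X = (\<Sum>\<tau>\<in>Tub_on F X. mel_at a F X r \<tau> * a (vdec F r) (rk F \<tau> r))"
proof -
  have r: "r \<in> X" using X by (simp add: is_tree_def)
  then have dr: "vdec F r \<in> I" using d X(1) by blast
  have "sig X = coeff (\<Lambda> (vdec F r) (branch_poly X r)) 1"
    by (simp only: Phi_tree[OF X])
  also have "\<dots> = lin_ext (\<lambda>\<gamma>. fact (mi_deg \<gamma>) * a (vdec F r) \<gamma>) (branch_poly X r)"
    by (rule cocycle_coeff_1[OF cocycle[OF dr] coeffs[OF dr] branch_poly_mpol[OF X(1) r]])
  finally show ?thesis by (simp only: lin_ext_branch_poly[OF X])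
qed

text \<open>The condition in the \<open>if\<close> encodes the upper limit k \<le> b(\<tau>), so
  that each power of L has a sum over all tubings. Undoing the outermost split lowers both the index
  and the number of tubes through the root by one, so the condition is preserved.\<close>

theorem coeff_Phi_tree:
  assumes "X \<subseteq> V" "is_tree R X r"
  shows "fact (Suc k) * coeff (Phi X) (Suc k) = (\<Sum>\<tau>\<in>Tub_on F X. mel_at a F X r \<tau> *
    (if Suc k \<le> card {Y \<in> \<tau>. r \<in> Y} then a (vdec F r) (beta_at F r \<tau> (Suc k)) else 0))"
  using assms
proof (induction k arbitrary: X)
  case 0
  note X = "0.prems"
  have fin: "finite X" by (rule finite_sub[OF X(1)])
  have "1 \<le> card {Y \<in> \<tau>. r \<in> Y}" if \<tau>: "\<tau> \<in> Tub_on F X" for \<tau>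
  proof -
    have "X \<in> {Y \<in> \<tau>. r \<in> Y}" using whole_in_Tub_on[OF \<tau> X(2,1)] X(2) by (simp add: is_tree_def)
    moreover have "finite {Y \<in> \<tau>. r \<in> Y}" using finite_Tub_on(2)[OF fin \<tau>] by simp
    ultimately have "0 < card {Y \<in> \<tau>. r \<in> Y}" using card_gt_0_iff by blast
    then show ?thesis by simp
  qed
  then show ?case
    using sig_tree[OF X] beta_1[OF X] by (auto intro!: sum.cong)
next
  case (Suc k)
  note X = Suc.prems
  let ?w = "\<lambda>X k \<tau>. mel_at a F X r \<tau> * (if k \<le> card {Y \<in> \<tau>. r \<in> Y} then a (vdec F r) (beta_at F r \<tau> k) else 0)"
  have r: "r \<in> X" "r \<in> V" "desc R X r = X" using X by (auto simp: is_tree_def)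
  have fin: "finite X" by (rule finite_sub[OF X(1)])
  have "fact (Suc (Suc k)) * coeff (Phi X) (Suc (Suc k)) = fact (Suc k) * coeff (pderiv (Phi X)) (Suc k)"
    by (simp add: coeff_pderiv algebra_simps)
  \<comment> \<open>The summand of the root is constant and has no coefficient in positive
    degree.\<close>
  also have "\<dots> = (\<Sum>v\<in>X - {r}. sig (desc R X v) * (fact (Suc k) * coeff (Phi (X - desc R X v)) (Suc k)))"
    unfolding pderiv_Phi[OF X(1)]
    by (simp only: coeff_sum coeff_smult sum.remove[OF fin r(1)] r(3) Diff_cancel phi_empty sum_distrib_left)
      (simp add: coeff_1 coeff_sum sum_distrib_left mult_ac)
  also have "\<dots> = (\<Sum>\<tau>\<in>Tub_on F X. ?w X (Suc (Suc k)) \<tau>)"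
  proof (cases "X = {r}")
    \<comment> \<open>Both sides are 0: there is nothing to cut off, and the only tubing has a
      single tube, fewer than \<open>Suc (Suc k)\<close>.\<close>
    case True
    have "Tub_on F X = {{{r}}}" using Tub_on_singleton[OF r(2)] True by simp
    moreover have "{Y. Y = {r} \<and> r \<in> Y} = {{r}}" by blast
    ultimately show ?thesis by (simp add: True)
  next
    case False
    show ?thesis
      unfolding sum_Tub_on[OF X False]
    proof (rule sum.cong[OF refl])
      fix v assume v: "v \<in> X - {r}"
      interpret s: tubing_split F X r v
        by unfold_locales (use X v in auto)
      have "sig (desc R X v) * (fact (Suc k) * coeff (Phi (X - desc R X v)) (Suc k)) =
          (\<Sum>\<tau>''\<in>Tub_on F (desc R X v). mel_at a F (desc R X v) v \<tau>'' * a (vdec F v) (rk F \<tau>'' v)) *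
          (\<Sum>\<tau>'\<in>Tub_on F (X - desc R X v). ?w (X - desc R X v) (Suc k) \<tau>')"
        by (simp only: sig_tree[OF s.subs(2) s.trees(2)] Suc.IH[OF s.subs(1) s.trees(1)])
      also have "\<dots> = (\<Sum>\<tau>'\<in>Tub_on F (X - desc R X v). \<Sum>\<tau>''\<in>Tub_on F (desc R X v).
          mel_at a F (desc R X v) v \<tau>'' * a (vdec F v) (rk F \<tau>'' v) * ?w (X - desc R X v) (Suc k) \<tau>')"
        unfolding sum_product by (rule sum.swap)
      also have "\<dots> = (\<Sum>\<tau>'\<in>Tub_on F (X - desc R X v). \<Sum>\<tau>''\<in>Tub_on F (desc R X v).
          ?w X (Suc (Suc k)) (insert X (\<tau>' \<union> \<tau>'')))"
        by (intro sum.cong refl)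
          (simp only: s.mel_join[OF _ _ refl] s.card_root_join[OF _ _ refl] s.beta_join[OF _ _ refl]
            Suc_le_mono mult_ac)
      finally show "sig (desc R X v) * (fact (Suc k) * coeff (Phi (X - desc R X v)) (Suc k)) = \<dots>" .
    qed
  qed
  finally show ?case .
qed

theorem forest_poly_tree:
  assumes t: "rooted_tree F"
  shows "forest_poly F = (\<Sum>\<tau>\<in>Tub F. smult (mel a F \<tau>)
    (\<Sum>k=1..b_stat F \<tau>. monom (a (vdec F (rt F)) (beta_stat F \<tau> k) / fact k) k))"
proof (rule poly_eqI)
  fix n
  have "tube F V" using t by (simp add: rooted_tree_def tube_def)
  then obtain r where tree: "is_tree R V r" by (rule tube_tree)
  have rt: "rt F = r" by (rule root_of_tree[OF order_refl tree])
  have V: "V \<noteq> {}" using t by (simp add: rooted_tree_def)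
  have FP: "forest_poly F = Phi V" by (simp add: forest_poly_def)
  have c: "coeff (\<Sum>k=1..b. monom (g k / fact k) k) n = (if 1 \<le> n \<and> n \<le> b then g n / fact n else 0)"
    for b and g :: "nat \<Rightarrow> 'k"
    by (simp add: coeff_sum)
  have mel: "mel a F \<tau> = mel_at a F V r \<tau>" "b_stat F \<tau> = card {Y \<in> \<tau>. r \<in> Y}"
    "beta_stat F \<tau> k = beta_at F r \<tau> k" for \<tau> k
    by (simp_all add: mel_def mel_at_def b_stat_def beta_stat_def beta_at_def rt)
  show "coeff (forest_poly F) n = coeff (\<Sum>\<tau>\<in>Tub F. smult (mel a F \<tau>)
    (\<Sum>k=1..b_stat F \<tau>. monom (a (vdec F (rt F)) (beta_stat F \<tau> k) / fact k) k)) n"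
  proof (cases n)
    case 0
    then show ?thesis
      using Phi_coeff_0[OF order_refl V] by (simp add: coeff_sum FP)
  next
    case (Suc k)
    have "coeff (forest_poly F) n = (fact (Suc k) * coeff (Phi V) (Suc k)) / fact (Suc k)"
      by (simp add: FP Suc del: fact_Suc)
    also have "\<dots> = (\<Sum>\<tau>\<in>Tub F. mel a F \<tau> *
        (if 1 \<le> n \<and> n \<le> b_stat F \<tau> then a (vdec F (rt F)) (beta_stat F \<tau> n) / fact n else 0))"
      unfolding coeff_Phi_tree[OF order_refl tree] mel rt Suc Tub_eq_Tub_on sum_divide_distrib
      by (intro sum.cong refl) simp
    finally show ?thesis
      by (simp only: coeff_sum[of _ "Tub F"] coeff_smult c)
  qed
qed

end

theorem theorem3p13:
  fixes I :: "'i set" and E :: "'i \<Rightarrow> 'e set"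
    and \<Lambda> :: "'i \<Rightarrow> ('e, 'k::field_char_0) mpol \<Rightarrow> 'k poly"
    and a :: "'i \<Rightarrow> 'e mindex \<Rightarrow> 'k"
  assumes "\<forall>i\<in>I. finite (E i)"
    and "\<forall>i\<in>I. one_cocycle (E i) (\<Lambda> i)"
    and "\<forall>i\<in>I. cocycle_coeffs (E i) (\<Lambda> i) (a i)"
  shows "(\<exists>!\<phi>. \<phi> \<in> extensional (forest_alg I E) \<and> universal_morphism I E \<Lambda> \<phi>) \<and>
    (\<forall>\<phi>. universal_morphism I E \<Lambda> \<phi> \<longrightarrow>
      (\<forall>t :: ('v, 'i, 'e) forest. rooted_tree t \<and> well_decorated I E t \<longrightarrow>
        \<phi> (single (cls t) 1) = 
          (\<Sum>\<tau>\<in>Tub t. smult (mel a t \<tau>)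
            (\<Sum>k=1..b_stat t \<tau>. monom (a (vdec t (rt t)) (beta_stat t \<tau> k) / fact k) k))))"
proof -
  interpret cocycles I E \<Lambda> a
    by unfold_locales (use assms in blast)+
  have "\<phi> (single (cls t) 1) =
      (\<Sum>\<tau>\<in>Tub t. smult (mel a t \<tau>)
        (\<Sum>k=1..b_stat t \<tau>. monom (a (vdec t (rt t)) (beta_stat t \<tau> k) / fact k) k))"
    if "universal_morphism I E \<Lambda> \<phi>" "rooted_tree t" "well_decorated I E t"
    for \<phi> and t :: "('v, 'i, 'e) forest"
  proof -
    have t: "rooted_forest t" using that(2) by (simp add: rooted_tree_def)
    interpret decorated_tubings t I E \<Lambda> a
      by unfold_locales (use t that(3) in auto)
    show ?thesis
      using universal_cls[OF that(1) t that(3)] forest_poly_tree[OF that(2)] by simp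
  qed
  then show ?thesis using universal_unique by blast
qed

end
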